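(* Consider the two-word naming game on the complete graph with $n$ vertices, with $\Phi_t=(X_t,Y_t,Z_t)$ the numbers of individuals of types $A$, $B$, $AB$ at time $t$. Let $\gamma=1+(-4+2\sqrt5)^{-1}$, $\Phi^A=(n,0,0)$, $\Phi^B=(0,n,0)$, and $$T_c=\inf\{t:\Phi_t\in\{\Phi^A,\Phi^B\}\}.$$ Then for any $\alpha>0$, $$\lim_{n\to\infty}\ \sup_{(X,Y,Z)}\mathbb{P}_{(X,Y,Z)}\big(T_c/\log n>\gamma+\alpha\big)=0,$$ $$\lim_{n\to\infty}\ \sup_{(X,Y,Z)}\mathbb{P}_{(X,Y,Z)}\big(T_c/\log n>\gamma-\alpha\big)=1,$$ where the suprema are over all $(X,Y,Z)\in\mathbb{Z}_{\ge0}^3$ with $X+Y+Z=n$.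
   Context: Two-word naming game on the complete graph: there are $n\ge2$ individuals, each having a vocabulary equal to one of $\{A\}$, $\{B\}$, $\{A,B\}$ (types $A$, $B$, $AB$). Each individual $v$, at the times of an independent rate-one Poisson process, chooses a listener $w$ uniformly among the other $n-1$ individuals and speaks to $w$ a word chosen uniformly at random from $v$'s vocabulary. If the listener already knows that word, then both speaker and listener reduce their vocabulary to that single word; otherwise the listener adds the word to her vocabulary and the speaker is unchanged. $X_t,Y_t,Z_t$ denote the numbers of individuals of types $A,B,AB$ at time $t$; $\Phi_t=(X_t,Y_t,Z_t)$ is a continuous-time Markov chain whose only absorbing states are $\Phi^A$ and $\Phi^B$. $\mathbb{P}_{(X,Y,Z)}$ is the law of the process started from $\Phi_0=(X,Y,Z)$. *)

theory Defs
  imports "HOL-Probability.Probability"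
begin

datatype word = WordA | WordB

lemma UNIV_word: "UNIV = {WordA, WordB}"
  using word.exhaust by auto

text \<open>
  Individuals are the naturals below \<open>n\<close>; a configuration gives each individual its vocabulary.
  The pair \<open>(X, Y)\<close> determines \<open>Z = n - X - Y\<close>. Individuals are exchangeable, so starting
  the counting process from \<open>(X, Y, Z)\<close> may be realised by any one configuration with these counts.
\<close>

type_synonym config = "nat \<Rightarrow> word set"

definition initial_config :: "nat \<Rightarrow> nat \<Rightarrow> config" where
  "initial_config X Y v =
     (if v < X then {WordA} else if v < X + Y then {WordB} else {WordA, WordB})"

definition type_counts :: "nat \<Rightarrow> config \<Rightarrow> nat \<times> nat \<times> nat" where
  "type_counts n \<sigma> =
     (card {v. v < n \<and> \<sigma> v = {WordA}},
      card {v. v < n \<and> \<sigma> v = {WordB}},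
      card {v. v < n \<and> \<sigma> v = {WordA, WordB}})"

lemma type_counts_initial_config:
  assumes "X + Y + Z = n"
  shows "type_counts n (initial_config X Y) = (X, Y, Z)"
proof -
  have "{v. v < n \<and> initial_config X Y v = {WordA}} = {..<X}"
    and "{v. v < n \<and> initial_config X Y v = {WordB}} = {X..<X + Y}"
    and "{v. v < n \<and> initial_config X Y v = {WordA, WordB}} = {X + Y..<n}"
    using assms by (auto simp: initial_config_def split: if_splits)
  with assms show ?thesis
    by (simp add: type_counts_def)
qed

text \<open>
  The word spoken from vocabulary \<open>V\<close>, given an independent fair word \<open>u\<close>: for \<open>V = {A, B}\<close> this
  is uniform on \<open>V\<close>, and a one-word vocabulary leaves no choice.
\<close>

definition spoken_word :: "word set \<Rightarrow> word \<Rightarrow> word" where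
  "spoken_word V u = (if u \<in> V then u else the_elem V)"

definition speak :: "nat \<Rightarrow> nat \<Rightarrow> word \<Rightarrow> config \<Rightarrow> config" where
  "speak v w u \<sigma> =
     (let s = spoken_word (\<sigma> v) u in
      if s \<in> \<sigma> w then \<sigma>(v := {s}, w := {s}) else \<sigma>(w := insert s (\<sigma> w)))"

text \<open>
  The coordinate \<open>\<omega> (v, k)\<close> holds the waiting time between the \<open>k\<close>-th and the next point of the
  rate-one Poisson process of individual \<open>v\<close>, and the listener and the fair word used at the latter.
  All coordinates, and the three components of each, are independent.
\<close>

type_synonym outcome = "nat \<times> nat \<Rightarrow> real \<times> nat \<times> word"

definition ring_measure :: "nat \<Rightarrow> nat \<Rightarrow> (real \<times> nat \<times> word) measure" where
  "ring_measure n v =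
     density lborel (exponential_density 1) \<Otimes>\<^sub>M
     (measure_pmf (pmf_of_set ({..<n} - {v})) \<Otimes>\<^sub>M measure_pmf (pmf_of_set (UNIV :: word set)))"

definition naming_space :: "nat \<Rightarrow> outcome measure" where
  "naming_space n = (\<Pi>\<^sub>M (v, k) \<in> {..<n} \<times> UNIV. ring_measure n v)"

lemma prob_space_ring_measure: "prob_space (ring_measure n v)"
  unfolding ring_measure_def
  by (intro prob_space_pair prob_space_measure_pmf prob_space_exponential_density) simp

lemma prob_space_naming_space: "prob_space (naming_space n)"
  unfolding naming_space_def
  by (rule prob_space_PiM) (auto simp: prob_space_ring_measure)

definition ring_time :: "outcome \<Rightarrow> nat \<times> nat \<Rightarrow> real" where
  "ring_time \<omega> = (\<lambda>(v, k). \<Sum>j\<le>k. fst (\<omega> (v, j)))"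

text \<open>
  The points up to time \<open>t\<close> in chronological order. Almost surely there are finitely many, at
  distinct times; otherwise ties are broken by \<open>prod_encode\<close>, and an infinite set gives \<open>[]\<close>.
\<close>

definition rings_until :: "nat \<Rightarrow> outcome \<Rightarrow> real \<Rightarrow> (nat \<times> nat) list" where
  "rings_until n \<omega> t =
     sort_key (ring_time \<omega>)
       (map prod_decode
         (sorted_list_of_set (prod_encode ` {e \<in> {..<n} \<times> UNIV. ring_time \<omega> e \<le> t})))"

definition ring_action :: "outcome \<Rightarrow> nat \<times> nat \<Rightarrow> config \<Rightarrow> config" where
  "ring_action \<omega> = (\<lambda>(v, k). case \<omega> (v, k) of (_, w, u) \<Rightarrow> speak v w u)"

definition config_at :: "nat \<Rightarrow> config \<Rightarrow> outcome \<Rightarrow> real \<Rightarrow> config" where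
  "config_at n \<sigma>\<^sub>0 \<omega> t = fold (ring_action \<omega>) (rings_until n \<omega> t) \<sigma>\<^sub>0"

definition naming_game :: "nat \<Rightarrow> nat \<Rightarrow> nat \<Rightarrow> outcome \<Rightarrow> real \<Rightarrow> nat \<times> nat \<times> nat" where
  "naming_game n X Y \<omega> t = type_counts n (config_at n (initial_config X Y) \<omega> t)"

definition consensus_time :: "nat \<Rightarrow> nat \<Rightarrow> nat \<Rightarrow> outcome \<Rightarrow> ereal" where
  "consensus_time n X Y \<omega> =
     (INF t \<in> {t. 0 \<le> t \<and> naming_game n X Y \<omega> t \<in> {(n, 0, 0), (0, n, 0)}}. ereal t)"

definition consensus_const :: real where
  "consensus_const = 1 + inverse (- 4 + 2 * sqrt 5)"

end

theory Submission
  imports Defs "HOL-Real_Asymp.Real_Asymp"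
begin

text \<open>
Write \<open>X\<close>, \<open>Y\<close>, \<open>Z\<close> for the numbers of individuals of types \<open>A\<close>, \<open>B\<close>, \<open>AB\<close>, and \<open>D = X - Y\<close>. To
leading order the fractions \<open>d = D / n\<close> and \<open>z = Z / n\<close> follow \<open>d' = z d\<close> and
\<open>z' = (1 - 4 z - z\<^sup>2 - d\<^sup>2) / 2\<close>. While \<open>d\<close> is small, \<open>z\<close> settles at \<open>g = sqrt 5 - 2\<close>, the positive root
of \<open>1 - 4 z - z\<^sup>2\<close>, and \<open>D\<close> is amplified at rate \<open>g\<close>. Noise alone makes \<open>D\<close> of order \<open>sqrt n\<close>, so \<open>D\<close>
needs time \<open>ln n / (2 g)\<close> to become macroscopic. The passage from a macroscopic lead to near
unanimity takes bounded time, and near unanimity the minority decays at rate \<open>1\<close>, which costs a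
further \<open>ln n\<close>. The sum \<open>1 + 1 / (2 g)\<close> is the constant of the theorem.

Consensus is never left, so the two probabilities are governed by the law of the configuration at
one fixed time. In the graphical construction this law is found by removing the first ring: by
lack of memory the remaining waiting times again have the law of the whole family
(\<open>emeasure_after_ring\<close>). Hence the configuration at time \<open>t\<close> is a discrete chain, one uniformly
chosen action per ring, observed after a Poisson number of steps of mean \<open>n t\<close>
(\<open>poisson_step_mean_le_prob\<close>), and that number is concentrated (\<open>poisson_deviation\<close>). It remains
to estimate \<open>survival n k \<sigma>\<close>, the probability that the chain started in \<open>\<sigma>\<close> has not reached
consensus after \<open>k\<close> steps.

No stopping times are used. An upper bound on survival is a supersolution, a function that
dominates its own one-step mean wherever it does not dominate the survival probability for another
reason (\<open>survival_le_supersolution\<close>). There is one for each stage, built from the last stage back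
to the first: a weighted size of the minority near unanimity; a linear function of \<open>d\<close> and \<open>z\<close> for
a macroscopic lead; and powers of \<open>(D\<^sup>2 + 2 n) (Z + (sqrt 5 + 2) n)\<^sup>2\<^sup>\<beta>\<close> for smaller leads. With
\<open>\<beta> = 2\<close> the factor in \<open>Z\<close> removes the fluctuations of \<open>z\<close> from the growth rate of \<open>D\<^sup>2\<close>: along the
equations above \<open>ln d + 2 ln (z + sqrt 5 + 2)\<close> has derivative \<open>g - d\<^sup>2 / (z + sqrt 5 + 2)\<close>.

The lower bound starts with \<open>X = Y\<close>. There \<open>D\<^sup>2 (z + sqrt 5 + 2)\<^sup>4\<close> has mean growth rate at most \<open>2 g\<close>
plus noise, so the lead is still below \<open>n / 2\<close> shortly before \<open>ln n / (2 g)\<close>. From then on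
\<open>exp (- c (n - D))\<close> and \<open>exp (- c (n + D))\<close>, with \<open>c\<close> decreasing at a relative rate slightly above \<open>1\<close>, are
supersolutions for consensus, which is thus unlikely during a further time slightly below \<open>ln n\<close>.
\<close>

section \<open>Thinning and reindexing an infinite product\<close>

text \<open>
Independent coordinates conditioned on separate events stay independent. The conditioning acts on
finitely many coordinates \<open>F\<close>, where \<open>c i\<close> is the probability of the event \<open>Q i\<close> and \<open>h i\<close> maps the
conditioned coordinate to its new law; \<open>\<iota>\<close> says which old coordinate becomes the new coordinate
\<open>i\<close>. Both sides are finite measures of \<open>B\<close>, so it is enough to compare them on cylinders.
\<close>

lemma emeasure_PiM_thinned_reindex:
  fixes M :: "'i \<Rightarrow> 'a measure" and M' :: "'j \<Rightarrow> 'b measure" and \<iota> :: "'i \<Rightarrow> 'j"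
  assumes M: "\<And>i. i \<in> I \<Longrightarrow> prob_space (M i)" and M': "\<And>i. i \<in> I \<Longrightarrow> prob_space (M' (\<iota> i))"
    and inj: "inj_on \<iota> I" and F: "finite F" "F \<subseteq> I"
    and h[measurable]: "\<And>i. i \<in> I \<Longrightarrow> h i \<in> measurable (M' (\<iota> i)) (M i)"
    and Q: "\<And>i. i \<in> F \<Longrightarrow> Q i \<in> sets (M' (\<iota> i))"
    and thin: "\<And>i A. i \<in> F \<Longrightarrow> A \<in> sets (M i) \<Longrightarrow>
        emeasure (M' (\<iota> i)) {x \<in> Q i. h i x \<in> A} = c i * emeasure (M i) A"
    and full: "\<And>i A. i \<in> I - F \<Longrightarrow> A \<in> sets (M i) \<Longrightarrow>
        emeasure (M' (\<iota> i)) {x \<in> space (M' (\<iota> i)). h i x \<in> A} = emeasure (M i) A"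
    and c: "\<And>i. i \<in> F \<Longrightarrow> c i < \<top>"
    and B: "B \<in> sets (PiM I M)"
  shows "emeasure (PiM (\<iota> ` I) M')
      {X \<in> space (PiM (\<iota> ` I) M'). (\<forall>i\<in>F. X (\<iota> i) \<in> Q i) \<and> (\<lambda>i\<in>I. h i (X (\<iota> i))) \<in> B}
    = (\<Prod>i\<in>F. c i) * emeasure (PiM I M) B"
proof -
  let ?P' = "PiM (\<iota> ` I) M'" and ?P = "PiM I M"
  let ?T = "\<lambda>X. \<lambda>i\<in>I. h i (X (\<iota> i))"
  define E where "E = {X \<in> space ?P'. \<forall>i\<in>F. X (\<iota> i) \<in> Q i}"
  define C where "C = (\<Prod>i\<in>F. c i)"
  interpret P: prob_space ?P using M by (rule prob_space_PiM)
  have T: "?T \<in> measurable ?P' ?P"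
  proof (rule measurable_restrict)
    fix i assume i: "i \<in> I"
    then have "(\<lambda>X. X (\<iota> i)) \<in> measurable ?P' (M' (\<iota> i))"
      by (intro measurable_component_singleton) auto
    then show "(\<lambda>X. h i (X (\<iota> i))) \<in> measurable ?P' (M i)"
      using h[OF i] by (rule measurable_compose)
  qed
  have E: "E \<in> sets ?P'"
    unfolding E_def
  proof (rule sets.sets_Collect_finite_All)
    fix i assume "i \<in> F"
    then have "(\<lambda>X. X (\<iota> i)) -` Q i \<inter> space ?P' \<in> sets ?P'"
      using F Q by (intro measurable_sets[OF measurable_component_singleton]) auto
    then show "{X \<in> space ?P'. X (\<iota> i) \<in> Q i} \<in> sets ?P'"
      by (simp add: vimage_def Int_def conj_commute)
  qed fact
  \<comment> \<open>The left-hand side as a measure in \<open>B\<close>.\<close>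
  define \<mu> where "\<mu> = distr (density ?P' (indicator E)) ?P ?T"
  define \<nu> where "\<nu> = scale_measure C ?P"
  have Cfin: "C < \<top>"
    unfolding C_def using F(1) c by (induction rule: finite_induct) (auto simp: ennreal_mult_less_top)
  have \<mu>: "emeasure \<mu> S = emeasure ?P' {X \<in> E. ?T X \<in> S}" if S: "S \<in> sets ?P" for S
  proof -
    have 1: "?T -` S \<inter> space ?P' \<in> sets ?P'" using T S by (rule measurable_sets)
    have "emeasure \<mu> S = emeasure (density ?P' (indicator E)) (?T -` S \<inter> space ?P')"
      unfolding \<mu>_def using S T by (subst emeasure_distr) auto
    also have "\<dots> = emeasure ?P' ((?T -` S \<inter> space ?P') \<inter> E)"
      using 1 E by (subst emeasure_density)
        (auto simp: indicator_inter_arith[symmetric] nn_integral_indicator sets.Int Int_commute)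
    also have "(?T -` S \<inter> space ?P') \<inter> E = {X \<in> E. ?T X \<in> S}"
      by (auto simp: E_def)
    finally show ?thesis .
  qed
  have "\<nu> = \<mu>"
  proof (rule measure_eqI_PiM_infinite)
    show "sets \<nu> = sets ?P" "sets \<mu> = sets ?P" by (simp_all add: \<mu>_def \<nu>_def)
    show "finite_measure \<nu>"
      using Cfin by (intro finite_measureI) (simp add: \<nu>_def P.emeasure_space_1 space_scale_measure)
    fix A J assume J: "finite J" "J \<subseteq> I" and A: "\<And>i. i \<in> J \<Longrightarrow> A i \<in> sets (M i)"
    define A2 where "A2 i = (if i \<in> J then A i else space (M i))" for i
    define J2 where "J2 = J \<union> F"
    define Q2 where "Q2 i = (if i \<in> F then Q i else space (M' (\<iota> i)))" for i
    define A' where "A' j = {x \<in> Q2 (the_inv_into I \<iota> j). h (the_inv_into I \<iota> j) x \<in> A2 (the_inv_into I \<iota> j)}" for j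
    have J2: "finite J2" "J2 \<subseteq> I" using J F by (auto simp: J2_def)
    have A2: "A2 i \<in> sets (M i)" for i using A by (auto simp: A2_def)
    have Q2: "Q2 i \<in> sets (M' (\<iota> i))" for i using Q by (auto simp: Q2_def)
    have A'i: "A' (\<iota> i) = {x \<in> Q2 i. h i x \<in> A2 i}" if "i \<in> I" for i
      using that inj by (simp add: A'_def the_inv_into_f_f)
    have A'_sets: "A' (\<iota> i) \<in> sets (M' (\<iota> i))" if "i \<in> I" for i
    proof -
      have "{x \<in> Q2 i. h i x \<in> A2 i} = Q2 i \<inter> (h i -` A2 i \<inter> space (M' (\<iota> i)))"
        using sets.sets_into_space[OF Q2] by auto
      then show ?thesis using A'i that measurable_sets[OF h A2] Q2 by auto
    qed
    let ?R = "prod_emb I M J (Pi\<^sub>E J A)"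
    have Rs: "?R \<in> sets ?P" using J A by (intro sets_PiM_I) auto
    have eq: "{X \<in> E. ?T X \<in> ?R} = prod_emb (\<iota> ` I) M' (\<iota> ` J2) (Pi\<^sub>E (\<iota> ` J2) A')"
    proof (intro set_eqI iffI)
      fix X assume "X \<in> {X \<in> E. ?T X \<in> ?R}"
      then have X: "X \<in> space ?P'" "\<And>i. i \<in> F \<Longrightarrow> X (\<iota> i) \<in> Q i" "\<And>i. i \<in> J \<Longrightarrow> h i (X (\<iota> i)) \<in> A i"
        using J by (auto simp: E_def prod_emb_iff PiE_iff subset_iff)
      have sp: "X (\<iota> i) \<in> space (M' (\<iota> i))" if "i \<in> I" for i using X(1) that by (auto simp: space_PiM)
      have "X (\<iota> i) \<in> A' (\<iota> i)" if "i \<in> J2" for i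
        using that J2 X(2,3) sp measurable_space[OF h sp] by (auto simp: A'i Q2_def A2_def subset_iff)
      then show "X \<in> prod_emb (\<iota> ` I) M' (\<iota> ` J2) (Pi\<^sub>E (\<iota> ` J2) A')"
        using X(1) by (auto simp: prod_emb_iff space_PiM PiE_iff)
    next
      fix X assume X: "X \<in> prod_emb (\<iota> ` I) M' (\<iota> ` J2) (Pi\<^sub>E (\<iota> ` J2) A')"
      then have 1: "X (\<iota> i) \<in> A' (\<iota> i)" if "i \<in> J2" for i using that by (auto simp: prod_emb_iff PiE_iff)
      have 2: "X \<in> space ?P'" using X by (auto simp: prod_emb_iff space_PiM PiE_iff)
      have 3: "X (\<iota> i) \<in> Q2 i \<and> h i (X (\<iota> i)) \<in> A2 i" if "i \<in> J2" for i
        using 1[OF that] J2 that by (auto simp: A'i subset_iff)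
      have 4: "X (\<iota> i) \<in> Q i" if "i \<in> F" for i using 3[of i] that by (auto simp: J2_def Q2_def)
      have 5: "h i (X (\<iota> i)) \<in> A i" if "i \<in> J" for i using 3[of i] that by (auto simp: J2_def A2_def)
      show "X \<in> {X \<in> E. ?T X \<in> ?R}"
        using 2 4 5 J measurable_space[OF T 2] by (auto simp: E_def prod_emb_iff PiE_iff subset_iff space_PiM)
    qed
    have "emeasure \<mu> ?R = emeasure ?P' (prod_emb (\<iota> ` I) M' (\<iota> ` J2) (Pi\<^sub>E (\<iota> ` J2) A'))"
      using \<mu>[OF Rs] eq by simp
    also have "\<dots> = (\<Prod>j\<in>\<iota> ` J2. emeasure (M' j) (A' j))"
      using M' J2 A'_sets by (intro emeasure_PiM_emb) auto
    also have "\<dots> = (\<Prod>i\<in>J2. emeasure (M' (\<iota> i)) (A' (\<iota> i)))"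
      using inj J2 by (subst prod.reindex) (auto intro: inj_on_subset)
    also have "\<dots> = (\<Prod>i\<in>J2. (if i \<in> F then c i else 1) * emeasure (M i) (A2 i))"
      using J2 by (intro prod.cong) (auto simp: A'i Q2_def thin full A2 subset_iff)
    also have "\<dots> = (\<Prod>i\<in>J2. (if i \<in> F then c i else 1)) * (\<Prod>i\<in>J2. emeasure (M i) (A2 i))"
      by (rule prod.distrib)
    also have "(\<Prod>i\<in>J2. (if i \<in> F then c i else 1)) = C"
      unfolding C_def by (rule prod.mono_neutral_cong_right) (use J2 in \<open>auto simp: J2_def\<close>)
    also have "(\<Prod>i\<in>J2. emeasure (M i) (A2 i)) = (\<Prod>i\<in>J. emeasure (M i) (A i))"
      by (rule prod.mono_neutral_cong_right)
         (use J2 F M in \<open>auto simp: J2_def A2_def prob_space.emeasure_space_1 subset_iff\<close>)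
    also have "(\<Prod>i\<in>J. emeasure (M i) (A i)) = emeasure ?P ?R"
      using M J A by (intro emeasure_PiM_emb[symmetric]) auto
    finally show "emeasure \<nu> ?R = emeasure \<mu> ?R" by (simp add: \<nu>_def)
  qed
  then have "emeasure \<nu> B = emeasure \<mu> B" by simp
  also have "\<dots> = emeasure ?P' {X \<in> E. ?T X \<in> B}" by (rule \<mu>[OF B])
  also have "{X \<in> E. ?T X \<in> B} = {X \<in> space ?P'. (\<forall>i\<in>F. X (\<iota> i) \<in> Q i) \<and> ?T X \<in> B}"
    unfolding E_def by blast
  finally show ?thesis unfolding \<nu>_def C_def by simp
qed

lemma sets_ring_measure[measurable_cong, simp]:
  "sets (ring_measure n v) = sets (borel \<Otimes>\<^sub>M (count_space UNIV \<Otimes>\<^sub>M count_space UNIV))"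
  unfolding ring_measure_def by (intro sets_pair_measure_cong) auto

lemma space_ring_measure[simp]: "space (ring_measure n v) = UNIV"
  by (simp add: ring_measure_def space_pair_measure)

lemma nn_integral_ring_measure:
  assumes f[measurable]: "f \<in> borel_measurable (borel \<Otimes>\<^sub>M (count_space UNIV \<Otimes>\<^sub>M count_space UNIV))"
  shows "(\<integral>\<^sup>+r. f r \<partial>ring_measure n v) =
    (\<integral>\<^sup>+p. (\<integral>\<^sup>+s. ennreal (exponential_density 1 s) * f (s, p) \<partial>lborel)
       \<partial>(measure_pmf (pmf_of_set ({..<n} - {v})) \<Otimes>\<^sub>M measure_pmf (pmf_of_set (UNIV :: word set))))"
proof -
  let ?\<mu> = "density lborel (exponential_density 1)"
  let ?\<nu> = "measure_pmf (pmf_of_set ({..<n} - {v})) \<Otimes>\<^sub>M measure_pmf (pmf_of_set (UNIV :: word set))"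
  interpret \<mu>: prob_space ?\<mu> by (rule prob_space_exponential_density) simp
  interpret \<nu>: prob_space ?\<nu> by (intro prob_space_pair prob_space_measure_pmf)
  interpret pair_sigma_finite ?\<mu> ?\<nu> by unfold_locales
  have f': "f \<in> borel_measurable (?\<mu> \<Otimes>\<^sub>M ?\<nu>)" using f by measurable
  have "(\<integral>\<^sup>+r. f r \<partial>ring_measure n v) = (\<integral>\<^sup>+p. (\<integral>\<^sup>+s. f (s, p) \<partial>?\<mu>) \<partial>?\<nu>)"
    unfolding ring_measure_def using nn_integral_snd[of f] f' by simp
  also have "\<dots> = (\<integral>\<^sup>+p. (\<integral>\<^sup>+s. ennreal (exponential_density 1 s) * f (s, p) \<partial>lborel) \<partial>?\<nu>)"
  proof (rule nn_integral_cong)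
    fix p
    have "(\<lambda>s. f (s, p)) \<in> borel_measurable borel"
      by (rule measurable_compose[OF _ f]) (simp add: space_pair_measure)
    then show "(\<integral>\<^sup>+s. f (s, p) \<partial>?\<mu>) = (\<integral>\<^sup>+s. ennreal (exponential_density 1 s) * f (s, p) \<partial>lborel)"
      by (subst nn_integral_density) auto
  qed
  finally show ?thesis .
qed

text \<open>
Lack of memory of the exponential distribution; listener and word are carried along.
\<close>

lemma ring_measure_memoryless:
  assumes s: "0 \<le> s" and A[measurable]: "A \<in> sets (ring_measure n v)"
  shows "emeasure (ring_measure n v) {x \<in> {x. s < fst x}. (fst x - s, snd x) \<in> A} =
     ennreal (exp (- s)) * emeasure (ring_measure n v) A"
proof -
  let ?S = "borel \<Otimes>\<^sub>M (count_space UNIV \<Otimes>\<^sub>M count_space UNIV) :: (real \<times> nat \<times> word) measure"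
  define E where "E = {x \<in> {x. s < fst x}. (fst x - s, snd x) \<in> A}"
  have A': "A \<in> sets ?S" using A by simp
  have [measurable]: "Measurable.pred ?S (\<lambda>x. x \<in> A)"
    using A' by (simp add: pred_def space_pair_measure)
  have E: "Measurable.pred ?S (\<lambda>x. x \<in> E)" unfolding E_def by simp
  then have E': "E \<in> sets ?S" by (simp add: pred_def space_pair_measure)
  have slice: "(\<lambda>t. indicator S (t, p) :: ennreal) \<in> borel_measurable borel" if "S \<in> sets ?S" for S p
    by (rule measurable_compose[OF _ borel_measurable_indicator[OF that]]) (simp add: space_pair_measure)
  have 1: "(\<integral>\<^sup>+t. ennreal (exponential_density 1 t) * indicator E (t, p) \<partial>lborel) =
      ennreal (exp (- s)) * (\<integral>\<^sup>+t. ennreal (exponential_density 1 t) * indicator A (t, p) \<partial>lborel)" for p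
  proof -
    have "(\<integral>\<^sup>+t. ennreal (exponential_density 1 t) * indicator E (t, p) \<partial>lborel) =
       (\<integral>\<^sup>+t. ennreal (exponential_density 1 (s + t)) * indicator E (s + t, p) \<partial>lborel)"
      using slice[OF E', of p] by (subst nn_integral_real_affine[where c=1 and t=s]) auto
    also have "\<dots> = (\<integral>\<^sup>+t. ennreal (exp (- s)) * (ennreal (exponential_density 1 t) * indicator A (t, p)) \<partial>lborel)"
    proof (rule nn_integral_cong_AE, use AE_lborel_singleton[of 0] in eventually_elim)
      fix t :: real assume t: "t \<noteq> 0"
      have "ennreal (exp (- (s + t))) = ennreal (exp (- s)) * ennreal (exp (- t))"
        by (subst ennreal_mult[symmetric]) (auto simp: exp_add[symmetric])
      then show "ennreal (exponential_density 1 (s + t)) * indicator E (s + t, p) =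
          ennreal (exp (- s)) * (ennreal (exponential_density 1 t) * indicator A (t, p))"
        using t s by (cases "t < 0") (simp_all add: E_def exponential_density_def indicator_def mult.assoc)
    qed
    also have "\<dots> = ennreal (exp (- s)) * (\<integral>\<^sup>+t. ennreal (exponential_density 1 t) * indicator A (t, p) \<partial>lborel)"
      using slice[OF A', of p] by (subst nn_integral_cmult) simp_all
    finally show ?thesis .
  qed
  have "emeasure (ring_measure n v) E = (\<integral>\<^sup>+r. indicator E r \<partial>ring_measure n v)"
    using E' by (subst nn_integral_indicator) auto
  also have "\<dots> = ennreal (exp (- s)) * (\<integral>\<^sup>+r. indicator A r \<partial>ring_measure n v)"
  proof -
    have "(\<lambda>p. \<integral>\<^sup>+t. ennreal (exponential_density 1 t) * indicator A (t, p) \<partial>lborel)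
        \<in> borel_measurable (measure_pmf (pmf_of_set ({..<n} - {v})) \<Otimes>\<^sub>M measure_pmf (pmf_of_set (UNIV :: word set)))"
      using A' by measurable
    then show ?thesis
      unfolding nn_integral_ring_measure[OF borel_measurable_indicator[OF E']]
        nn_integral_ring_measure[OF borel_measurable_indicator[OF A']] 1
      by (rule nn_integral_cmult)
  qed
  also have "(\<integral>\<^sup>+r. indicator A r \<partial>ring_measure n v) = emeasure (ring_measure n v) A"
    using A by (rule nn_integral_indicator)
  finally show ?thesis by (simp add: E_def)
qed

section \<open>The law of the ring history\<close>

text \<open>
After the first ring of \<open>v\<close> is removed, the \<open>k\<close>-th ring of \<open>v\<close> is what was its ring \<open>Suc k\<close>; the
rings of the others keep their numbers.
\<close>

definition later_index :: "nat \<Rightarrow> nat \<times> nat \<Rightarrow> nat \<times> nat" where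
  "later_index v = (\<lambda>(v', k). (v', if v' = v then Suc k else k))"

text \<open>
The outcome seen by an observer who starts at the time \<open>s\<close> of the first ring of all, which is due
to \<open>v\<close>: the others have already waited \<open>s\<close> for their first rings.
\<close>

definition after_ring :: "nat \<Rightarrow> nat \<Rightarrow> real \<Rightarrow> outcome \<Rightarrow> outcome" where
  "after_ring n v s \<omega> = (\<lambda>i\<in>{..<n} \<times> UNIV.
     if fst i \<noteq> v \<and> snd i = 0 then (fst (\<omega> (later_index v i)) - s, snd (\<omega> (later_index v i)))
     else \<omega> (later_index v i))"

lemma later_index_apply: "later_index v (v', k) = (v', if v' = v then Suc k else k)"
  by (simp add: later_index_def)

lemma fst_later_index[simp]: "fst (later_index v i) = fst i"
  by (cases i) (simp add: later_index_apply)

text \<open>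
The rings up to time \<open>t\<close> are, in chronological order, those of the speakers, listeners and words in
the list. The recursion on the remaining time makes the probabilities computable, and the strict
inequalities exclude ties, so that the tie-breaking rule of the construction never matters.
\<close>

fun history :: "nat \<Rightarrow> (nat \<times> nat \<times> word) list \<Rightarrow> real \<Rightarrow> outcome \<Rightarrow> bool" where
  "history n [] t \<omega> \<longleftrightarrow> (\<forall>v<n. t < fst (\<omega> (v, 0)))"
| "history n ((v, w, u) # L) t \<omega> \<longleftrightarrow>
     snd (\<omega> (v, 0)) = (w, u) \<and> 0 \<le> fst (\<omega> (v, 0)) \<and> fst (\<omega> (v, 0)) \<le> t \<and>
     (\<forall>v'<n. v' \<noteq> v \<longrightarrow> fst (\<omega> (v, 0)) < fst (\<omega> (v', 0))) \<and>
     history n L (t - fst (\<omega> (v, 0))) (after_ring n v (fst (\<omega> (v, 0))) \<omega>)"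

abbreviation mark_space :: "(real \<times> nat \<times> word) measure" where
  "mark_space \<equiv> borel \<Otimes>\<^sub>M (count_space UNIV \<Otimes>\<^sub>M count_space UNIV)"

lemma inj_on_later_index: "inj_on (later_index v) I"
  by (auto simp: inj_on_def later_index_def split: if_splits)

lemma later_index_image:
  fixes n v :: nat
  assumes "v < n" shows "later_index v ` ({..<n} \<times> UNIV) = {..<n} \<times> UNIV - {(v, 0::nat)}"
proof (intro set_eqI iffI)
  fix i assume "i \<in> {..<n} \<times> UNIV - {(v, 0::nat)}"
  then obtain v' k where i: "i = (v', k)" "v' < n" "\<not> (v' = v \<and> k = 0)" by (cases i) auto
  then have "i = later_index v (v', if v' = v then k - 1 else k)"
    by (auto simp: later_index_def)
  then show "i \<in> later_index v ` ({..<n} \<times> UNIV)" using i by blast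
qed (auto simp: later_index_def split: if_splits)

lemma measurable_coordinate:
  assumes "v < n"
  shows "(\<lambda>\<omega>. \<omega> (v, k)) \<in> measurable (naming_space n) mark_space"
proof -
  have "(\<lambda>\<omega>. \<omega> (v, k)) \<in> measurable (naming_space n) (case (v, k) of (v, k) \<Rightarrow> ring_measure n v)"
    unfolding naming_space_def by (rule measurable_component_singleton) (use assms in auto)
  then show ?thesis by (simp cong: measurable_cong_sets)
qed

lemma measurable_into_naming_space:
  assumes "\<And>v k. v < n \<Longrightarrow> (\<lambda>x. f x (v, k)) \<in> measurable M mark_space"
    and "\<And>x. x \<in> space M \<Longrightarrow> f x \<in> extensional ({..<n} \<times> UNIV)"
  shows "f \<in> measurable M (naming_space n)"
  unfolding naming_space_def
proof (rule measurable_PiM_single')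
  fix i :: "nat \<times> nat" assume "i \<in> {..<n} \<times> UNIV"
  then show "(\<lambda>x. f x i) \<in> measurable M (case i of (v, k) \<Rightarrow> ring_measure n v)"
    using assms(1) by (auto cong: measurable_cong_sets)
next
  show "f \<in> space M \<rightarrow> (\<Pi>\<^sub>E i\<in>{..<n} \<times> UNIV. space (case i of (v, k) \<Rightarrow> ring_measure n v))"
    using assms(2) by (auto simp: PiE_iff split: prod.split)
qed

lemma measurable_after_ring:
  assumes "v < n" and s[measurable]: "s \<in> borel_measurable M"
    and f: "f \<in> measurable M (naming_space n)"
  shows "(\<lambda>x. after_ring n v (s x) (f x)) \<in> measurable M (naming_space n)"
proof (rule measurable_into_naming_space)
  fix v' k assume v': "v' < n"
  have c[measurable]: "(\<lambda>x. f x (v', k')) \<in> measurable M mark_space" for k'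
    using measurable_compose[OF f measurable_coordinate[OF v']] .
  show "(\<lambda>x. after_ring n v (s x) (f x) (v', k)) \<in> measurable M mark_space"
    using v' by (cases "v' = v"; cases "k = 0") (use c in \<open>simp_all add: after_ring_def later_index_apply\<close>)
qed (auto simp: after_ring_def)

lemma measurable_history:
  assumes "\<forall>(v, w, u) \<in> set L. v < n"
    and "t \<in> borel_measurable M" and "f \<in> measurable M (naming_space n)"
  shows "Measurable.pred M (\<lambda>x. history n L (t x) (f x))"
  using assms
proof (induction L arbitrary: t f)
  case Nil
  note [measurable] = Nil.prems(2)
  have [measurable]: "v < n \<Longrightarrow> (\<lambda>x. f x (v, k)) \<in> measurable M mark_space" for v k
    using measurable_compose[OF Nil.prems(3) measurable_coordinate] .
  show ?case unfolding history.simps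
    by (rule pred_intros_finite(3)[of "{..<n}", unfolded lessThan_iff Ball_def]) (simp, measurable)
next
  case (Cons a L)
  obtain v w u where a: "a = (v, w, u)" by (cases a)
  have v: "v < n" using Cons.prems a by auto
  note [measurable] = Cons.prems(2)
  have c[measurable]: "v < n \<Longrightarrow> (\<lambda>x. f x (v, k)) \<in> measurable M mark_space" for v k
    using measurable_compose[OF Cons.prems(3) measurable_coordinate] .
  note [measurable] = c[OF v]
  have [measurable]: "Measurable.pred M (\<lambda>x. \<forall>v'\<in>{..<n}. v' \<noteq> v \<longrightarrow> fst (f x (v, 0)) < fst (f x (v', 0)))"
    by (rule pred_intros_finite) auto
  have [measurable]: "Measurable.pred M (\<lambda>x. history n L (t x - fst (f x (v, 0)))
      (after_ring n v (fst (f x (v, 0))) (f x)))"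
    using Cons.prems by (intro Cons.IH measurable_after_ring v) auto
  have [measurable]: "Measurable.pred M (\<lambda>x. snd (f x (v, 0)) = (w, u))"
    by (rule pred_eq_const1[where N="count_space UNIV \<Otimes>\<^sub>M count_space UNIV"]) (use pair_measureI[of "{w}" "count_space UNIV" "{u}" "count_space UNIV"] in auto)
  show ?case unfolding a history.simps
    using \<open>Measurable.pred M (\<lambda>x. \<forall>v'\<in>{..<n}. _ v' x)\<close> by (simp add: Ball_def)
qed

lemma space_naming_space: "space (naming_space n) = {..<n} \<times> UNIV \<rightarrow>\<^sub>E UNIV"
  by (auto simp: naming_space_def space_PiM PiE_def split: prod.split)

lemma later_marks: "{x. t < fst x} \<in> sets mark_space"
proof -
  have "{x \<in> space mark_space. t < fst x} \<in> sets mark_space" by measurable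
  then show ?thesis by (simp add: space_pair_measure)
qed

lemma emeasure_ring_measure_later:
  "0 \<le> t \<Longrightarrow> emeasure (ring_measure n v) {x. t < fst x} = ennreal (exp (- t))"
  using ring_measure_memoryless[of t UNIV n v] prob_space.emeasure_space_1[OF prob_space_ring_measure, of n v]
    sets.top[of "ring_measure n v"] by simp

lemma emeasure_no_ring:
  assumes t: "0 \<le> t"
  shows "emeasure (naming_space n) {\<omega> \<in> space (naming_space n). history n [] t \<omega>} = ennreal (exp (- (real n * t)))"
proof -
  let ?J = "(\<lambda>v. (v, 0::nat)) ` {..<n}"
  let ?M = "\<lambda>(v::nat, k::nat). ring_measure n v"
  have S: "{x. t < fst x} \<in> sets (ring_measure n v)" for v
    unfolding sets_ring_measure by (rule later_marks)
  have "{\<omega> \<in> space (naming_space n). history n [] t \<omega>} =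
      prod_emb ({..<n} \<times> UNIV) ?M ?J (Pi\<^sub>E ?J (\<lambda>_. {x. t < fst x}))"
    by (auto simp: space_naming_space prod_emb_iff PiE_iff split: prod.split)
  also have "emeasure (naming_space n) \<dots> = (\<Prod>i\<in>?J. emeasure (?M i) {x. t < fst x})"
    unfolding naming_space_def
    by (rule emeasure_PiM_emb) (use S in \<open>auto simp: prob_space_ring_measure simp del: sets_ring_measure\<close>)
  also have "\<dots> = (\<Prod>v<n. ennreal (exp (- t)))"
    by (subst prod.reindex) (auto simp: inj_on_def emeasure_ring_measure_later[OF t])
  also have "\<dots> = ennreal (exp (- (real n * t)))"
    by (simp add: ennreal_power exp_of_nat_mult[symmetric])
  finally show ?thesis .
qed

text \<open>
The Markov property at the first ring. The \<open>n - 1\<close> other individuals each contribute a factor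
\<open>exp (- s)\<close> for not having rung by time \<open>s\<close>, and what is left is a fresh outcome.
\<close>

lemma emeasure_after_ring:
  fixes s :: real
  defines "I' n v \<equiv> {..<n} \<times> UNIV - {(v::nat, 0::nat)}"
  assumes v: "v < n" and s: "0 \<le> s" and B: "B \<in> sets (naming_space n)"
  shows "emeasure (PiM (I' n v) (\<lambda>(v, k). ring_measure n v))
      {X \<in> space (PiM (I' n v) (\<lambda>(v, k). ring_measure n v)).
        (\<forall>v'<n. v' \<noteq> v \<longrightarrow> s < fst (X (v', 0))) \<and> after_ring n v s X \<in> B}
    = ennreal (exp (- (real (n - 1) * s))) * emeasure (naming_space n) B"
proof -
  let ?I = "{..<n} \<times> (UNIV :: nat set)" and ?M = "\<lambda>(v::nat, k::nat). ring_measure n v"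
  let ?F = "(\<lambda>v'. (v', 0::nat)) ` ({..<n} - {v})"
  let ?h = "\<lambda>i x. if fst i \<noteq> v \<and> snd i = 0 then (fst x - s, snd x) else x :: real \<times> nat \<times> word"
  have M: "?M (later_index v i) = ring_measure n (fst i)" "?M i = ring_measure n (fst i)" for i
    by (auto simp: later_index_def split: prod.split)
  have F: "later_index v i = i" "fst i \<noteq> v \<and> snd i = 0" if "i \<in> ?F" for i
    using that by (auto simp: later_index_def)
  have "emeasure (PiM (later_index v ` ?I) ?M)
      {X \<in> space (PiM (later_index v ` ?I) ?M). (\<forall>i\<in>?F. X (later_index v i) \<in> {x. s < fst x}) \<and>
         (\<lambda>i\<in>?I. ?h i (X (later_index v i))) \<in> B}
    = (\<Prod>i\<in>?F. ennreal (exp (- s))) * emeasure (PiM ?I ?M) B"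
  proof (rule emeasure_PiM_thinned_reindex)
    fix i :: "nat \<times> nat"
    show "prob_space (?M i)" "prob_space (?M (later_index v i))"
      unfolding M by (rule prob_space_ring_measure)+
    show "?h i \<in> measurable (?M (later_index v i)) (?M i)"
      unfolding M by (simp cong: measurable_cong_sets)
    show "{x. s < fst x} \<in> sets (?M (later_index v i))"
      unfolding M sets_ring_measure by (rule later_marks)
    show "emeasure (?M (later_index v i)) {x \<in> {x. s < fst x}. ?h i x \<in> A} = ennreal (exp (- s)) * emeasure (?M i) A"
      if "i \<in> ?F" "A \<in> sets (?M i)" for A
      using that F(2)[OF that(1)] ring_measure_memoryless[OF s, of A n "fst i"] unfolding M by simp
    show "emeasure (?M (later_index v i)) {x \<in> space (?M (later_index v i)). ?h i x \<in> A} = emeasure (?M i) A"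
      if i: "i \<in> ?I - ?F" and A: "A \<in> sets (?M i)" for A
    proof -
      have "\<not> (fst i \<noteq> v \<and> snd i = 0)" using i by (cases i) auto
      then show ?thesis unfolding M by auto
    qed
  qed (use B in \<open>auto simp: inj_on_later_index naming_space_def\<close>)
  also have "(\<Prod>i\<in>?F. ennreal (exp (- s))) = ennreal (exp (- (real (n - 1) * s)))"
  proof -
    have "card ?F = n - 1" using v by (subst card_image) (auto simp: inj_on_def)
    then show ?thesis by (simp add: ennreal_power exp_of_nat_mult[symmetric])
  qed
  also have "{X \<in> space (PiM (later_index v ` ?I) ?M). (\<forall>i\<in>?F. X (later_index v i) \<in> {x. s < fst x}) \<and>
         (\<lambda>i\<in>?I. ?h i (X (later_index v i))) \<in> B} =
     {X \<in> space (PiM (I' n v) ?M). (\<forall>v'<n. v' \<noteq> v \<longrightarrow> s < fst (X (v', 0))) \<and> after_ring n v s X \<in> B}"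
  proof -
    have "(\<lambda>i\<in>?I. ?h i (X (later_index v i))) = after_ring n v s X" for X
      unfolding after_ring_def by (rule restrict_ext) auto
    then show ?thesis
      by (auto simp: later_index_image[OF v] I'_def later_index_apply)
  qed
  finally show ?thesis
    by (simp add: later_index_image[OF v] I'_def naming_space_def)
qed

lemma after_ring_upd: "after_ring n v s (X((v, 0) := x)) = after_ring n v s X"
  unfolding after_ring_def by (rule restrict_ext) (auto simp: later_index_def split: prod.split)

lemma after_ring_space: "after_ring n v s X \<in> space (naming_space n)"
  by (auto simp: space_naming_space after_ring_def)

lemma nn_integral_power_Icc:
  assumes "0 \<le> (t::real)"
  shows "(\<integral>\<^sup>+s. ennreal ((t - s) ^ k / fact k) * indicator {0..t} s \<partial>lborel) = ennreal (t ^ Suc k / fact (Suc k))"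
proof -
  have "((\<lambda>x. - ((t - x) ^ Suc k / fact (Suc k))) has_field_derivative ((t - s) ^ k / fact k)) (at s within A)"
    for s :: real and A :: "real set"
    by (rule derivative_eq_intros refl | simp)+
  then have "(\<integral>\<^sup>+s. ennreal ((t - s) ^ k / fact k) * indicator {0..t} s \<partial>lborel) =
      ennreal (- ((t - t) ^ Suc k / fact (Suc k)) - (- ((t - 0) ^ Suc k / fact (Suc k))))"
    using assms by (intro nn_integral_FTC_Icc) auto
  then show ?thesis by simp
qed

lemma emeasure_ring_choice:
  assumes "v < n" "w < n" "w \<noteq> v"
  shows "emeasure (measure_pmf (pmf_of_set ({..<n} - {v})) \<Otimes>\<^sub>M measure_pmf (pmf_of_set (UNIV :: word set))) {(w, u)}
    = ennreal (1 / (2 * real (n - 1)))"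
proof -
  have 1: "{(w, u)} = {w} \<times> {u}" by simp
  have "emeasure (measure_pmf (pmf_of_set ({..<n} - {v})) \<Otimes>\<^sub>M measure_pmf (pmf_of_set (UNIV :: word set))) {(w, u)}
    = emeasure (measure_pmf (pmf_of_set ({..<n} - {v}))) {w} * emeasure (measure_pmf (pmf_of_set (UNIV :: word set))) {u}"
    unfolding 1 by (rule measure_pmf.emeasure_pair_measure_Times) auto
  also have "emeasure (measure_pmf (pmf_of_set ({..<n} - {v}))) {w} = ennreal (1 / real (n - 1))"
  proof -
    have "finite ({..<n} - {v})" "{..<n} - {v} \<noteq> {}" "card ({..<n} - {v}) = n - 1" using assms by auto
    then show ?thesis using assms by (subst emeasure_pmf_single) (simp add: pmf_of_set)
  qed
  also have "emeasure (measure_pmf (pmf_of_set (UNIV :: word set))) {u} = ennreal (1 / 2)"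
  proof -
    have "finite (UNIV :: word set)" "card (UNIV :: word set) = 2" by (simp_all add: UNIV_word)
    then show ?thesis by (subst emeasure_pmf_single) (auto simp: pmf_of_set)
  qed
  also have "ennreal (1 / real (n - 1)) * ennreal (1 / 2) = ennreal (1 / (2 * real (n - 1)))"
    by (subst ennreal_mult[symmetric]) auto
  finally show ?thesis .
qed

text \<open>
The density of the first ring time of \<open>v\<close> is \<open>exp (- s)\<close>. Together with the silence of the others it
gives \<open>exp (- n s)\<close>, and the choice of listener and word gives \<open>1 / (2 (n - 1))\<close>.
\<close>

lemma emeasure_history_Cons:
  assumes v: "v < n" and w: "w < n" "w \<noteq> v" and L: "\<forall>(v, w, u) \<in> set L. v < n"
    and p: "\<And>s. 0 \<le> s \<Longrightarrow> emeasure (naming_space n) {\<omega> \<in> space (naming_space n). history n L s \<omega>} = ennreal (p s)"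
    and p0: "\<And>s. 0 \<le> s \<Longrightarrow> 0 \<le> p s" and pm[measurable]: "p \<in> borel_measurable borel" and t: "0 \<le> t"
  shows "emeasure (naming_space n) {\<omega> \<in> space (naming_space n). history n ((v, w, u) # L) t \<omega>}
    = ennreal (1 / (2 * real (n - 1))) * (\<integral>\<^sup>+s. ennreal (exp (- (real n * s)) * p (t - s)) * indicator {0..t} s \<partial>lborel)"
proof -
  let ?I = "{..<n} \<times> (UNIV :: nat set)" and ?M = "\<lambda>(v::nat, k::nat). ring_measure n v"
  let ?I' = "?I - {(v, 0)}"
  let ?P = "PiM ?I' ?M" and ?R = "ring_measure n v" and ?N = "naming_space n"
  let ?\<nu> = "measure_pmf (pmf_of_set ({..<n} - {v})) \<Otimes>\<^sub>M measure_pmf (pmf_of_set (UNIV :: word set))"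
  let ?H = "{\<omega> \<in> space ?N. history n ((v, w, u) # L) t \<omega>}"
  let ?up = "\<lambda>(x, X). X((v, 0) := x)"
  interpret R: prob_space ?R by (rule prob_space_ring_measure)
  interpret P: prob_space ?P by (rule prob_space_PiM) (auto simp: prob_space_ring_measure)
  have ins: "insert (v, 0) ?I' = ?I" using v by auto
  have N: "?N = distr (?R \<Otimes>\<^sub>M ?P) ?N ?up"
    using distr_pair_PiM_eq_PiM[of ?I' ?M "(v, 0)"] unfolding ins naming_space_def
    by (auto simp: prob_space_ring_measure)
  have up: "?up \<in> measurable (?R \<Otimes>\<^sub>M ?P) ?N"
  proof -
    have "(\<lambda>(X, x). X((v, 0) := x)) \<in> measurable (?P \<Otimes>\<^sub>M ?M (v, 0)) (PiM (insert (v, 0) ?I') ?M)"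
      by (rule measurable_add_dim)
    from measurable_compose[OF measurable_pair_swap' this]
    show ?thesis unfolding ins naming_space_def by (simp add: split_beta')
  qed
  have H: "?H \<in> sets ?N"
    using measurable_history[of "(v, w, u) # L" n "\<lambda>_. t" ?N "\<lambda>x. x"] v L by (auto simp: pred_def)
  let ?S = "?up -` ?H \<inter> space (?R \<Otimes>\<^sub>M ?P)"
  have S: "?S \<in> sets (?R \<Otimes>\<^sub>M ?P)" using up H by (rule measurable_sets)
  have "emeasure ?N ?H = emeasure (?R \<Otimes>\<^sub>M ?P) ?S"
    by (subst N, rule emeasure_distr[OF up H])
  also have "\<dots> = (\<integral>\<^sup>+x. emeasure ?P (Pair x -` ?S) \<partial>?R)"
    using S by (rule P.emeasure_pair_measure_alt)
  also have "\<dots> = (\<integral>\<^sup>+x. (indicator {(w, u)} (snd x) *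
      (ennreal (exp (- (real (n - 1) * fst x)) * p (t - fst x)) * indicator {0..t} (fst x))) \<partial>?R)"
  proof (rule nn_integral_cong)
    fix x :: "real \<times> nat \<times> word"
    let ?B = "{\<omega> \<in> space ?N. history n L (t - fst x) \<omega>}"
    have B: "?B \<in> sets ?N"
      using measurable_history[of L n "\<lambda>_. t - fst x" ?N "\<lambda>x. x"] L by (auto simp: pred_def)
    have upsp: "X((v, 0) := x) \<in> space ?N" if "X \<in> space ?P" for X
      using that v by (auto simp: space_naming_space space_PiM PiE_iff extensional_def)
    show "emeasure ?P (Pair x -` ?S) = indicator {(w, u)} (snd x) *
      (ennreal (exp (- (real (n - 1) * fst x)) * p (t - fst x)) * indicator {0..t} (fst x))"
    proof (cases "snd x = (w, u) \<and> fst x \<in> {0..t}")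
      case True
      have "Pair x -` ?S = {X \<in> space ?P. (\<forall>v'<n. v' \<noteq> v \<longrightarrow> fst x < fst (X (v', 0))) \<and> after_ring n v (fst x) X \<in> ?B}"
        using True upsp by (auto simp: space_pair_measure after_ring_upd after_ring_space)
      then have "emeasure ?P (Pair x -` ?S) = ennreal (exp (- (real (n - 1) * fst x))) * emeasure ?N ?B"
        using emeasure_after_ring[OF v, of "fst x" ?B] B True by simp
      then show ?thesis using True p[of "t - fst x"] p0[of "t - fst x"] by (simp add: ennreal_mult)
    next
      case False
      then have "Pair x -` ?S = {}" by auto
      then show ?thesis using False by (auto simp: indicator_def)
    qed
  qed
  also have "\<dots> = (\<integral>\<^sup>+y. (\<integral>\<^sup>+s. ennreal (exponential_density 1 s) * (indicator {(w, u)} y *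
      (ennreal (exp (- (real (n - 1) * s)) * p (t - s)) * indicator {0..t} s)) \<partial>lborel) \<partial>?\<nu>)"
  proof (subst nn_integral_ring_measure)
    have [measurable]: "{(w, u)} \<in> sets (count_space UNIV \<Otimes>\<^sub>M count_space UNIV)"
      using pair_measureI[of "{w}" "count_space UNIV" "{u}" "count_space UNIV"] by simp
    show "(\<lambda>x. indicator {(w, u)} (snd x) * (ennreal (exp (- (real (n - 1) * fst x)) * p (t - fst x)) *
       indicator {0..t} (fst x))) \<in> borel_measurable mark_space" by measurable
  qed simp
  also have "\<dots> = (\<integral>\<^sup>+y. indicator {(w, u)} y *
      (\<integral>\<^sup>+s. ennreal (exp (- (real n * s)) * p (t - s)) * indicator {0..t} s \<partial>lborel) \<partial>?\<nu>)"
  proof (rule nn_integral_cong)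
    fix y :: "nat \<times> word"
    have "ennreal (exponential_density 1 s) * (indicator {(w, u)} y *
      (ennreal (exp (- (real (n - 1) * s)) * p (t - s)) * indicator {0..t} s)) =
      indicator {(w, u)} y * (ennreal (exp (- (real n * s)) * p (t - s)) * indicator {0..t} s)" for s
    proof (cases "s \<in> {0..t}")
      case True
      have "exp (- s) * exp (- (real (n - 1) * s)) = exp (- (real n * s))"
        using v by (simp add: exp_add[symmetric] of_nat_diff algebra_simps)
      then have "ennreal (exp (- s)) * ennreal (exp (- (real (n - 1) * s)) * p (t - s)) = ennreal (exp (- (real n * s)) * p (t - s))"
        using True p0[of "t - s"] by (simp add: ennreal_mult[symmetric] mult.assoc[symmetric])
      then show ?thesis using True by (simp add: exponential_density_def ac_simps split: split_indicator)
    qed simp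
    then show "(\<integral>\<^sup>+s. ennreal (exponential_density 1 s) * (indicator {(w, u)} y *
      (ennreal (exp (- (real (n - 1) * s)) * p (t - s)) * indicator {0..t} s)) \<partial>lborel) =
      indicator {(w, u)} y * (\<integral>\<^sup>+s. ennreal (exp (- (real n * s)) * p (t - s)) * indicator {0..t} s \<partial>lborel)"
      by (subst nn_integral_cmult[symmetric]) auto
  qed
  also have "\<dots> = emeasure ?\<nu> {(w, u)} * (\<integral>\<^sup>+s. ennreal (exp (- (real n * s)) * p (t - s)) * indicator {0..t} s \<partial>lborel)"
  proof -
    have 1: "{(w, u)} \<in> sets ?\<nu>"
      using pair_measureI[of "{w}" "measure_pmf (pmf_of_set ({..<n} - {v}))" "{u}" "measure_pmf (pmf_of_set (UNIV :: word set))"] by simp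
    then show ?thesis by (subst nn_integral_multc) (auto simp: nn_integral_indicator)
  qed
  finally show ?thesis using emeasure_ring_choice[OF v w] by simp
qed

text \<open>
The Poisson probability of \<open>k\<close> rings divided by \<open>n ^ k\<close> for the speakers and \<open>(2 (n - 1)) ^ k\<close> for
listeners and words: given their number, the actions are independent and uniform.
\<close>

lemma emeasure_history:
  assumes "\<forall>(v, w, u) \<in> set L. v < n \<and> w < n \<and> w \<noteq> v" and "0 \<le> t"
  shows "emeasure (naming_space n) {\<omega> \<in> space (naming_space n). history n L t \<omega>} =
    ennreal (exp (- (real n * t)) * (t ^ length L / fact (length L)) * (1 / (2 * real (n - 1))) ^ length L)"
  using assms
proof (induction L arbitrary: t)
  case Nil
  then show ?case using emeasure_no_ring[of t n] by simp
next
  case (Cons a L)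
  obtain v w u where a: "a = (v, w, u)" by (cases a)
  let ?q = "1 / (2 * real (n - 1))" and ?k = "length L"
  have q: "0 \<le> ?q" by simp
  let ?p = "\<lambda>s. exp (- (real n * s)) * (s ^ ?k / fact ?k) * ?q ^ ?k"
  have "emeasure (naming_space n) {\<omega> \<in> space (naming_space n). history n (a # L) t \<omega>}
    = ennreal ?q * (\<integral>\<^sup>+s. ennreal (exp (- (real n * s)) * ?p (t - s)) * indicator {0..t} s \<partial>lborel)"
    unfolding a using Cons by (intro emeasure_history_Cons) (auto simp: a)
  also have "(\<integral>\<^sup>+s. ennreal (exp (- (real n * s)) * ?p (t - s)) * indicator {0..t} s \<partial>lborel) =
      (\<integral>\<^sup>+s. ennreal (exp (- (real n * t)) * ?q ^ ?k) * (ennreal ((t - s) ^ ?k / fact ?k) * indicator {0..t} s) \<partial>lborel)"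
  proof (rule nn_integral_cong)
    fix s :: real
    have e: "exp (- (real n * s)) * exp (- (real n * (t - s))) = exp (- (real n * t))"
      by (simp add: exp_add[symmetric] algebra_simps)
    have "exp (- (real n * s)) * ?p (t - s) = (exp (- (real n * s)) * exp (- (real n * (t - s)))) * ?q ^ ?k * ((t - s) ^ ?k / fact ?k)"
      by (simp only: ac_simps)
    then have "exp (- (real n * s)) * ?p (t - s) = (exp (- (real n * t)) * ?q ^ ?k) * ((t - s) ^ ?k / fact ?k)"
      unfolding e .
    then show "ennreal (exp (- (real n * s)) * ?p (t - s)) * indicator {0..t} s =
        ennreal (exp (- (real n * t)) * ?q ^ ?k) * (ennreal ((t - s) ^ ?k / fact ?k) * indicator {0..t} s)"
      by (cases "s \<in> {0..t}")
         (simp_all only: ennreal_mult' indicator_simps mult_zero_right mult_1_right zero_le_mult_iff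
            zero_le_power q exp_ge_zero simp_thms)
  qed
  also have "\<dots> = ennreal (exp (- (real n * t)) * ?q ^ ?k) * ennreal (t ^ Suc ?k / fact (Suc ?k))"
    by (subst nn_integral_cmult) (auto simp: nn_integral_power_Icc[OF Cons.prems(2)])
  also have "ennreal ?q * \<dots> = ennreal (?q * (exp (- (real n * t)) * ?q ^ ?k * (t ^ Suc ?k / fact (Suc ?k))))"
    using Cons.prems(2) by (simp add: ennreal_mult'[symmetric] del: fact_Suc)
  also have "?q * (exp (- (real n * t)) * ?q ^ ?k * (t ^ Suc ?k / fact (Suc ?k))) =
     exp (- (real n * t)) * (t ^ length (a # L) / fact (length (a # L))) * ?q ^ length (a # L)"
    by (simp add: mult_ac del: fact_Suc)
  finally show ?case .
qed

section \<open>From ring histories to the discrete chain\<close>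

definition positive_waits :: "nat \<Rightarrow> outcome \<Rightarrow> bool" where
  "positive_waits n \<omega> \<longleftrightarrow> (\<forall>v<n. \<forall>k. 0 < fst (\<omega> (v, k)))"

definition actions :: "nat \<Rightarrow> (nat \<times> nat \<times> word) set" where
  "actions n = {(v, w, u). v < n \<and> w < n \<and> w \<noteq> v}"

definition perform :: "nat \<times> nat \<times> word \<Rightarrow> config \<Rightarrow> config" where
  "perform = (\<lambda>(v, w, u). speak v w u)"

text \<open>
The transition operator of the chain that performs one uniformly chosen action per step.
\<close>

definition step_mean :: "nat \<Rightarrow> (config \<Rightarrow> real) \<Rightarrow> config \<Rightarrow> real" where
  "step_mean n f \<sigma> = (\<Sum>a\<in>actions n. f (perform a \<sigma>)) / real (2 * n * (n - 1))"

lemma ring_time_pos: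
  assumes "positive_waits n \<omega>" "e \<in> {..<n} \<times> UNIV"
  shows "0 < ring_time \<omega> e"
  using assms by (cases e) (auto simp: ring_time_def positive_waits_def intro!: sum_pos)

lemma ring_time_first: "ring_time \<omega> (v, 0) = fst (\<omega> (v, 0))"
  by (simp add: ring_time_def)

lemma ring_time_later:
  assumes i: "i \<in> {..<n} \<times> UNIV" and s: "s = fst (\<omega> (v, 0))"
  shows "ring_time \<omega> (later_index v i) = s + ring_time (after_ring n v s \<omega>) i"
proof -
  obtain v' k where i': "i = (v', k)" "v' < n" using i by (cases i) auto
  show ?thesis
  proof (cases "v' = v")
    case True
    have "(\<Sum>j\<le>Suc k. fst (\<omega> (v, j))) = s + (\<Sum>j\<le>k. fst (\<omega> (v, Suc j)))"
      using s by (simp only: sum.atMost_Suc_shift)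
    then show ?thesis
      using i' True by (simp add: ring_time_def later_index_apply after_ring_def)
  next
    case False
    have "(\<Sum>j\<le>k. fst (after_ring n v s \<omega> (v', j))) = (\<Sum>j\<le>k. fst (\<omega> (v', j)) - (if j = 0 then s else 0))"
      using i' False by (intro sum.cong) (auto simp: after_ring_def later_index_apply)
    also have "\<dots> = (\<Sum>j\<le>k. fst (\<omega> (v', j))) - s"
      by (simp add: sum_subtractf)
    finally show ?thesis
      using i' False by (simp add: ring_time_def later_index_apply)
  qed
qed

lemma positive_waits_after_ring:
  assumes "positive_waits n \<omega>" "v < n" "\<forall>v'<n. v' \<noteq> v \<longrightarrow> s < fst (\<omega> (v', 0))"
  shows "positive_waits n (after_ring n v s \<omega>)"
  using assms by (auto simp: positive_waits_def after_ring_def later_index_apply)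

lemma ring_action_later:
  assumes "i \<in> {..<n} \<times> UNIV"
  shows "ring_action \<omega> (later_index v i) = ring_action (after_ring n v s \<omega>) i"
proof -
  obtain v' k where i: "i = (v', k)" "v' < n" using assms by (cases i) auto
  have "snd (after_ring n v s \<omega> i) = snd (\<omega> (later_index v i))"
    using assms by (auto simp: after_ring_def)
  then show ?thesis
    unfolding i later_index_apply ring_action_def by (auto split: prod.splits)
qed

text \<open>
The list \<open>R\<close> is built like the history itself: the first ring, then the rings of the shifted
outcome with their original indices restored.
\<close>

lemma rings_of_history:
  assumes "history n L t \<omega>" "positive_waits n \<omega>" "set L \<subseteq> actions n"
  shows "\<exists>R. sorted_wrt (\<lambda>d e. ring_time \<omega> d < ring_time \<omega> e) R \<and>
     set R = {e \<in> {..<n} \<times> UNIV. ring_time \<omega> e \<le> t} \<and>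
     (\<forall>\<sigma>. fold (ring_action \<omega>) R \<sigma> = fold perform L \<sigma>)"
  using assms
proof (induction L arbitrary: t \<omega>)
  case Nil
  have "t < ring_time \<omega> e" if "e \<in> {..<n} \<times> UNIV" for e
  proof -
    obtain v k where e: "e = (v, k)" "v < n" using \<open>e \<in> _\<close> by (cases e) auto
    have "fst (\<omega> (v, 0)) \<le> (\<Sum>j\<le>k. fst (\<omega> (v, j)))"
      using Nil(2) e(2) by (intro member_le_sum) (auto simp: positive_waits_def less_imp_le)
    then show ?thesis using Nil(1) e by (force simp: ring_time_def)
  qed
  then have "\<not> ring_time \<omega> e \<le> t" if "e \<in> {..<n} \<times> UNIV" for e using that by (simp only: not_le)
  then have "{e \<in> {..<n} \<times> UNIV. ring_time \<omega> e \<le> t} = {}" by blast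
  then show ?case by (intro exI[of _ "[]"]) simp
next
  case (Cons a L)
  obtain v w u where a: "a = (v, w, u)" by (cases a)
  define s where "s = fst (\<omega> (v, 0))"
  define \<omega>' where "\<omega>' = after_ring n v s \<omega>"
  have v: "v < n" using Cons.prems a by (auto simp: actions_def)
  have h: "snd (\<omega> (v, 0)) = (w, u)" "s \<le> t" "\<forall>v'<n. v' \<noteq> v \<longrightarrow> s < fst (\<omega> (v', 0))"
      "history n L (t - s) \<omega>'"
    using Cons.prems(1) by (auto simp: a s_def \<omega>'_def)
  have pos': "positive_waits n \<omega>'"
    unfolding \<omega>'_def using Cons.prems(2) v h(3) by (rule positive_waits_after_ring)
  obtain R where R: "sorted_wrt (\<lambda>d e. ring_time \<omega>' d < ring_time \<omega>' e) R"
     "set R = {e \<in> {..<n} \<times> UNIV. ring_time \<omega>' e \<le> t - s}"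
     "\<And>\<sigma>. fold (ring_action \<omega>') R \<sigma> = fold perform L \<sigma>"
    using Cons.IH[OF h(4) pos'] Cons.prems(3) by auto
  have Ri: "e \<in> {..<n} \<times> UNIV" if "e \<in> set R" for e using that R(2) by auto
  have rt: "ring_time \<omega> (later_index v e) = s + ring_time \<omega>' e" if "e \<in> {..<n} \<times> UNIV" for e
    unfolding \<omega>'_def using that s_def by (rule ring_time_later)
  let ?R = "(v, 0) # map (later_index v) R"
  have "sorted_wrt (\<lambda>d e. ring_time \<omega> d < ring_time \<omega> e) (map (later_index v) R)"
    unfolding sorted_wrt_map using R(1)
    by (rule sorted_wrt_mono_rel[rotated]) (use rt Ri in auto)
  moreover have "ring_time \<omega> (v, 0) < ring_time \<omega> (later_index v e)" if "e \<in> set R" for e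
    using rt[OF Ri[OF that]] ring_time_pos[OF pos' Ri[OF that]] by (simp add: ring_time_first s_def)
  ultimately have "sorted_wrt (\<lambda>d e. ring_time \<omega> d < ring_time \<omega> e) ?R" by simp
  moreover have "set ?R = {e \<in> {..<n} \<times> UNIV. ring_time \<omega> e \<le> t}"
  proof -
    have "{e \<in> {..<n} \<times> UNIV. ring_time \<omega> e \<le> t} =
        insert (v, 0) {e \<in> {..<n} \<times> UNIV - {(v, 0)}. ring_time \<omega> e \<le> t}"
      using v h(2) by (auto simp: ring_time_first s_def)
    also have "{e \<in> {..<n} \<times> UNIV - {(v, 0)}. ring_time \<omega> e \<le> t} = later_index v ` set R"
      unfolding later_index_image[OF v, symmetric] R(2) using rt by force
    finally show ?thesis by simp
  qed
  moreover have "fold (ring_action \<omega>) ?R \<sigma> = fold perform (a # L) \<sigma>" for \<sigma>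
  proof -
    have "fold (ring_action \<omega>) (map (later_index v) R) \<tau> = fold (ring_action \<omega>') R \<tau>" for \<tau>
      unfolding fold_map \<omega>'_def by (rule fold_cong) (use Ri ring_action_later in auto)
    moreover have "ring_action \<omega> (v, 0) = perform a"
      using h(1) by (auto simp: ring_action_def perform_def a split: prod.splits)
    ultimately show ?thesis using R(3) by simp
  qed
  ultimately show ?case by blast
qed

text \<open>
A finite set of rings at distinct times has one chronological enumeration.
\<close>

lemma rings_until_eqI:
  assumes R: "sorted_wrt (\<lambda>d e. ring_time \<omega> d < ring_time \<omega> e) R"
    and set: "set R = {e \<in> {..<n} \<times> UNIV. ring_time \<omega> e \<le> t}"
  shows "rings_until n \<omega> t = R"
proof -
  have s: "sorted_wrt (<) (map (ring_time \<omega>) R)" using R by (simp add: sorted_wrt_map)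
  then have d: "distinct (map (ring_time \<omega>) R)" "sorted (map (ring_time \<omega>) R)"
    by (auto simp: strict_sorted_iff)
  have fin: "finite {e \<in> {..<n} \<times> UNIV. ring_time \<omega> e \<le> t}" unfolding set[symmetric] by simp
  have st: "set (rings_until n \<omega> t) = set R"
    unfolding rings_until_def set using fin by (simp add: image_image)
  have "distinct (rings_until n \<omega> t)"
    unfolding rings_until_def using fin
    by (simp add: distinct_map distinct_sorted_list_of_set) (metis inj_on_subset inj_prod_decode subset_UNIV)
  with d st show ?thesis
    by (intro map_sorted_distinct_set_unique[of "ring_time \<omega>"])
       (auto simp: distinct_map rings_until_def)
qed

lemma config_at_history:
  assumes "history n L t \<omega>" "positive_waits n \<omega>" "set L \<subseteq> actions n"
  shows "config_at n \<sigma> \<omega> t = fold perform L \<sigma>"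
proof -
  from rings_of_history[OF assms] obtain R where
    R: "sorted_wrt (\<lambda>d e. ring_time \<omega> d < ring_time \<omega> e) R"
       "set R = {e \<in> {..<n} \<times> UNIV. ring_time \<omega> e \<le> t}"
    and fold: "\<forall>\<sigma>. fold (ring_action \<omega>) R \<sigma> = fold perform L \<sigma>"
    by (elim exE conjE)
  show ?thesis
    unfolding config_at_def rings_until_eqI[OF R] using fold by (rule spec)
qed

lemma history_unique:
  assumes "history n L t \<omega>" "history n L' t \<omega>" "set L \<subseteq> actions n" "set L' \<subseteq> actions n"
  shows "L = L'"
  using assms
proof (induction L arbitrary: L' t \<omega>)
  case Nil
  then show ?case by (cases L') (auto simp: actions_def)
next
  case (Cons a L)
  obtain v w u where a: "a = (v, w, u)" by (cases a)
  from Cons.prems a obtain b L2 where L': "L' = b # L2" by (cases L') (auto simp: actions_def)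
  obtain v' w' u' where b: "b = (v', w', u')" by (cases b)
  have v: "v < n" "v' < n" using Cons.prems by (auto simp: a b L' actions_def)
  have "v' = v"
  proof (rule ccontr)
    assume "v' \<noteq> v"
    then have "fst (\<omega> (v, 0)) < fst (\<omega> (v', 0))" "fst (\<omega> (v', 0)) < fst (\<omega> (v, 0))"
      using Cons.prems(1,2) v by (auto simp: a b L')
    then show False by simp
  qed
  then have "b = a" using Cons.prems(1,2) by (simp add: a b L')
  have "history n L (t - fst (\<omega> (v, 0))) (after_ring n v (fst (\<omega> (v, 0))) \<omega>)"
    using Cons.prems(1) unfolding a by simp
  moreover have "history n L2 (t - fst (\<omega> (v, 0))) (after_ring n v (fst (\<omega> (v, 0))) \<omega>)"
    using Cons.prems(2) unfolding L' \<open>b = a\<close> a by simp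
  ultimately have "L = L2"
    using Cons.prems(3,4) unfolding L' by (intro Cons.IH) auto
  then show ?case using \<open>b = a\<close> L' by simp
qed

lemma finite_actions: "finite (actions n)"
proof -
  have "actions n \<subseteq> {..<n} \<times> {..<n} \<times> UNIV" by (auto simp: actions_def)
  then show ?thesis by (rule finite_subset) (simp add: UNIV_word)
qed

text \<open>
Summing a function of the final configuration over all histories with \<open>k\<close> rings iterates the
transition operator.
\<close>

lemma sum_over_histories:
  assumes n: "2 \<le> n"
  shows "(\<Sum>L | set L \<subseteq> actions n \<and> length L = k. f (fold perform L \<sigma>)) =
     real (2 * n * (n - 1)) ^ k * (step_mean n ^^ k) f \<sigma>"
proof (induction k arbitrary: \<sigma>)
  case 0
  have "{L. set L \<subseteq> actions n \<and> length L = 0} = {[]}" by auto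
  then show ?case by simp
next
  case (Suc k)
  let ?L = "\<lambda>k. {L. set L \<subseteq> actions n \<and> length L = k}"
  have eq: "?L (Suc k) = (\<lambda>(a, L). a # L) ` (actions n \<times> ?L k)"
    by (auto simp: length_Suc_conv image_iff)
  have "(\<Sum>L\<in>?L (Suc k). f (fold perform L \<sigma>)) = (\<Sum>(a, L)\<in>actions n \<times> ?L k. f (fold perform L (perform a \<sigma>)))"
    unfolding eq by (subst sum.reindex) (auto simp: inj_on_def split_beta')
  also have "\<dots> = (\<Sum>a\<in>actions n. \<Sum>L\<in>?L k. f (fold perform L (perform a \<sigma>)))"
    by (rule sum.cartesian_product[symmetric])
  also have "\<dots> = (\<Sum>a\<in>actions n. real (2 * n * (n - 1)) ^ k * (step_mean n ^^ k) f (perform a \<sigma>))"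
    by (simp add: Suc.IH)
  also have "\<dots> = real (2 * n * (n - 1)) ^ k * (real (2 * n * (n - 1)) * step_mean n ((step_mean n ^^ k) f) \<sigma>)"
  proof -
    have "real (2 * n * (n - 1)) \<noteq> 0" using n by simp
    then have "real (2 * n * (n - 1)) * (x / real (2 * n * (n - 1))) = x" for x
      by (simp only: times_divide_eq_right nonzero_mult_div_cancel_left simp_thms)
    then show ?thesis
      unfolding step_mean_def[of n "(step_mean n ^^ k) f" \<sigma>] sum_distrib_left[symmetric] by simp
  qed
  finally show ?case by (simp add: ac_simps)
qed

lemma AE_positive_waits: "AE \<omega> in naming_space n. positive_waits n \<omega>"
proof -
  have "AE \<omega> in naming_space n. 0 < fst (\<omega> (v, k))" if v: "v < n" for v k
  proof -
    have "{x. 0 < fst x} \<in> sets (ring_measure n v)" using later_marks by simp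
    moreover have "measure (ring_measure n v) {x. 0 < fst x} = 1"
      using emeasure_ring_measure_later[of 0 n v] by (simp add: measure_def)
    ultimately have ae: "AE x in ring_measure n v. 0 < fst x"
      using prob_space.AE_in_set_eq_1[OF prob_space_ring_measure] by force
    have "AE \<omega> in PiM ({..<n} \<times> UNIV) (\<lambda>(v, k). ring_measure n v). 0 < fst (\<omega> (v, k))"
      by (rule AE_PiM_component) (use v ae in \<open>auto simp: prob_space_ring_measure\<close>)
    then show ?thesis unfolding naming_space_def .
  qed
  then have "\<forall>v\<in>{..<n}. AE \<omega> in naming_space n. \<forall>k. 0 < fst (\<omega> (v, k))"
    by (auto simp: AE_all_countable)
  then have "AE \<omega> in naming_space n. \<forall>v\<in>{..<n}. \<forall>k. 0 < fst (\<omega> (v, k))"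
    by (subst AE_ball_countable) auto
  then show ?thesis by (simp add: positive_waits_def Ball_def)
qed

lemma history_weight:
  fixes x e t F N M :: real
  assumes "0 < M"
  shows "(2 * N * M) ^ k * x * (e * (t ^ k / F) * (1 / (2 * M)) ^ k) = e * (N * t) ^ k / F * x"
proof -
  have "(2 * N * M) ^ k * (t ^ k * (1 / (2 * M)) ^ k) = (N * t) ^ k"
    using assms by (simp add: power_mult_distrib[symmetric])
  then have "(2 * N * M) ^ k * (t ^ k * (1 / (2 * M)) ^ k) * (e / F * x) = (N * t) ^ k * (e / F * x)"
    by (rule arg_cong)
  then show ?thesis by (simp add: ac_simps)
qed

text \<open>
The histories with at most \<open>m\<close> rings are disjoint events, so their probabilities add up. Applied to
a set of configurations and to its complement this determines the law of the configuration at
time \<open>t\<close>, because the Poisson weights sum to \<open>1\<close>; in particular almost every outcome has a history.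
\<close>

lemma poisson_step_mean_le_prob:
  assumes n: "2 \<le> n" and t: "0 \<le> t" and E: "E \<in> sets (naming_space n)"
    and hist: "\<And>\<omega> L. \<lbrakk>\<omega> \<in> space (naming_space n); positive_waits n \<omega>; set L \<subseteq> actions n; history n L t \<omega>;
        fold perform L \<sigma> \<in> S\<rbrakk> \<Longrightarrow> \<omega> \<in> E"
  shows "(\<Sum>k\<le>m. exp (- (real n * t)) * (real n * t) ^ k / fact k * (step_mean n ^^ k) (indicator S) \<sigma>)
     \<le> measure (naming_space n) E"
proof -
  let ?N = "naming_space n"
  interpret N: prob_space ?N by (rule prob_space_naming_space)
  define H where "H L = {\<omega> \<in> space ?N. history n L t \<omega>}" for L
  define \<L> where "\<L> k = {L. set L \<subseteq> actions n \<and> length L = k}" for k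
  define \<K> where "\<K> = {L \<in> (\<Union>k\<le>m. \<L> k). fold perform L \<sigma> \<in> S}"
  have fin: "finite (\<L> k)" for k
    unfolding \<L>_def by (rule finite_lists_length_eq[OF finite_actions])
  have val: "set L \<subseteq> actions n" if "L \<in> \<L> k" for L k using that by (auto simp: \<L>_def)
  have finK: "finite \<K>" unfolding \<K>_def using fin by auto
  have sH: "H L \<in> sets ?N" if "set L \<subseteq> actions n" for L
    using measurable_history[of L n "\<lambda>_. t" ?N "\<lambda>x. x"] that unfolding H_def pred_def
    by (auto simp: actions_def)
  have mH: "measure ?N (H L) = exp (- (real n * t)) * (t ^ k / fact k) * (1 / (2 * real (n - 1))) ^ k"
    if "L \<in> \<L> k" for L k
  proof -
    have "\<forall>(v, w, u)\<in>set L. v < n \<and> w < n \<and> w \<noteq> v" "length L = k"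
      using that by (auto simp: \<L>_def actions_def)
    then show ?thesis
      using emeasure_history[of L n t] t unfolding H_def measure_def by simp
  qed
  have "(\<Sum>L\<in>\<K>. measure ?N (H L)) = measure ?N (\<Union>L\<in>\<K>. H L)"
  proof (rule N.finite_measure_finite_Union[symmetric, OF finK])
    show "H ` \<K> \<subseteq> N.events" using sH by (auto simp: \<K>_def \<L>_def)
    show "disjoint_family_on H \<K>"
      unfolding disjoint_family_on_def
    proof (intro ballI impI)
      fix L L' assume L: "L \<in> \<K>" "L' \<in> \<K>" "L \<noteq> L'"
      then have "set L \<subseteq> actions n" "set L' \<subseteq> actions n" by (auto simp: \<K>_def \<L>_def)
      then have "\<not> (history n L t \<omega> \<and> history n L' t \<omega>)" for \<omega>
        using history_unique[of n L t \<omega> L'] L(3) by blast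
      then show "H L \<inter> H L' = {}" unfolding H_def by blast
    qed
  qed
  also have "\<dots> \<le> measure ?N E"
  proof (rule N.finite_measure_mono_AE[OF _ E])
    show "AE \<omega> in ?N. \<omega> \<in> (\<Union>L\<in>\<K>. H L) \<longrightarrow> \<omega> \<in> E"
      using AE_positive_waits
    proof eventually_elim
      fix \<omega> assume pos: "positive_waits n \<omega>"
      show "\<omega> \<in> (\<Union>L\<in>\<K>. H L) \<longrightarrow> \<omega> \<in> E"
      proof
        assume "\<omega> \<in> (\<Union>L\<in>\<K>. H L)"
        then obtain L where L: "L \<in> \<K>" "\<omega> \<in> H L" by blast
        have "set L \<subseteq> actions n" "fold perform L \<sigma> \<in> S" using L(1) by (auto simp: \<K>_def \<L>_def)
        moreover have "\<omega> \<in> space ?N" "history n L t \<omega>" using L(2) by (auto simp: H_def)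
        ultimately show "\<omega> \<in> E" using hist pos by blast
      qed
    qed
  qed
  also have "(\<Sum>L\<in>\<K>. measure ?N (H L)) = (\<Sum>L\<in>(\<Union>k\<le>m. \<L> k). indicator S (fold perform L \<sigma>) * measure ?N (H L))"
    unfolding \<K>_def using fin by (intro sum.mono_neutral_cong_left) (auto simp: indicator_def)
  also have "\<dots> = (\<Sum>k\<le>m. \<Sum>L\<in>\<L> k. indicator S (fold perform L \<sigma>) * measure ?N (H L))"
    using fin by (intro sum.UNION_disjoint) (auto simp: \<L>_def)
  also have "\<dots> = (\<Sum>k\<le>m. exp (- (real n * t)) * (real n * t) ^ k / fact k * (step_mean n ^^ k) (indicator S) \<sigma>)"
  proof (rule sum.cong[OF refl])
    fix k
    let ?c = "exp (- (real n * t)) * (t ^ k / fact k) * (1 / (2 * real (n - 1))) ^ k"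
    have "(\<Sum>L\<in>\<L> k. indicator S (fold perform L \<sigma>) * measure ?N (H L)) = (\<Sum>L\<in>\<L> k. indicator S (fold perform L \<sigma>)) * ?c"
      unfolding sum_distrib_right by (rule sum.cong) (simp_all only: mH)
    also have "(\<Sum>L\<in>\<L> k. indicator S (fold perform L \<sigma>)) = real (2 * n * (n - 1)) ^ k * (step_mean n ^^ k) (indicator S) \<sigma>"
      unfolding \<L>_def by (rule sum_over_histories[OF n])
    also have "real (2 * n * (n - 1)) ^ k * (step_mean n ^^ k) (indicator S) \<sigma> * ?c =
        exp (- (real n * t)) * (real n * t) ^ k / fact k * (step_mean n ^^ k) (indicator S) \<sigma>"
      unfolding of_nat_mult of_nat_numeral by (rule history_weight) (use n in simp)
    finally show "(\<Sum>L\<in>\<L> k. indicator S (fold perform L \<sigma>) * measure ?N (H L)) =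
      exp (- (real n * t)) * (real n * t) ^ k / fact k * (step_mean n ^^ k) (indicator S) \<sigma>" .
  qed
  finally show ?thesis .
qed

section \<open>Consensus persists and its time is measurable\<close>

definition consensus :: "nat \<Rightarrow> config \<Rightarrow> bool" where
  "consensus n \<sigma> \<longleftrightarrow> (\<forall>v<n. \<sigma> v = {WordA}) \<or> (\<forall>v<n. \<sigma> v = {WordB})"

lemma type_counts_consensus:
  assumes "0 < n"
  shows "type_counts n \<sigma> \<in> {(n, 0, 0), (0, n, 0)} \<longleftrightarrow> consensus n \<sigma>"
proof
  have full: "\<forall>v<n. \<sigma> v = V" if "card {v. v < n \<and> \<sigma> v = V} = n" for V
  proof -
    have "{v. v < n \<and> \<sigma> v = V} = {..<n}"
      by (rule card_subset_eq) (use that in auto)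
    then show ?thesis by auto
  qed
  assume "type_counts n \<sigma> \<in> {(n, 0, 0), (0, n, 0)}"
  then have "card {v. v < n \<and> \<sigma> v = {WordA}} = n \<or> card {v. v < n \<and> \<sigma> v = {WordB}} = n"
    by (auto simp: type_counts_def)
  then show "consensus n \<sigma>" unfolding consensus_def using full by blast
next
  have c: "card {v. v < n \<and> \<sigma> v = W} = (if W = V then n else 0)" if "\<forall>v<n. \<sigma> v = V" for V W
  proof -
    have "{v. v < n \<and> \<sigma> v = W} = (if W = V then {..<n} else {})" using that by auto
    then show ?thesis by simp
  qed
  have ne: "{WordA} \<noteq> {WordB}" "{WordA, WordB} \<noteq> {WordA}" "{WordA, WordB} \<noteq> {WordB}" by auto
  assume "consensus n \<sigma>"
  then show "type_counts n \<sigma> \<in> {(n, 0, 0), (0, n, 0)}"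
    unfolding consensus_def
  proof
    assume "\<forall>v<n. \<sigma> v = {WordA}"
    from c[OF this] show ?thesis using ne by (simp add: type_counts_def)
  next
    assume "\<forall>v<n. \<sigma> v = {WordB}"
    from c[OF this] show ?thesis using ne by (simp add: type_counts_def)
  qed
qed

lemma consensus_speak:
  assumes "consensus n \<sigma>" "v < n"
  shows "consensus n (speak v w u \<sigma>)"
proof -
  have "\<forall>v'<n. speak v w u \<sigma> v' = {s}" if \<sigma>: "\<forall>v<n. \<sigma> v = {s}" for s
  proof -
    have "spoken_word (\<sigma> v) u = s" using \<sigma> assms(2) by (simp add: spoken_word_def)
    then show ?thesis using \<sigma> assms(2) by (cases "w < n") (auto simp: speak_def Let_def)
  qed
  then show ?thesis using assms(1) unfolding consensus_def by blast
qed

lemma strictly_sorted_filter_append: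
  assumes "sorted_wrt (\<lambda>d e. f d < (f e :: real)) R"
  shows "filter (\<lambda>e. f e \<le> t) R @ filter (\<lambda>e. \<not> f e \<le> t) R = R"
  using assms
proof (induction R)
  case (Cons x R)
  show ?case
  proof (cases "f x \<le> t")
    case False
    then have "filter (\<lambda>e. f e \<le> t) R = []" "filter (\<lambda>e. \<not> f e \<le> t) R = R"
      using Cons.prems by (auto simp: filter_empty_conv intro!: filter_True)
    then show ?thesis using False by simp
  qed (use Cons in simp)
qed simp

text \<open>
The rings up to \<open>t1\<close> form an initial segment of those up to \<open>t\<close>, and no action leaves consensus.
\<close>

lemma consensus_persists:
  assumes hist: "history n L t \<omega>" "positive_waits n \<omega>" "set L \<subseteq> actions n"
    and t1: "t1 \<le> t" and c: "consensus n (config_at n \<sigma> \<omega> t1)"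
  shows "consensus n (config_at n \<sigma> \<omega> t)"
proof -
  from rings_of_history[OF hist] obtain R where
    *: "sorted_wrt (\<lambda>d e. ring_time \<omega> d < ring_time \<omega> e) R \<and>
       set R = {e \<in> {..<n} \<times> UNIV. ring_time \<omega> e \<le> t} \<and>
       (\<forall>\<sigma>. fold (ring_action \<omega>) R \<sigma> = fold perform L \<sigma>)" ..
  note R = conjunct1[OF *] conjunct1[OF conjunct2[OF *]]
  let ?A = "filter (\<lambda>e. ring_time \<omega> e \<le> t1) R" and ?B = "filter (\<lambda>e. \<not> ring_time \<omega> e \<le> t1) R"
  have A: "rings_until n \<omega> t1 = ?A"
  proof (rule rings_until_eqI)
    show "sorted_wrt (\<lambda>d e. ring_time \<omega> d < ring_time \<omega> e) ?A" using R(1) by (rule sorted_wrt_filter)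
    show "set ?A = {e \<in> {..<n} \<times> UNIV. ring_time \<omega> e \<le> t1}"
      unfolding set_filter R(2) using t1 by force
  qed
  have "consensus n (fold (ring_action \<omega>) ?B \<tau>)" if "consensus n \<tau>" for \<tau>
  proof -
    have "fst e < n" if "e \<in> set ?B" for e
    proof -
      have "e \<in> set R" using that by simp
      then show ?thesis unfolding R(2) by auto
    qed
    moreover have "consensus n (fold (ring_action \<omega>) B \<tau>)" if "\<forall>e\<in>set B. fst e < n" for B
      using that \<open>consensus n \<tau>\<close>
    proof (induction B arbitrary: \<tau>)
      case (Cons e B)
      have "consensus n (ring_action \<omega> e \<tau>)"
        using Cons.prems by (auto simp: ring_action_def consensus_speak split: prod.splits)
      then show ?case using Cons by simp
    qed simp
    ultimately show ?thesis by blast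
  qed
  then have "consensus n (fold (ring_action \<omega>) (?A @ ?B) \<sigma>)"
    using c unfolding config_at_def A by simp
  then show ?thesis
    unfolding config_at_def rings_until_eqI[OF R] strictly_sorted_filter_append[OF R(1)] .
qed

lemma measurable_coordinate_all:
  "(\<lambda>\<omega>. \<omega> e) \<in> measurable (naming_space n) mark_space"
proof (cases "e \<in> {..<n} \<times> UNIV")
  case True
  then show ?thesis by (cases e) (auto intro: measurable_coordinate)
next
  case False
  then have "\<omega> e = undefined" if "\<omega> \<in> space (naming_space n)" for \<omega> :: outcome
    using that unfolding space_naming_space by (rule PiE_arb[rotated])
  then show ?thesis
    by (subst measurable_cong[where g="\<lambda>_. undefined"]) (auto simp: space_pair_measure)
qed

lemma measurable_ring_time: "(\<lambda>\<omega>. ring_time \<omega> e) \<in> borel_measurable (naming_space n)"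
proof -
  obtain v k where e: "e = (v, k)" by (cases e)
  have [measurable]: "(\<lambda>\<omega>. \<omega> (v, j)) \<in> measurable (naming_space n) mark_space" for j
    by (rule measurable_coordinate_all)
  show ?thesis unfolding e ring_time_def by simp
qed

text \<open>
Infinite sets of rings are sent to the empty set, which agrees with \<open>rings_until\<close> and leaves only
countably many values.
\<close>

lemma measurable_rings_before:
  assumes \<tau>: "\<tau> \<in> borel_measurable (naming_space n)"
  defines "I \<equiv> {..<n} \<times> (UNIV :: nat set)"
  shows "(\<lambda>\<omega>. if finite {e \<in> I. ring_time \<omega> e \<le> \<tau> \<omega>} then {e \<in> I. ring_time \<omega> e \<le> \<tau> \<omega>} else {})
    \<in> measurable (naming_space n) (count_space {F. finite F \<and> F \<subseteq> I})"
    (is "?f \<in> _")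
proof -
  let ?S = "\<lambda>\<omega>. {e \<in> I. ring_time \<omega> e \<le> \<tau> \<omega>}" and ?A = "{F. finite F \<and> F \<subseteq> I}"
  have cI: "countable I" by simp
  have cA: "countable ?A" using countable_Collect_finite_subset[OF cI] by (simp add: conj_commute)
  have S: "{\<omega> \<in> space (naming_space n). ?S \<omega> = F} \<in> sets (naming_space n)" if "F \<subseteq> I" for F
  proof -
    have "?S \<omega> = F \<longleftrightarrow> (\<forall>e\<in>I. ring_time \<omega> e \<le> \<tau> \<omega> \<longleftrightarrow> e \<in> F)" for \<omega> using that by auto
    moreover have "{\<omega> \<in> space (naming_space n). \<forall>e\<in>I. ring_time \<omega> e \<le> \<tau> \<omega> \<longleftrightarrow> e \<in> F} \<in> sets (naming_space n)"
    proof (rule sets.sets_Collect_countable_Ball)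
      fix e
      have "{\<omega> \<in> space (naming_space n). ring_time \<omega> e \<le> \<tau> \<omega>} \<in> sets (naming_space n)"
        using measurable_ring_time \<tau> by (rule borel_measurable_le)
      then show "{\<omega> \<in> space (naming_space n). (ring_time \<omega> e \<le> \<tau> \<omega>) = (e \<in> F)} \<in> sets (naming_space n)"
        by (cases "e \<in> F") (auto intro: sets.sets_Collect_neg)
    qed
    ultimately show ?thesis by simp
  qed
  show ?thesis
  proof (subst measurable_count_space_eq_countable[OF cA], intro conjI ballI)
    show "?f \<in> space (naming_space n) \<rightarrow> ?A" by auto
    fix F assume F: "F \<in> ?A"
    show "?f -` {F} \<inter> space (naming_space n) \<in> sets (naming_space n)"
    proof (cases "F = {}")
      case False
      then have "?f -` {F} \<inter> space (naming_space n) = {\<omega> \<in> space (naming_space n). ?S \<omega> = F}"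
        using F by (auto split: if_splits)
      then show ?thesis using S F by simp
    next
      case True
      have "?f -` {F} \<inter> space (naming_space n) =
          space (naming_space n) - (\<Union>F'\<in>?A - {{}}. {\<omega> \<in> space (naming_space n). ?S \<omega> = F'})"
        unfolding True by (auto split: if_splits)
      also have "\<dots> \<in> sets (naming_space n)"
        using cA S by (intro sets.compl_sets sets.countable_UN') auto
      finally show ?thesis .
    qed
  qed
qed

lemma measurable_insort_key:
  fixes f :: "'w \<Rightarrow> 'e::countable \<Rightarrow> real"
  assumes f: "\<And>e. (\<lambda>\<omega>. f \<omega> e) \<in> borel_measurable M"
  shows "(\<lambda>\<omega>. insort_key (f \<omega>) x xs) \<in> measurable M (count_space UNIV)"
proof (induction xs)
  case (Cons y ys)
  note [measurable] = Cons f
  show ?case by simp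
qed simp

lemma measurable_sort_key:
  fixes f :: "'w \<Rightarrow> 'e::countable \<Rightarrow> real"
  assumes f: "\<And>e. (\<lambda>\<omega>. f \<omega> e) \<in> borel_measurable M"
  shows "(\<lambda>\<omega>. sort_key (f \<omega>) xs) \<in> measurable M (count_space UNIV)"
proof (induction xs)
  case (Cons x xs)
  show ?case unfolding sort_key_simps
    by (rule measurable_compose_countable[OF _ Cons]) (rule measurable_insort_key[OF f])
qed simp

lemma measurable_rings_until:
  assumes \<tau>: "\<tau> \<in> borel_measurable (naming_space n)"
  shows "(\<lambda>\<omega>. rings_until n \<omega> (\<tau> \<omega>)) \<in> measurable (naming_space n) (count_space UNIV)"
proof -
  let ?S = "\<lambda>\<omega>. {e \<in> {..<n} \<times> UNIV. ring_time \<omega> e \<le> \<tau> \<omega>}"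
  let ?g = "\<lambda>F \<omega>. sort_key (ring_time \<omega>) (map prod_decode (sorted_list_of_set (prod_encode ` F)))"
  have eq: "rings_until n \<omega> (\<tau> \<omega>) = ?g (if finite (?S \<omega>) then ?S \<omega> else {}) \<omega>" for \<omega>
  proof (cases "finite (?S \<omega>)")
    case False
    then have "infinite (prod_encode ` ?S \<omega>)"
      using finite_imageD[of prod_encode "?S \<omega>"] inj_prod_encode by (auto intro: inj_on_subset)
    then show ?thesis using False by (simp add: rings_until_def)
  qed (simp add: rings_until_def)
  have cA: "countable {F. finite F \<and> F \<subseteq> {..<n} \<times> (UNIV :: nat set)}"
    using countable_Collect_finite_subset[of "{..<n} \<times> (UNIV :: nat set)"] by (simp add: conj_commute)
  show ?thesis unfolding eq
    by (rule measurable_compose_countable'[OF _ measurable_rings_before[OF \<tau>] cA])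
       (rule measurable_sort_key[OF measurable_ring_time])
qed

lemma pred_fold_ring_action:
  "Measurable.pred (naming_space n) (\<lambda>\<omega>. P (fold (ring_action \<omega>) l \<sigma>))"
proof (induction l arbitrary: \<sigma>)
  case (Cons e l)
  obtain v k where e: "e = (v, k)" by (cases e)
  have [measurable]: "(\<lambda>\<omega>. \<omega> e) \<in> measurable (naming_space n) mark_space"
    by (rule measurable_coordinate_all)
  note [measurable] = Cons
  have w: "(\<lambda>\<omega>. fst (snd (\<omega> e))) \<in> measurable (naming_space n) (count_space UNIV)" by measurable
  have u: "(\<lambda>\<omega>. snd (snd (\<omega> e)) = WordA) \<in> measurable (naming_space n) (count_space UNIV)" by measurable
  let ?u = "\<lambda>b. if b then WordA else WordB"
  have "Measurable.pred (naming_space n) (\<lambda>\<omega>. P (fold (ring_action \<omega>) l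
     (speak v (fst (snd (\<omega> e))) (?u (snd (snd (\<omega> e)) = WordA)) \<sigma>)))"
    by (rule measurable_compose_countable[OF measurable_compose_countable[OF Cons u] w])
  moreover have "ring_action \<omega> e \<sigma> = speak v (fst (snd (\<omega> e))) (?u (snd (snd (\<omega> e)) = WordA)) \<sigma>" for \<omega>
  proof -
    have "?u (snd (snd (\<omega> e)) = WordA) = snd (snd (\<omega> e))" by (cases "snd (snd (\<omega> e))") auto
    then show ?thesis by (simp add: ring_action_def e split: prod.splits)
  qed
  ultimately show ?case by simp
qed simp

lemma pred_consensus_at:
  assumes "\<tau> \<in> borel_measurable (naming_space n)"
  shows "Measurable.pred (naming_space n) (\<lambda>\<omega>. consensus n (config_at n \<sigma> \<omega> (\<tau> \<omega>)))"
  unfolding config_at_def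
  by (rule measurable_compose_countable[OF pred_fold_ring_action measurable_rings_until[OF assms]])

lemma config_at_cong:
  assumes "{e \<in> {..<n} \<times> UNIV. ring_time \<omega> e \<le> s} = {e \<in> {..<n} \<times> UNIV. ring_time \<omega> e \<le> t}"
  shows "config_at n \<sigma> \<omega> s = config_at n \<sigma> \<omega> t"
  unfolding config_at_def rings_until_def assms ..

lemma config_at_infinite:
  assumes "infinite {e \<in> {..<n} \<times> UNIV. ring_time \<omega> e \<le> t}"
  shows "config_at n \<sigma> \<omega> t = \<sigma>"
proof -
  have "infinite (prod_encode ` {e \<in> {..<n} \<times> UNIV. ring_time \<omega> e \<le> t})"
    using assms finite_image_iff[OF inj_on_subset[OF inj_prod_encode subset_UNIV]] by blast
  then show ?thesis by (simp add: config_at_def rings_until_def)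
qed

text \<open>
The configuration changes only at ring times, so the infimum may be taken over time \<open>0\<close> and the
ring times, as long as finitely many rings have occurred. If infinitely many rings occur by time
\<open>t\<close>, the configuration is the initial one from \<open>t\<close> on, and rational times suffice. This covers
every outcome, so the consensus time is measurable without completing the measure.
\<close>

lemma consensus_time_countable:
  fixes n \<omega> X Y
  assumes n: "0 < n"
  defines "c \<equiv> \<lambda>t. consensus n (config_at n (initial_config X Y) \<omega> t)"
  defines "h \<equiv> \<lambda>t. if 0 \<le> t \<and> c t then ereal t else \<infinity>"
  shows "consensus_time n X Y \<omega> =
     min (h 0) (min (INF e\<in>{..<n} \<times> UNIV. h (ring_time \<omega> e)) (INF q. h (real_of_rat q)))"
    (is "_ = ?R")
proof (rule antisym)
  have T: "consensus_time n X Y \<omega> = (INF t\<in>{t. 0 \<le> t \<and> c t}. ereal t)"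
    unfolding consensus_time_def naming_game_def type_counts_consensus[OF n] c_def ..
  have le: "consensus_time n X Y \<omega> \<le> h t" for t
    unfolding T h_def by (auto intro: INF_lower)
  then show "consensus_time n X Y \<omega> \<le> ?R"
    by (simp add: le_INF_iff)
  show "?R \<le> consensus_time n X Y \<omega>"
    unfolding T
  proof (rule INF_greatest)
    fix t assume "t \<in> {t. 0 \<le> t \<and> c t}"
    then have t: "0 \<le> t" "c t" by auto
    let ?S = "\<lambda>t. {e \<in> {..<n} \<times> UNIV. ring_time \<omega> e \<le> t}"
    show "?R \<le> ereal t"
    proof (cases "finite (?S t)")
      case True
      \<comment> \<open>The last ring time before \<open>t\<close>, or \<open>0\<close> if there is none.\<close>
      define t0 where "t0 = Max (insert 0 (ring_time \<omega> ` {e \<in> ?S t. 0 \<le> ring_time \<omega> e}))"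
      have fin: "finite (insert 0 (ring_time \<omega> ` {e \<in> ?S t. 0 \<le> ring_time \<omega> e}))"
        using True by (intro finite.insertI finite_imageI) (rule finite_subset[of _ "?S t"], auto)
      have mem: "t0 \<in> insert 0 (ring_time \<omega> ` {e \<in> ?S t. 0 \<le> ring_time \<omega> e})"
        unfolding t0_def using fin by (intro Max_in) auto
      then have t0: "0 \<le> t0" "t0 \<le> t" using t by auto
      have "ring_time \<omega> e \<le> t0" if "e \<in> ?S t" for e
      proof (cases "0 \<le> ring_time \<omega> e")
        case True
        then show ?thesis unfolding t0_def using that fin by (intro Max_ge) auto
      qed (use t0 in simp)
      then have "?S t0 = ?S t" using t0(2) by auto
      then have "c t0" using t(2) config_at_cong[of n \<omega> t0 t] unfolding c_def by simp
      then have ht: "h t0 = ereal t0" using t0 by (simp add: h_def)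
      consider "t0 = 0" | e where "e \<in> {..<n} \<times> UNIV" "t0 = ring_time \<omega> e" using mem by auto
      then have "?R \<le> h t0"
      proof cases
        case 1
        then show ?thesis by simp
      next
        case 2
        then have "(INF e\<in>{..<n} \<times> UNIV. h (ring_time \<omega> e)) \<le> h t0" by (auto intro: INF_lower)
        then show ?thesis by (meson min.coboundedI1 min.coboundedI2)
      qed
      also have "h t0 \<le> ereal t" using ht t0(2) by simp
      finally show ?thesis .
    next
      case False
      have init: "c s" if "t \<le> s" for s
      proof -
        have "?S t \<subseteq> ?S s" using that by auto
        then have "infinite (?S s)" using False finite_subset by blast
        then show ?thesis using t(2) False by (simp add: c_def config_at_infinite)
      qed
      have "?R \<le> ereal y" if y: "t < y" for y
      proof -
        obtain q where q: "t < real_of_rat q" "real_of_rat q < y" using of_rat_dense[OF y] by blast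
        then have "0 \<le> real_of_rat q" using t by linarith
        then have "h (real_of_rat q) \<le> ereal y" using q t init[of "real_of_rat q"] by (simp add: h_def)
        moreover have "(INF q. h (real_of_rat q)) \<le> h (real_of_rat q)" by (rule INF_lower) simp
        ultimately show ?thesis by (meson min.coboundedI2 order_trans)
      qed
      then have "?R \<le> x" if "ereal t < x" for x
        using that by (cases x) auto
      then show ?thesis by (rule dense_ge)
    qed
  qed
qed

lemma measurable_consensus_time:
  assumes n: "0 < n"
  shows "consensus_time n X Y \<in> borel_measurable (naming_space n)"
proof -
  let ?h = "\<lambda>t \<omega>. if 0 \<le> t \<and> consensus n (config_at n (initial_config X Y) \<omega> t) then ereal t else \<infinity>"
  have h: "(\<lambda>\<omega>. ?h (\<tau> \<omega>) \<omega>) \<in> borel_measurable (naming_space n)"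
    if [measurable]: "\<tau> \<in> borel_measurable (naming_space n)" for \<tau>
  proof -
    note [measurable] = pred_consensus_at[OF that]
    show ?thesis by measurable
  qed
  have "(\<lambda>\<omega>. min (?h 0 \<omega>) (min (INF e\<in>{..<n} \<times> UNIV. ?h (ring_time \<omega> e) \<omega>) (INF q. ?h (real_of_rat q) \<omega>)))
      \<in> borel_measurable (naming_space n)"
    by (intro borel_measurable_min borel_measurable_INF h measurable_ring_time) auto
  then show ?thesis
    by (simp add: consensus_time_countable[OF n, abs_def])
qed

lemma prob_consensus_time_gt_le:
  assumes n: "2 \<le> n" and t: "0 \<le> t" "t = c * ln (real n)"
  shows "\<P>(\<omega> in naming_space n. consensus_time n X Y \<omega> / ereal (ln (real n)) > ereal c)
    \<le> 1 - (\<Sum>k\<le>m. exp (- (real n * t)) * (real n * t) ^ k / fact k *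
        (step_mean n ^^ k) (indicator {\<sigma>. consensus n \<sigma>}) (initial_config X Y))"
proof -
  let ?N = "naming_space n"
  interpret prob_space ?N by (rule prob_space_naming_space)
  let ?E = "{\<omega> \<in> space ?N. consensus_time n X Y \<omega> / ereal (ln (real n)) > ereal c}"
  have ln: "0 < ln (real n)" using n by simp
  have [measurable]: "consensus_time n X Y \<in> borel_measurable ?N"
    using n by (intro measurable_consensus_time) auto
  have E: "?E \<in> sets ?N" by measurable
  have "(\<Sum>k\<le>m. exp (- (real n * t)) * (real n * t) ^ k / fact k *
        (step_mean n ^^ k) (indicator {\<sigma>. consensus n \<sigma>}) (initial_config X Y)) \<le> prob (space ?N - ?E)"
  proof (rule poisson_step_mean_le_prob[OF n t(1)])
    show "space ?N - ?E \<in> sets ?N" using E by (rule sets.compl_sets)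
    fix \<omega> L assume L: "\<omega> \<in> space ?N" "positive_waits n \<omega>" "set L \<subseteq> actions n" "history n L t \<omega>"
      "fold perform L (initial_config X Y) \<in> {\<sigma>. consensus n \<sigma>}"
    then have "consensus n (config_at n (initial_config X Y) \<omega> t)"
      using config_at_history[OF L(4,2,3)] by simp
    then have "consensus_time n X Y \<omega> \<le> ereal t"
      unfolding consensus_time_def naming_game_def using n t(1) type_counts_consensus[of n]
      by (intro INF_lower) auto
    then have "consensus_time n X Y \<omega> / ereal (ln (real n)) \<le> ereal t / ereal (ln (real n))"
      using ln by (intro ereal_divide_right_mono) auto
    also have "\<dots> = ereal c" using ln t(2) by simp
    finally show "\<omega> \<in> space ?N - ?E" using L(1) by auto
  qed
  then show ?thesis using prob_compl[OF E] by simp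
qed

lemma prob_consensus_time_gt_ge:
  assumes n: "2 \<le> n" and t: "0 \<le> t" "c * ln (real n) < t"
  shows "(\<Sum>k\<le>m. exp (- (real n * t)) * (real n * t) ^ k / fact k *
        (step_mean n ^^ k) (indicator {\<sigma>. \<not> consensus n \<sigma>}) (initial_config X Y)) \<le>
    \<P>(\<omega> in naming_space n. consensus_time n X Y \<omega> / ereal (ln (real n)) > ereal c)"
proof (rule poisson_step_mean_le_prob[OF n t(1)])
  let ?N = "naming_space n"
  have ln: "0 < ln (real n)" using n by simp
  have [measurable]: "consensus_time n X Y \<in> borel_measurable ?N"
    using n by (intro measurable_consensus_time) auto
  show "{\<omega> \<in> space ?N. consensus_time n X Y \<omega> / ereal (ln (real n)) > ereal c} \<in> sets ?N" by measurable
  fix \<omega> L assume L: "\<omega> \<in> space ?N" "positive_waits n \<omega>" "set L \<subseteq> actions n" "history n L t \<omega>"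
    "fold perform L (initial_config X Y) \<in> {\<sigma>. \<not> consensus n \<sigma>}"
  then have nc: "\<not> consensus n (config_at n (initial_config X Y) \<omega> t)"
    using config_at_history[OF L(4,2,3)] by simp
  have "ereal t \<le> consensus_time n X Y \<omega>"
    unfolding consensus_time_def naming_game_def
  proof (rule INF_greatest)
    fix s assume "s \<in> {t. 0 \<le> t \<and> type_counts n (config_at n (initial_config X Y) \<omega> t) \<in> {(n, 0, 0), (0, n, 0)}}"
    then have "consensus n (config_at n (initial_config X Y) \<omega> s)"
      using n type_counts_consensus[of n] by auto
    then have "\<not> s \<le> t" using consensus_persists[OF L(4,2,3)] nc by blast
    then show "ereal t \<le> ereal s" by simp
  qed
  then have "ereal t / ereal (ln (real n)) \<le> consensus_time n X Y \<omega> / ereal (ln (real n))"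
    using ln by (intro ereal_divide_right_mono) auto
  moreover have "ereal c < ereal t / ereal (ln (real n))"
    using ln t(2) by (simp add: pos_less_divide_eq)
  ultimately show "\<omega> \<in> {\<omega> \<in> space ?N. consensus_time n X Y \<omega> / ereal (ln (real n)) > ereal c}"
    using L(1) by (auto intro: less_le_trans)
qed

section \<open>One step of the chain in terms of the lead and the mixed individuals\<close>

definition valid :: "nat \<Rightarrow> config \<Rightarrow> bool" where
  "valid n \<sigma> \<longleftrightarrow> (\<forall>v<n. \<sigma> v \<in> {{WordA}, {WordB}, {WordA, WordB}})"

definition lead_value :: "word set \<Rightarrow> real" where
  "lead_value V = (if V = {WordA} then 1 else if V = {WordB} then - 1 else 0)"

definition mixed_value :: "word set \<Rightarrow> real" where
  "mixed_value V = (if V = {WordA, WordB} then 1 else 0)"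

definition lead :: "nat \<Rightarrow> config \<Rightarrow> real" where
  "lead n \<sigma> = (\<Sum>v<n. lead_value (\<sigma> v))"

definition mixed :: "nat \<Rightarrow> config \<Rightarrow> real" where
  "mixed n \<sigma> = (\<Sum>v<n. mixed_value (\<sigma> v))"

definition number_of :: "nat \<Rightarrow> config \<Rightarrow> word set \<Rightarrow> real" where
  "number_of n \<sigma> V = real (card {v. v < n \<and> \<sigma> v = V})"

lemma vocabularies_distinct:
  "{WordA} \<noteq> {WordB}" "{WordB} \<noteq> {WordA}" "{WordA, WordB} \<noteq> {WordA}" "{WordA, WordB} \<noteq> {WordB}"
  "{WordA} \<noteq> {WordA, WordB}" "{WordB} \<noteq> {WordA, WordB}" "insert WordB {WordA} = {WordA, WordB}"
  by auto

lemma sum_over_types: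
  fixes H :: "word set \<Rightarrow> real"
  assumes "valid n \<sigma>"
  shows "(\<Sum>v<n. H (\<sigma> v)) = number_of n \<sigma> {WordA} * H {WordA} + number_of n \<sigma> {WordB} * H {WordB}
    + number_of n \<sigma> {WordA, WordB} * H {WordA, WordB}"
proof -
  have one: "(\<Sum>v<n. if \<sigma> v = V then H V else 0) = number_of n \<sigma> V * H V" for V
  proof -
    have "(\<Sum>v<n. if \<sigma> v = V then H V else 0) = (\<Sum>v\<in>{v\<in>{..<n}. \<sigma> v = V}. H V)"
      by (rule sum.inter_filter[symmetric]) simp
    then show ?thesis by (simp add: number_of_def)
  qed
  have "(\<Sum>v<n. H (\<sigma> v)) = (\<Sum>v<n. (if \<sigma> v = {WordA} then H {WordA} else 0)
      + (if \<sigma> v = {WordB} then H {WordB} else 0) + (if \<sigma> v = {WordA, WordB} then H {WordA, WordB} else 0))"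
  proof (rule sum.cong[OF refl])
    fix v assume "v \<in> {..<n}"
    then have "\<sigma> v \<in> {{WordA}, {WordB}, {WordA, WordB}}" using assms by (auto simp: valid_def)
    then show "H (\<sigma> v) = (if \<sigma> v = {WordA} then H {WordA} else 0)
      + (if \<sigma> v = {WordB} then H {WordB} else 0) + (if \<sigma> v = {WordA, WordB} then H {WordA, WordB} else 0)"
      using vocabularies_distinct by (elim insertE emptyE) simp_all
  qed
  then show ?thesis by (simp add: sum.distrib one)
qed

lemma lead_mixed_number_of:
  assumes "valid n \<sigma>"
  shows "lead n \<sigma> = number_of n \<sigma> {WordA} - number_of n \<sigma> {WordB}"
    and "mixed n \<sigma> = number_of n \<sigma> {WordA, WordB}"
    and "real n = number_of n \<sigma> {WordA} + number_of n \<sigma> {WordB} + number_of n \<sigma> {WordA, WordB}"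
  using sum_over_types[OF assms, of lead_value] sum_over_types[OF assms, of mixed_value]
    sum_over_types[OF assms, of "\<lambda>_. 1"] vocabularies_distinct
  by (simp_all add: lead_def mixed_def lead_value_def mixed_value_def)

text \<open>
The change of the sum of \<open>h\<close> over all vocabularies when an individual with vocabulary \<open>V\<close> speaks to
one with vocabulary \<open>W\<close>.
\<close>

definition type_change :: "(word set \<Rightarrow> real) \<Rightarrow> word set \<Rightarrow> word set \<Rightarrow> word \<Rightarrow> real" where
  "type_change h V W u = (let s = spoken_word V u in
     if s \<in> W then (h {s} - h V) + (h {s} - h W) else h (insert s W) - h W)"

lemma sum_type_change:
  fixes h :: "word set \<Rightarrow> real"
  assumes "v < n" "w < n" "w \<noteq> v"
  shows "(\<Sum>i<n. h (speak v w u \<sigma> i)) = (\<Sum>i<n. h (\<sigma> i)) + type_change h (\<sigma> v) (\<sigma> w) u"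
proof -
  have upd: "(\<Sum>i<n. h ((\<tau>(j := V)) i)) = (\<Sum>i<n. h (\<tau> i)) + (h V - h (\<tau> j))" if "j < n" for j V \<tau>
  proof -
    have "(\<Sum>i<n. h ((\<tau>(j := V)) i)) = h V + (\<Sum>i\<in>{..<n} - {j}. h (\<tau> i))"
      using that by (subst sum.remove[of _ j]) auto
    moreover have "(\<Sum>i<n. h (\<tau> i)) = h (\<tau> j) + (\<Sum>i\<in>{..<n} - {j}. h (\<tau> i))"
      using that by (subst sum.remove[of _ j]) auto
    ultimately show ?thesis by simp
  qed
  show ?thesis
    using assms unfolding speak_def type_change_def Let_def
    by (cases "spoken_word (\<sigma> v) u \<in> \<sigma> w") (simp_all only: if_True if_False upd fun_upd_other, simp_all)
qed

text \<open>
\<open>n (n - 1)\<close> times the expected change in one step of a function of \<open>D = X - Y\<close> and \<open>Z\<close>. Here \<open>x\<close> and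
\<open>y\<close> are the numbers of individuals of type \<open>A\<close> and \<open>B\<close>; each coefficient counts the ordered pairs
of speaker and listener, with weight \<open>1 / 2\<close> for each word of a mixed speaker.
\<close>

definition generator :: "real \<Rightarrow> (real \<Rightarrow> real \<Rightarrow> real) \<Rightarrow> real \<Rightarrow> real \<Rightarrow> real" where
  "generator n g D Z = (let x = (n - Z + D) / 2; y = (n - Z - D) / 2; \<Delta> = (\<lambda>a b. g (D + a) (Z + b) - g D Z) in
     3 / 2 * x * Z * \<Delta> 1 (- 1) + 3 / 2 * y * Z * \<Delta> (- 1) (- 1)
     + (x * y + x * Z / 2) * \<Delta> (- 1) 1 + (x * y + y * Z / 2) * \<Delta> 1 1
     + Z * (Z - 1) / 2 * (\<Delta> 2 (- 2) + \<Delta> (- 2) (- 2)))"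

lemma sum_actions:
  "(\<Sum>a\<in>actions n. F a) = (\<Sum>v<n. \<Sum>w\<in>{..<n} - {v}. F (v, w, WordA) + F (v, w, WordB))"
  for F :: "nat \<times> nat \<times> word \<Rightarrow> real"
proof -
  have eq: "actions n = (SIGMA v:{..<n}. SIGMA w:{..<n} - {v}. UNIV)"
    by (auto simp: actions_def)
  have u: "(\<Sum>u\<in>UNIV. G u) = G WordA + G WordB" for G :: "word \<Rightarrow> real"
    by (simp add: UNIV_word)
  have fin: "finite (UNIV :: word set)" by (simp add: UNIV_word)
  have "(\<Sum>w\<in>{..<n} - {v}. \<Sum>u\<in>UNIV. F (v, w, u)) = (\<Sum>p\<in>({..<n} - {v}) \<times> UNIV. F (v, p))" for v
    by (simp add: sum.cartesian_product split_beta')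
  moreover have "(\<Sum>v<n. \<Sum>p\<in>({..<n} - {v}) \<times> UNIV. F (v, p)) = sum F (SIGMA v:{..<n}. ({..<n} - {v}) \<times> UNIV)"
    by (subst sum.Sigma) (auto simp: fin split_beta')
  ultimately show ?thesis unfolding eq by (simp add: u)
qed

lemma step_mean_lead_mixed:
  assumes \<sigma>: "valid n \<sigma>" and n: "2 \<le> n"
  shows "step_mean n (\<lambda>\<tau>. g (lead n \<tau>) (mixed n \<tau>)) \<sigma> =
    g (lead n \<sigma>) (mixed n \<sigma>) + generator n g (lead n \<sigma>) (mixed n \<sigma>) / (real n * (real n - 1))"
proof -
  define D Z where "D = lead n \<sigma>" and "Z = mixed n \<sigma>"
  define x y where "x = number_of n \<sigma> {WordA}" and "y = number_of n \<sigma> {WordB}"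
  define G where "G V W u = g (D + type_change lead_value V W u) (Z + type_change mixed_value V W u)" for V W u
  define K where "K V W = G V W WordA + G V W WordB" for V W
  have xy: "D = x - y" "Z = number_of n \<sigma> {WordA, WordB}" "real n = x + y + Z"
    using lead_mixed_number_of[OF \<sigma>] by (simp_all add: D_def Z_def x_def y_def)
  have st: "(\<Sum>v<n. H (\<sigma> v)) = x * H {WordA} + y * H {WordB} + Z * H {WordA, WordB}" for H :: "word set \<Rightarrow> real"
    using sum_over_types[OF \<sigma>] xy(2) by (simp add: x_def y_def)
  have "(\<Sum>a\<in>actions n. (\<lambda>\<tau>. g (lead n \<tau>) (mixed n \<tau>)) (perform a \<sigma>)) = (\<Sum>v<n. \<Sum>w\<in>{..<n} - {v}. K (\<sigma> v) (\<sigma> w))"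
    unfolding sum_actions
  proof (intro sum.cong refl)
    fix v w assume "v \<in> {..<n}" "w \<in> {..<n} - {v}"
    then have "v < n" "w < n" "w \<noteq> v" by auto
    note * = sum_type_change[OF this, of lead_value] sum_type_change[OF this, of mixed_value]
    show "g (lead n (perform (v, w, WordA) \<sigma>)) (mixed n (perform (v, w, WordA) \<sigma>))
       + g (lead n (perform (v, w, WordB) \<sigma>)) (mixed n (perform (v, w, WordB) \<sigma>)) = K (\<sigma> v) (\<sigma> w)"
      unfolding K_def G_def D_def Z_def by (simp add: perform_def lead_def mixed_def *)
  qed
  also have "\<dots> = (\<Sum>v<n. (\<Sum>w<n. K (\<sigma> v) (\<sigma> w)) - K (\<sigma> v) (\<sigma> v))"
    by (intro sum.cong refl) (simp add: sum_diff1)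
  also have "\<dots> = (\<Sum>v<n. (\<lambda>V. x * K V {WordA} + y * K V {WordB} + Z * K V {WordA, WordB} - K V V) (\<sigma> v))"
    by (simp add: st)
  also have "\<dots> = x * (x * K {WordA} {WordA} + y * K {WordA} {WordB} + Z * K {WordA} {WordA, WordB} - K {WordA} {WordA})
     + y * (x * K {WordB} {WordA} + y * K {WordB} {WordB} + Z * K {WordB} {WordA, WordB} - K {WordB} {WordB})
     + Z * (x * K {WordA, WordB} {WordA} + y * K {WordA, WordB} {WordB} + Z * K {WordA, WordB} {WordA, WordB}
        - K {WordA, WordB} {WordA, WordB})"
    by (rule st)
  also have "\<dots> = 2 * (real n * (real n - 1) * g D Z + generator n g D Z)"
  proof -
    have "K {WordA} {WordA} = 2 * g D Z" "K {WordA} {WordB} = 2 * g (D + 1) (Z + 1)"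
      "K {WordA} {WordA, WordB} = 2 * g (D + 1) (Z - 1)"
      "K {WordB} {WordA} = 2 * g (D - 1) (Z + 1)" "K {WordB} {WordB} = 2 * g D Z"
      "K {WordB} {WordA, WordB} = 2 * g (D - 1) (Z - 1)"
      "K {WordA, WordB} {WordA} = g (D + 1) (Z - 1) + g (D - 1) (Z + 1)"
      "K {WordA, WordB} {WordB} = g (D + 1) (Z + 1) + g (D - 1) (Z - 1)"
      "K {WordA, WordB} {WordA, WordB} = g (D + 2) (Z - 2) + g (D - 2) (Z - 2)"
      using vocabularies_distinct
      by (simp_all add: K_def G_def type_change_def spoken_word_def lead_value_def mixed_value_def)
    moreover have half: "(real n - Z + D) / 2 = x" "(real n - Z - D) / 2 = y" using xy by simp_all
    ultimately show ?thesis
      unfolding generator_def Let_def half unfolding xy(3) by (simp add: field_simps)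
  qed
  finally have "step_mean n (\<lambda>\<tau>. g (lead n \<tau>) (mixed n \<tau>)) \<sigma> =
      2 * (real n * (real n - 1) * g D Z + generator n g D Z) / real (2 * n * (n - 1))"
    by (simp add: step_mean_def)
  also have "real (2 * n * (n - 1)) = 2 * (real n * (real n - 1))" using n by (simp add: of_nat_diff)
  also have "2 * (real n * (real n - 1) * g D Z + generator n g D Z) / (2 * (real n * (real n - 1))) =
     g D Z + generator n g D Z / (real n * (real n - 1))"
    using n by (simp add: add_divide_distrib)
  finally show ?thesis by (simp add: D_def Z_def)
qed

lemma state_bounds:
  assumes "valid n \<sigma>"
  shows "0 \<le> mixed n \<sigma>" "\<bar>lead n \<sigma>\<bar> \<le> real n - mixed n \<sigma>" "0 \<le> mixed n \<sigma> * (mixed n \<sigma> - 1)"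
    "mixed n \<sigma> \<le> real n" "\<bar>lead n \<sigma>\<bar> \<le> real n"
proof -
  show Z: "0 \<le> mixed n \<sigma>" by (auto simp: mixed_def mixed_value_def intro: sum_nonneg)
  show D: "\<bar>lead n \<sigma>\<bar> \<le> real n - mixed n \<sigma>"
    using lead_mixed_number_of[OF assms] by (auto simp: number_of_def)
  show "0 \<le> mixed n \<sigma> * (mixed n \<sigma> - 1)"
  proof -
    obtain k where k: "mixed n \<sigma> = real k"
      using lead_mixed_number_of(2)[OF assms] by (auto simp: number_of_def)
    show ?thesis unfolding k by (cases k) auto
  qed
  show "mixed n \<sigma> \<le> real n" "\<bar>lead n \<sigma>\<bar> \<le> real n" using Z D by linarith+
qed

lemma consensus_lead:
  assumes \<sigma>: "valid n \<sigma>"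
  shows "\<bar>lead n \<sigma>\<bar> = real n \<Longrightarrow> consensus n \<sigma>"
    and "\<not> consensus n \<sigma> \<Longrightarrow> \<bar>lead n \<sigma>\<bar> \<le> real n - 1"
    and "consensus n \<sigma> \<Longrightarrow> \<bar>lead n \<sigma>\<bar> = real n"
proof -
  define a b c where "a = card {v. v < n \<and> \<sigma> v = {WordA}}" and "b = card {v. v < n \<and> \<sigma> v = {WordB}}"
    and "c = card {v. v < n \<and> \<sigma> v = {WordA, WordB}}"
  have eq: "lead n \<sigma> = real a - real b" "real n = real a + real b + real c"
    using lead_mixed_number_of[OF \<sigma>] by (simp_all add: number_of_def a_def b_def c_def)
  have full: "\<forall>v<n. \<sigma> v = V" if "card {v. v < n \<and> \<sigma> v = V} = n" for V
  proof -
    have "{v. v < n \<and> \<sigma> v = V} = {..<n}"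
      by (rule card_subset_eq) (use that in auto)
    then show ?thesis by auto
  qed
  show 1: "consensus n \<sigma>" if "\<bar>lead n \<sigma>\<bar> = real n"
  proof -
    have "a = n \<or> b = n" using that eq by (auto simp: abs_if split: if_splits)
    then show ?thesis unfolding consensus_def a_def b_def using full by blast
  qed
  show "\<bar>lead n \<sigma>\<bar> \<le> real n - 1" if "\<not> consensus n \<sigma>"
  proof -
    have ne: "\<bar>lead n \<sigma>\<bar> \<noteq> real n" using 1 that by blast
    have "\<not> (b = 0 \<and> c = 0)" "\<not> (a = 0 \<and> c = 0)" using ne eq by auto
    then have "1 \<le> b + c" "1 \<le> a + c" by auto
    then have "1 \<le> real b + real c" "1 \<le> real a + real c" by linarith+
    then show ?thesis unfolding eq(1) eq(2) abs_le_iff by linarith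
  qed
  show "\<bar>lead n \<sigma>\<bar> = real n" if "consensus n \<sigma>"
    using that unfolding consensus_def lead_def
  proof
    assume "\<forall>v<n. \<sigma> v = {WordA}"
    then have "(\<Sum>v<n. lead_value (\<sigma> v)) = (\<Sum>v<n. 1)" by (intro sum.cong) (auto simp: lead_value_def)
    then show "\<bar>\<Sum>v<n. lead_value (\<sigma> v)\<bar> = real n" by simp
  next
    assume "\<forall>v<n. \<sigma> v = {WordB}"
    then have "(\<Sum>v<n. lead_value (\<sigma> v)) = (\<Sum>v<n. - 1)"
      using vocabularies_distinct by (intro sum.cong) (auto simp: lead_value_def)
    then show "\<bar>\<Sum>v<n. lead_value (\<sigma> v)\<bar> = real n" by simp
  qed
qed

text \<open>
The main tool for one-step estimates. If the increments of \<open>g\<close> are bounded by a polynomial in the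
increments \<open>a\<close>, \<open>b\<close> of \<open>D\<close> and \<open>Z\<close>, only three exact averages are needed: \<open>D Z\<close> for \<open>a\<close>, and the two
brackets for \<open>b\<close> and for \<open>a\<^sup>2\<close>, all over \<open>n (n - 1)\<close>. The sign \<open>s\<close> exploits the symmetry between the
two words.
\<close>

lemma step_mean_le_linear:
  assumes \<sigma>: "valid n \<sigma>" and n: "2 \<le> n" and s: "s \<in> {1, -1}" and e: "0 \<le> e"
  defines "D \<equiv> s * lead n \<sigma>" and "Z \<equiv> mixed n \<sigma>"
  assumes inc: "\<And>a b. \<lbrakk>\<bar>a\<bar> \<le> 2; \<bar>b\<bar> \<le> 2\<rbrakk> \<Longrightarrow>
      g (D + a) (Z + b) - g D Z \<le> \<alpha> * a + \<beta> * b + \<delta> * a\<^sup>2 + e"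
  shows "step_mean n (\<lambda>\<tau>. g (s * lead n \<tau>) (mixed n \<tau>)) \<sigma> \<le> g D Z
    + (\<alpha> * (D * Z) + \<beta> * ((real n)\<^sup>2 / 2 - 2 * real n * Z - Z\<^sup>2 / 2 - D\<^sup>2 / 2 + 2 * Z)
       + \<delta> * ((real n)\<^sup>2 / 2 + real n * Z + 5 / 2 * Z\<^sup>2 - D\<^sup>2 / 2 - 4 * Z)) / (real n * (real n - 1)) + e"
proof -
  let ?D = "lead n \<sigma>" and ?N = "real n"
  define x y where "x = (?N - Z + ?D) / 2" and "y = (?N - Z - ?D) / 2"
  define \<Delta> where "\<Delta> a b = g (s * (?D + a)) (Z + b) - g (s * ?D) Z" for a b
  define M where "M a b = \<alpha> * (s * a) + \<beta> * b + \<delta> * a\<^sup>2 + e" for a b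
  have pos: "0 \<le> x" "0 \<le> y" "0 \<le> Z" "0 \<le> Z * (Z - 1)"
    using state_bounds[OF \<sigma>] by (auto simp: x_def y_def Z_def)
  have sq: "s * s = 1" using s by auto
  have b: "\<Delta> a b \<le> M a b" if "\<bar>a\<bar> \<le> 2" "\<bar>b\<bar> \<le> 2" for a b
  proof -
    have "\<bar>s * a\<bar> \<le> 2" using that s by auto
    moreover have "(s * a)\<^sup>2 = a\<^sup>2" using sq by (simp add: power_mult_distrib power2_eq_square)
    ultimately show ?thesis
      using inc[of "s * a" b] that(2) by (simp add: \<Delta>_def M_def D_def distrib_left)
  qed
  have "generator n (\<lambda>D. g (s * D)) ?D Z =
     3 / 2 * x * Z * \<Delta> 1 (- 1) + 3 / 2 * y * Z * \<Delta> (- 1) (- 1)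
     + (x * y + x * Z / 2) * \<Delta> (- 1) 1 + (x * y + y * Z / 2) * \<Delta> 1 1
     + Z * (Z - 1) / 2 * (\<Delta> 2 (- 2) + \<Delta> (- 2) (- 2))"
    unfolding generator_def Let_def x_def y_def \<Delta>_def ..
  also have "\<dots> \<le> 3 / 2 * x * Z * M 1 (- 1) + 3 / 2 * y * Z * M (- 1) (- 1)
     + (x * y + x * Z / 2) * M (- 1) 1 + (x * y + y * Z / 2) * M 1 1
     + Z * (Z - 1) / 2 * (M 2 (- 2) + M (- 2) (- 2))"
    using pos by (intro add_mono mult_left_mono b) auto
  also have "\<dots> = \<alpha> * s * ((x - y) * Z) + \<beta> * (2 * x * y - (x + y) * Z - 2 * (Z * (Z - 1)))
     + \<delta> * (2 * (x + y) * Z + 2 * x * y + 4 * (Z * (Z - 1))) + e * (2 * x * y + 2 * (x + y) * Z + Z * (Z - 1))"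
    by (simp add: M_def field_simps power2_eq_square)
  also have "\<dots> \<le> \<alpha> * s * ((x - y) * Z) + \<beta> * (2 * x * y - (x + y) * Z - 2 * (Z * (Z - 1)))
     + \<delta> * (2 * (x + y) * Z + 2 * x * y + 4 * (Z * (Z - 1))) + e * (?N * (?N - 1))"
  proof -
    obtain a b where ab: "x = real a" "y = real b"
      using lead_mixed_number_of[OF \<sigma>] by (auto simp: x_def y_def Z_def number_of_def)
    have "real k \<le> real k * real k" for k :: nat by (cases k) (simp_all add: algebra_simps)
    then have "x \<le> x * x" "y \<le> y * y" unfolding ab by blast+
    moreover have "?N = x + y + Z" by (simp add: x_def y_def field_simps)
    ultimately have "2 * x * y + 2 * (x + y) * Z + Z * (Z - 1) \<le> ?N * (?N - 1)"
      by (simp add: algebra_simps)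
    then show ?thesis using e by (intro add_left_mono mult_left_mono)
  qed
  also have "\<alpha> * s * ((x - y) * Z) + \<beta> * (2 * x * y - (x + y) * Z - 2 * (Z * (Z - 1)))
     + \<delta> * (2 * (x + y) * Z + 2 * x * y + 4 * (Z * (Z - 1))) =
     \<alpha> * (D * Z) + \<beta> * (?N\<^sup>2 / 2 - 2 * ?N * Z - Z\<^sup>2 / 2 - D\<^sup>2 / 2 + 2 * Z)
       + \<delta> * (?N\<^sup>2 / 2 + ?N * Z + 5 / 2 * Z\<^sup>2 - D\<^sup>2 / 2 - 4 * Z)"
  proof -
    have N: "?N = x + y + Z" by (simp add: x_def y_def field_simps)
    have D: "D = s * (x - y)" by (simp add: x_def y_def D_def field_simps)
    then have D2: "D\<^sup>2 = (x - y)\<^sup>2" using sq by (simp add: power_mult_distrib power2_eq_square)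
    have "2 * x * y - (x + y) * Z - 2 * (Z * (Z - 1)) = ?N\<^sup>2 / 2 - 2 * ?N * Z - Z\<^sup>2 / 2 - D\<^sup>2 / 2 + 2 * Z"
      unfolding D2 N by (simp add: power2_eq_square field_simps)
    moreover have "2 * (x + y) * Z + 2 * x * y + 4 * (Z * (Z - 1)) = ?N\<^sup>2 / 2 + ?N * Z + 5 / 2 * Z\<^sup>2 - D\<^sup>2 / 2 - 4 * Z"
      unfolding D2 N by (simp add: power2_eq_square field_simps)
    moreover have "\<alpha> * s * ((x - y) * Z) = \<alpha> * (D * Z)" by (simp add: D)
    ultimately show ?thesis by (simp only:)
  qed
  finally have "generator n (\<lambda>D. g (s * D)) ?D Z / (?N * (?N - 1)) \<le>
     (\<alpha> * (D * Z) + \<beta> * (?N\<^sup>2 / 2 - 2 * ?N * Z - Z\<^sup>2 / 2 - D\<^sup>2 / 2 + 2 * Z)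
       + \<delta> * (?N\<^sup>2 / 2 + ?N * Z + 5 / 2 * Z\<^sup>2 - D\<^sup>2 / 2 - 4 * Z) + e * (?N * (?N - 1))) / (?N * (?N - 1))"
    using n by (intro divide_right_mono) auto
  then show ?thesis
    using step_mean_lead_mixed[OF \<sigma> n, of "\<lambda>D. g (s * D)"] n
    by (simp add: D_def Z_def add_divide_distrib)
qed

lemma valid_perform:
  assumes "valid n \<sigma>" "a \<in> actions n"
  shows "valid n (perform a \<sigma>)"
proof -
  obtain v w u where a: "a = (v, w, u)" "v < n" "w < n" using assms(2) by (auto simp: actions_def)
  have V: "V \<in> {{WordA}, {WordB}, {WordA, WordB}}" if "V \<noteq> {}" for V
  proof -
    have "V \<subseteq> {WordA, WordB}" using UNIV_word by auto
    then show ?thesis using that by blast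
  qed
  have ne: "\<sigma> i \<noteq> {}" if "i < n" for i using assms(1) that by (auto simp: valid_def)
  have "speak v w u \<sigma> i \<noteq> {}" if "i < n" for i
    using ne[OF that] by (auto simp: speak_def Let_def)
  then show ?thesis using V unfolding valid_def a(1) perform_def by simp
qed

lemma step_mean_mono:
  assumes "valid n \<sigma>" "\<And>\<tau>. valid n \<tau> \<Longrightarrow> f \<tau> \<le> h \<tau>"
  shows "step_mean n f \<sigma> \<le> step_mean n h \<sigma>"
  unfolding step_mean_def using assms valid_perform by (intro divide_right_mono sum_mono) auto

lemma step_mean_const:
  assumes "valid n \<sigma>" "2 \<le> n" shows "step_mean n (\<lambda>_. c) \<sigma> = c"
  using step_mean_lead_mixed[OF assms, of "\<lambda>_ _. c"] by (simp add: generator_def)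

lemma step_mean_add: "step_mean n (\<lambda>\<tau>. f \<tau> + h \<tau>) \<sigma> = step_mean n f \<sigma> + step_mean n h \<sigma>"
  by (simp add: step_mean_def sum.distrib add_divide_distrib)

lemma step_mean_cmult: "step_mean n (\<lambda>\<tau>. c * f \<tau>) \<sigma> = c * step_mean n f \<sigma>"
  by (simp add: step_mean_def sum_distrib_left[symmetric])

section \<open>Survival probabilities and supersolutions\<close>

definition survival :: "nat \<Rightarrow> nat \<Rightarrow> config \<Rightarrow> real" where
  "survival n k = (step_mean n ^^ k) (indicator {\<sigma>. \<not> consensus n \<sigma>})"

lemma survival_0: "survival n 0 \<sigma> = indicator {\<sigma>. \<not> consensus n \<sigma>} \<sigma>"
  by (simp add: survival_def)

lemma survival_Suc: "survival n (Suc k) = step_mean n (survival n k)"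
  by (simp add: survival_def)

lemma survival_le_1: "valid n \<sigma> \<Longrightarrow> 2 \<le> n \<Longrightarrow> survival n k \<sigma> \<le> 1"
proof (induction k arbitrary: \<sigma>)
  case (Suc k)
  then have "survival n (Suc k) \<sigma> \<le> step_mean n (\<lambda>_. 1) \<sigma>"
    unfolding survival_Suc by (intro step_mean_mono) auto
  then show ?case using Suc.prems by (simp add: step_mean_const)
qed (simp add: survival_0 indicator_def)

lemma survival_nonneg: "0 \<le> survival n k \<sigma>"
proof (induction k arbitrary: \<sigma>)
  case (Suc k)
  then show ?case by (auto simp: survival_Suc step_mean_def intro!: divide_nonneg_nonneg sum_nonneg)
qed (simp add: survival_0)

lemma survival_consensus: "consensus n \<sigma> \<Longrightarrow> survival n k \<sigma> = 0"
proof (induction k arbitrary: \<sigma>)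
  case (Suc k)
  have "survival n k (perform a \<sigma>) = 0" if "a \<in> actions n" for a
    using that Suc consensus_speak by (auto simp: actions_def perform_def)
  then show ?case by (simp add: survival_Suc step_mean_def)
qed (simp add: survival_0)

lemma survival_antimono:
  assumes "valid n \<sigma>" "2 \<le> n" "j \<le> k" shows "survival n k \<sigma> \<le> survival n j \<sigma>"
proof -
  have "survival n (Suc k) \<sigma> \<le> survival n k \<sigma>" if "valid n \<sigma>" for k \<sigma>
    using that
  proof (induction k arbitrary: \<sigma>)
    case 0
    then show ?case
      using survival_le_1[OF 0 assms(2), of 1] survival_consensus[of n \<sigma> 1]
      by (cases "consensus n \<sigma>") (auto simp: survival_0)
  next
    case (Suc k)
    then show ?case unfolding survival_Suc[of n "Suc k"] survival_Suc[of n k]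
      by (intro step_mean_mono) (auto simp: survival_Suc)
  qed
  then show ?thesis
    using assms(1,3) lift_Suc_antimono_le[of "\<lambda>k. survival n k \<sigma>" j k] by blast
qed

text \<open>
A comparison principle that replaces hitting times. On \<open>R\<close> the bound is propagated by one step;
outside \<open>R\<close>, either because the next stage has been reached or because the stage has failed, it
must hold for a separate reason.
\<close>

lemma survival_le_supersolution:
  assumes n: "2 \<le> n" and \<sigma>: "valid n \<sigma>"
    and outside: "\<And>j \<sigma>. valid n \<sigma> \<Longrightarrow> \<not> R \<sigma> \<Longrightarrow> survival n (j + k) \<sigma> \<le> w j \<sigma>"
    and init: "\<And>\<sigma>. valid n \<sigma> \<Longrightarrow> R \<sigma> \<Longrightarrow> survival n k \<sigma> \<le> w 0 \<sigma>"
    and step: "\<And>j \<sigma>. valid n \<sigma> \<Longrightarrow> R \<sigma> \<Longrightarrow> step_mean n (w j) \<sigma> \<le> w (Suc j) \<sigma>"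
  shows "survival n (j + k) \<sigma> \<le> w j \<sigma>"
  using \<sigma>
proof (induction j arbitrary: \<sigma>)
  case 0
  then show ?case using outside[OF 0, of 0] init[OF 0] by (cases "R \<sigma>") auto
next
  case (Suc j)
  show ?case
  proof (cases "R \<sigma>")
    case True
    have "survival n (Suc j + k) \<sigma> = step_mean n (survival n (j + k)) \<sigma>" by (simp add: survival_Suc)
    also have "\<dots> \<le> step_mean n (w j) \<sigma>" using Suc by (intro step_mean_mono) auto
    finally show ?thesis using step[OF Suc.prems True, of j] by simp
  qed (use outside[OF Suc.prems, of "Suc j"] in simp)
qed

text \<open>
From every configuration whose lead satisfies \<open>P\<close>, consensus is reached within \<open>\<tau> n ln n\<close> steps,
that is within time about \<open>\<tau> ln n\<close>, except with probability \<open>\<eta>\<close>.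
\<close>

definition fast_consensus :: "real \<Rightarrow> real \<Rightarrow> (nat \<Rightarrow> real \<Rightarrow> bool) \<Rightarrow> bool" where
  "fast_consensus \<eta> \<tau> P \<longleftrightarrow> (\<forall>\<^sub>F n in sequentially. \<forall>\<sigma> k. valid n \<sigma> \<longrightarrow> P n \<bar>lead n \<sigma>\<bar> \<longrightarrow>
      \<tau> * (real n * ln (real n)) \<le> real k \<longrightarrow> survival n k \<sigma> \<le> \<eta>)"

lemma filterlim_n_ln_n: "filterlim (\<lambda>n. real n * ln (real n)) at_top sequentially"
  by real_asymp

lemma one_minus_power_le_exp:
  fixes x :: real
  assumes "x \<le> 1" shows "(1 - x) ^ k \<le> exp (- (x * real k))"
proof -
  have "(1 - x) ^ k \<le> exp (- x) ^ k"
    using assms exp_ge_add_one_self[of "- x"] by (intro power_mono) auto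
  then show ?thesis by (simp add: exp_of_nat_mult[symmetric] mult.commute)
qed

text \<open>
Times of consecutive stages add up. The strict inequality for \<open>\<tau>\<close> absorbs the rounding of the
numbers of steps.
\<close>

lemma fast_consensus_compose:
  assumes last: "fast_consensus \<eta>1 t' P2"
    and first: "\<forall>\<^sub>F n in sequentially. \<forall>k. (\<forall>\<sigma>. valid n \<sigma> \<longrightarrow> P2 n \<bar>lead n \<sigma>\<bar> \<longrightarrow> survival n k \<sigma> \<le> \<eta>1) \<longrightarrow>
      (\<forall>\<sigma> j. valid n \<sigma> \<longrightarrow> P1 n \<bar>lead n \<sigma>\<bar> \<longrightarrow> t * (real n * ln (real n)) \<le> real j \<longrightarrow>
         real j \<le> t * (real n * ln (real n)) + 1 \<longrightarrow> survival n (j + k) \<sigma> \<le> \<eta>1 + err n)"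
    and err: "err \<longlonglongrightarrow> 0" and \<eta>: "\<eta>1 < \<eta>" and \<tau>: "0 \<le> t" "0 \<le> t'" "t + t' < \<tau>"
  shows "fast_consensus \<eta> \<tau> P1"
proof -
  have e1: "\<forall>\<^sub>F n in sequentially. err n < \<eta> - \<eta>1"
    using order_tendstoD(2)[OF err] \<eta> by simp
  have e2: "\<forall>\<^sub>F n in sequentially. 2 / (\<tau> - (t + t')) \<le> real n * ln (real n)"
    using filterlim_n_ln_n by (simp add: filterlim_at_top)
  show ?thesis
    unfolding fast_consensus_def
    using last[unfolded fast_consensus_def] first e1 e2 eventually_ge_at_top[of 2]
  proof eventually_elim
    case (elim n)
    let ?l = "real n * ln (real n)"
    define j k' where "j = nat \<lceil>t * ?l\<rceil>" and "k' = nat \<lceil>t' * ?l\<rceil>"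
    have l: "0 \<le> ?l" using elim(5) by simp
    then have l1: "0 \<le> t * ?l" and l2: "0 \<le> t' * ?l" using \<tau> by (simp_all add: mult_nonneg_nonneg)
    have j: "t * ?l \<le> real j" "real j \<le> t * ?l + 1"
      using l1 by (simp_all add: j_def)
    have k': "t' * ?l \<le> real k'" "real k' \<le> t' * ?l + 1"
      using l2 by (simp_all add: k'_def)
    have end_bound: "\<forall>\<sigma>. valid n \<sigma> \<longrightarrow> P2 n \<bar>lead n \<sigma>\<bar> \<longrightarrow> survival n k' \<sigma> \<le> \<eta>1"
      using elim(1) k'(1) by blast
    show ?case
    proof (intro allI impI)
      fix \<sigma> k assume \<sigma>: "valid n \<sigma>" "P1 n \<bar>lead n \<sigma>\<bar>" and k: "\<tau> * ?l \<le> real k"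
      have "2 \<le> (\<tau> - (t + t')) * ?l" using elim(4) \<tau>(3) by (simp add: divide_le_eq mult.commute)
      then have "real (j + k') \<le> real k" using j k' k by (simp add: algebra_simps)
      then have "survival n k \<sigma> \<le> survival n (j + k') \<sigma>"
        using \<sigma>(1) elim(5) by (intro survival_antimono) auto
      also have "\<dots> \<le> \<eta>1 + err n" using elim(2) end_bound \<sigma> j by blast
      finally show "survival n k \<sigma> \<le> \<eta>" using elim(3) by simp
    qed
  qed
qed

lemma sign_of_lead:
  obtains s :: real where "s \<in> {1, -1}" "s * x = \<bar>x\<bar>"
  by (cases "0 \<le> x") (force simp: abs_if)+

section \<open>Near unanimity\<close>

text \<open>
For \<open>D\<close> close to \<open>N\<close> this is \<open>L Y + Z\<close>. Linearised at \<open>X = N\<close>, the equations are \<open>y' = - y\<close> and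
\<open>z' = 2 y - z\<close>; a large weight \<open>L\<close> on \<open>Y\<close> makes the decay rate of the sum close to \<open>1\<close>.
\<close>

definition minority_weight :: "real \<Rightarrow> real \<Rightarrow> real \<Rightarrow> real \<Rightarrow> real" where
  "minority_weight L N D Z = L * ((N - Z - D) / 2) + Z"

lemma minority_weight_increment:
  "minority_weight L N (D + a) (Z + b) - minority_weight L N D Z = (- L / 2) * a + (1 - L / 2) * b"
  by (simp add: minority_weight_def algebra_simps add_divide_distrib diff_divide_distrib)

lemma step_mean_minority_weight:
  fixes s \<epsilon> :: real
  assumes \<sigma>: "valid n \<sigma>" and n: "2 \<le> n" and s: "s \<in> {1, -1}" and \<epsilon>: "0 < \<epsilon>" "\<epsilon> \<le> 1"
  defines "W \<equiv> \<lambda>\<tau>. minority_weight (4 / \<epsilon>) n (s * lead n \<tau>) (mixed n \<tau>)"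
  assumes small: "W \<sigma> \<le> \<epsilon>\<^sup>2 / 8 * real n"
  shows "step_mean n W \<sigma> \<le> (1 - (1 - \<epsilon>) / real n) * W \<sigma>"
proof -
  define N D Z where "N = real n" and "D = s * lead n \<sigma>" and "Z = mixed n \<sigma>"
  define L where "L = 4 / \<epsilon>"
  define x y where "x = (N - Z + D) / 2" and "y = (N - Z - D) / 2"
  define c where "c = \<epsilon>\<^sup>2 / 8"
  have L: "4 \<le> L" "L * \<epsilon> = 4" using \<epsilon> by (simp_all add: L_def field_simps)
  have N: "2 \<le> N" using n by (simp add: N_def)
  have Wd: "W \<sigma> = L * y + Z" by (simp add: W_def minority_weight_def L_def N_def D_def Z_def y_def)
  have "\<bar>D\<bar> = \<bar>lead n \<sigma>\<bar>" using s by (auto simp: D_def)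
  then have "\<bar>D\<bar> \<le> N - Z" using state_bounds[OF \<sigma>] by (simp add: N_def Z_def)
  then have pos: "0 \<le> x" "0 \<le> y" "0 \<le> Z" "0 \<le> Z * (Z - 1)"
    using state_bounds[OF \<sigma>] by (auto simp: x_def y_def N_def Z_def)
  have c: "c \<le> \<epsilon> / 6" "c * (2 + L) \<le> \<epsilon>" "0 < c"
  proof -
    have "\<epsilon>\<^sup>2 \<le> \<epsilon>" using \<epsilon> by (simp add: power2_eq_square mult_left_le)
    then show "c \<le> \<epsilon> / 6" using \<epsilon> by (simp add: c_def)
    have "c * L = \<epsilon> / 2" using \<epsilon> by (simp add: c_def L_def power2_eq_square)
    moreover have "c * 2 = \<epsilon>\<^sup>2 / 4" by (simp add: c_def)
    ultimately show "c * (2 + L) \<le> \<epsilon>"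
      using \<open>\<epsilon>\<^sup>2 \<le> \<epsilon>\<close> \<epsilon>(1) unfolding distrib_left by linarith
    show "0 < c" using \<epsilon> by (simp add: c_def)
  qed
  have small': "L * y + Z \<le> c * N" using small by (simp add: Wd c_def N_def)
  have "1 * y \<le> L * y" using L pos by (intro mult_right_mono) auto
  then have Z: "Z \<le> c * N" and y: "y \<le> c * N" using small' pos by auto
  have "N = x + y + Z" by (simp add: x_def y_def field_simps)
  then have x: "(1 - 2 * c) * N \<le> x" using Z y by (simp add: algebra_simps)
  have "step_mean n W \<sigma> \<le> minority_weight L N D Z + ((- L / 2) * (D * Z) + (1 - L / 2) * (N\<^sup>2 / 2 - 2 * N * Z - Z\<^sup>2 / 2 - D\<^sup>2 / 2 + 2 * Z)
       + 0 * (N\<^sup>2 / 2 + N * Z + 5 / 2 * Z\<^sup>2 - D\<^sup>2 / 2 - 4 * Z)) / (N * (N - 1)) + 0"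
    unfolding W_def N_def D_def Z_def L_def
    by (rule step_mean_le_linear[OF \<sigma> n s]) (simp_all add: minority_weight_increment)
  also have "\<dots> = W \<sigma> + ((- L / 2) * (D * Z) + (1 - L / 2) * (N\<^sup>2 / 2 - 2 * N * Z - Z\<^sup>2 / 2 - D\<^sup>2 / 2 + 2 * Z)) / (N * (N - 1))"
    by (simp add: Wd minority_weight_def y_def)
  also have "(- L / 2) * (D * Z) + (1 - L / 2) * (N\<^sup>2 / 2 - 2 * N * Z - Z\<^sup>2 / 2 - D\<^sup>2 / 2 + 2 * Z) =
     L * y * Z - (L - 2) * x * y - (x + y) * Z + (L - 2) * (Z * (Z - 1))"
    by (simp add: x_def y_def power2_eq_square field_simps)
  also have "\<dots> \<le> - ((1 - \<epsilon>) * N * (L * y + Z))"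
  proof -
    have "(1 - \<epsilon>) * L * N \<le> (L - 2) * x - L * Z"
    proof -
      have "(L - 2) * ((1 - 2 * c) * N) \<le> (L - 2) * x" using x L by (intro mult_left_mono) auto
      moreover have "L * Z \<le> L * (c * N)" using Z L by (intro mult_left_mono) auto
      moreover have "(1 - \<epsilon>) * L * N \<le> (L - 2) * ((1 - 2 * c) * N) - L * (c * N)"
      proof -
        have "L * c \<le> L * (\<epsilon> / 6)" using c L by (intro mult_left_mono) auto
        then have "(1 - \<epsilon>) * L \<le> (L - 2) * (1 - 2 * c) - L * c"
          using L c by (simp add: algebra_simps)
        then have "(1 - \<epsilon>) * L * N \<le> ((L - 2) * (1 - 2 * c) - L * c) * N" using N by (intro mult_right_mono) auto
        then show ?thesis by (simp add: algebra_simps)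
      qed
      ultimately show ?thesis by linarith
    qed
    then have 1: "y * ((1 - \<epsilon>) * L * N) \<le> y * ((L - 2) * x - L * Z)" using pos by (intro mult_left_mono) auto
    have "(1 - \<epsilon>) * N \<le> x - (L - 2) * Z"
    proof -
      have "(L - 2) * Z \<le> (L - 2) * (c * N)" using Z L by (intro mult_left_mono) auto
      moreover have "(1 - \<epsilon>) * N \<le> (1 - 2 * c) * N - (L - 2) * (c * N)"
      proof -
        have "c * (2 + L) * N \<le> \<epsilon> * N" using c N by (intro mult_right_mono) auto
        moreover have "0 \<le> c * N" using c N by simp
        ultimately show ?thesis by (simp add: algebra_simps)
      qed
      ultimately show ?thesis using x by linarith
    qed
    then have 2: "Z * ((1 - \<epsilon>) * N) \<le> Z * (x - (L - 2) * Z)" using pos by (intro mult_left_mono) auto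
    have 3: "0 \<le> y * Z" "0 \<le> (L - 2) * Z" using pos L by auto
    show ?thesis using 1 2 3 by (simp add: algebra_simps)
  qed
  also have "- ((1 - \<epsilon>) * N * (L * y + Z)) / (N * (N - 1)) \<le> - ((1 - \<epsilon>) / N) * (L * y + Z)"
  proof -
    have "(1 - \<epsilon>) / N * (L * y + Z) \<le> (1 - \<epsilon>) / (N - 1) * (L * y + Z)"
      using N \<epsilon> pos L by (intro mult_right_mono divide_left_mono) auto
    moreover have "- ((1 - \<epsilon>) * N * w) / (N * (N - 1)) = - ((1 - \<epsilon>) / (N - 1) * w)" for w
      using N by simp
    ultimately show ?thesis by (simp only: mult_minus_left neg_le_iff_le)
  qed
  finally show ?thesis using N Wd by (simp add: divide_right_mono N_def algebra_simps)
qed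

text \<open>
The first term bounds the probability of ever leaving the region where the weight decays, the
second the probability that weight is left after \<open>k\<close> steps; without consensus the weight is at
least \<open>1\<close>.
\<close>

lemma survival_le_minority_weight:
  fixes s \<epsilon> :: real
  assumes \<sigma>: "valid n \<sigma>" and n: "2 \<le> n" and s: "s \<in> {1, -1}" and \<epsilon>: "0 < \<epsilon>" "\<epsilon> \<le> 1"
  defines "W \<equiv> \<lambda>\<tau>. minority_weight (4 / \<epsilon>) n (s * lead n \<tau>) (mixed n \<tau>)"
  shows "survival n k \<sigma> \<le> (1 / (\<epsilon>\<^sup>2 / 8 * real n) + (1 - (1 - \<epsilon>) / real n) ^ k) * W \<sigma>"
proof -
  let ?c = "\<epsilon>\<^sup>2 / 8 * real n" and ?\<rho> = "1 - (1 - \<epsilon>) / real n"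
  have c: "0 < ?c" using \<epsilon> n by simp
  have \<rho>: "0 \<le> ?\<rho>" "?\<rho> \<le> 1" using \<epsilon> n by (auto simp: field_simps)
  have L: "2 \<le> 4 / \<epsilon>" using \<epsilon> by (simp add: field_simps)
  have W: "real n - s * lead n \<tau> \<le> W \<tau>" "0 \<le> W \<tau>" if "valid n \<tau>" for \<tau>
  proof -
    have "\<bar>s * lead n \<tau>\<bar> = \<bar>lead n \<tau>\<bar>" using s by auto
    define q where "q = (real n - mixed n \<tau> - s * lead n \<tau>) / 2"
    have q: "0 \<le> q" "real n - s * lead n \<tau> = 2 * q + mixed n \<tau>" and Z: "0 \<le> mixed n \<tau>"
      using state_bounds[OF that] \<open>\<bar>s * lead n \<tau>\<bar> = _\<close> by (auto simp: q_def field_simps)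
    have "2 * q \<le> 4 / \<epsilon> * q" using L q by (intro mult_right_mono)
    moreover have "W \<tau> = 4 / \<epsilon> * q + mixed n \<tau>" by (simp add: W_def minority_weight_def q_def)
    ultimately show "real n - s * lead n \<tau> \<le> W \<tau>" "0 \<le> W \<tau>" using q Z by auto
  qed
  have "survival n (k + 0) \<sigma> \<le> (\<lambda>j \<tau>. (1 / ?c + ?\<rho> ^ j) * W \<tau>) k \<sigma>"
  proof (rule survival_le_supersolution[where R="\<lambda>\<tau>. W \<tau> \<le> ?c", OF n \<sigma>])
    fix j \<tau> assume \<tau>: "valid n \<tau>" "\<not> W \<tau> \<le> ?c"
    have "1 \<le> 1 / ?c * W \<tau>" using \<tau>(2) c by (simp add: field_simps)
    also have "\<dots> \<le> (1 / ?c + ?\<rho> ^ j) * W \<tau>" using W(2)[OF \<tau>(1)] \<rho> by (intro mult_right_mono) auto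
    finally show "survival n (j + 0) \<tau> \<le> (1 / ?c + ?\<rho> ^ j) * W \<tau>"
      using survival_le_1[OF \<tau>(1) n, of "j + 0"] by linarith
  next
    fix \<tau> assume \<tau>: "valid n \<tau>"
    have "indicator {\<sigma>. \<not> consensus n \<sigma>} \<tau> \<le> W \<tau>"
    proof (cases "consensus n \<tau>")
      case False
      then have "\<bar>lead n \<tau>\<bar> \<le> real n - 1" using consensus_lead(2)[OF \<tau>] by simp
      then have "1 \<le> real n - s * lead n \<tau>" using s by (auto simp: abs_le_iff)
      then show ?thesis using W[OF \<tau>] False by simp
    qed (use W[OF \<tau>] in simp)
    also have "W \<tau> \<le> (1 / ?c + ?\<rho> ^ 0) * W \<tau>" using W(2)[OF \<tau>] c by (simp add: distrib_right)
    finally show "survival n 0 \<tau> \<le> (1 / ?c + ?\<rho> ^ 0) * W \<tau>" by (simp only: survival_0)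
  next
    fix j \<tau> assume \<tau>: "valid n \<tau>" "W \<tau> \<le> ?c"
    have "step_mean n (\<lambda>\<tau>. (1 / ?c + ?\<rho> ^ j) * W \<tau>) \<tau> = (1 / ?c + ?\<rho> ^ j) * step_mean n W \<tau>"
      by (rule step_mean_cmult)
    also have "\<dots> \<le> (1 / ?c + ?\<rho> ^ j) * (?\<rho> * W \<tau>)"
      using step_mean_minority_weight[OF \<tau>(1) n s \<epsilon>] \<tau>(2) c \<rho> unfolding W_def
      by (intro mult_left_mono) auto
    also have "\<dots> = (1 / ?c * ?\<rho> + ?\<rho> ^ Suc j) * W \<tau>" by (simp add: algebra_simps)
    also have "\<dots> \<le> (1 / ?c + ?\<rho> ^ Suc j) * W \<tau>"
    proof (intro mult_right_mono add_right_mono)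
      show "1 / ?c * ?\<rho> \<le> 1 / ?c" using \<rho> c by (intro mult_left_le) auto
    qed (rule W(2)[OF \<tau>(1)])
    finally show "step_mean n (\<lambda>\<tau>. (1 / ?c + ?\<rho> ^ j) * W \<tau>) \<tau> \<le> (1 / ?c + ?\<rho> ^ Suc j) * W \<tau>" .
  qed
  then show ?thesis by simp
qed

lemma fast_consensus_near_unanimity:
  assumes \<tau>: "1 < \<tau>" and \<eta>: "0 < \<eta>"
  obtains c where "0 < c" "c < 1" "fast_consensus \<eta> \<tau> (\<lambda>n d. (1 - c) * real n \<le> d)"
proof -
  define \<epsilon> where "\<epsilon> = (\<tau> - 1) / (2 * \<tau>)"
  have \<epsilon>: "0 < \<epsilon>" "\<epsilon> \<le> 1" using \<tau> by (auto simp: \<epsilon>_def field_simps)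
  have rate: "(1 - \<epsilon>) * \<tau> = 1 + (\<tau> - 1) / 2" using \<tau> by (simp add: \<epsilon>_def field_simps)
  define L where "L = 4 / \<epsilon>"
  have L: "4 \<le> L" using \<epsilon> by (simp add: L_def field_simps)
  \<comment> \<open>The initial weight \<open>c L n\<close> has to be small against the exit level \<open>\<epsilon>\<^sup>2 / 8 * n\<close>.\<close>
  define c where "c = min (1 / 2) (\<eta> / 2 * (\<epsilon>\<^sup>2 / 8) / L)"
  have c: "0 < c" "c < 1" using \<epsilon> \<eta> L by (auto simp: c_def)
  have cL: "c * L / (\<epsilon>\<^sup>2 / 8) \<le> \<eta> / 2"
  proof -
    have "c \<le> \<eta> / 2 * (\<epsilon>\<^sup>2 / 8) / L" by (simp add: c_def)
    then show ?thesis using L \<epsilon> by (simp add: field_simps)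
  qed
  have lim: "(\<lambda>n. c * L * real n powr (- ((\<tau> - 1) / 2))) \<longlonglongrightarrow> 0"
    using \<tau> by (intro tendsto_mult_right_zero tendsto_neg_powr filterlim_real_sequentially) auto
  have "\<forall>\<^sub>F n in sequentially. c * L * real n powr (- ((\<tau> - 1) / 2)) < \<eta> / 2"
    using order_tendstoD(2)[OF lim, of "\<eta> / 2"] \<eta> by simp
  then have "fast_consensus \<eta> \<tau> (\<lambda>n d. (1 - c) * real n \<le> d)"
    unfolding fast_consensus_def using eventually_ge_at_top[of 2]
  proof eventually_elim
    case (elim n)
    show ?case
    proof (intro allI impI)
      fix \<sigma> k assume \<sigma>: "valid n \<sigma>" and d: "(1 - c) * real n \<le> \<bar>lead n \<sigma>\<bar>"
        and k: "\<tau> * (real n * ln (real n)) \<le> real k"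
      obtain s where s: "s \<in> {1, -1}" "s * lead n \<sigma> = \<bar>lead n \<sigma>\<bar>" by (rule sign_of_lead)
      let ?W = "minority_weight (4 / \<epsilon>) n (s * lead n \<sigma>) (mixed n \<sigma>)"
      have n: "2 \<le> n" by fact
      have "(real n - mixed n \<sigma> - \<bar>lead n \<sigma>\<bar>) / 2 + mixed n \<sigma> \<le> c * real n"
      proof -
        have "real n - \<bar>lead n \<sigma>\<bar> \<le> c * real n" using d by (simp add: algebra_simps)
        then show ?thesis using state_bounds(2)[OF \<sigma>] by (simp add: field_simps)
      qed
      then have "L * ((real n - mixed n \<sigma> - \<bar>lead n \<sigma>\<bar>) / 2 + mixed n \<sigma>) \<le> L * (c * real n)"
        using L by (intro mult_left_mono) auto
      moreover have "1 * mixed n \<sigma> \<le> L * mixed n \<sigma>" using L state_bounds(1)[OF \<sigma>] by (intro mult_right_mono) auto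
      ultimately have W: "?W \<le> c * L * real n"
        unfolding minority_weight_def s(2) L_def[symmetric] by (simp add: algebra_simps)
      let ?\<rho> = "1 - (1 - \<epsilon>) / real n"
      have \<rho>: "0 \<le> ?\<rho>" using \<epsilon> n by (auto simp: field_simps)
      have x1: "(1 - \<epsilon>) / real n \<le> 1" using \<epsilon> n by (auto simp: field_simps)
      have "?\<rho> ^ k \<le> exp (- ((1 - \<epsilon>) / real n * real k))" by (rule one_minus_power_le_exp[OF x1])
      also have "\<dots> \<le> exp (- ((1 + (\<tau> - 1) / 2) * ln (real n)))"
      proof -
        have "(1 - \<epsilon>) / real n * (\<tau> * (real n * ln (real n))) \<le> (1 - \<epsilon>) / real n * real k"
          using k \<epsilon> by (intro mult_left_mono) auto
        moreover have "(1 - \<epsilon>) / real n * (\<tau> * (real n * ln (real n))) = ((1 - \<epsilon>) * \<tau>) * ln (real n)"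
          using n by simp
        ultimately show ?thesis unfolding rate by simp
      qed
      also have "\<dots> = real n powr (- ((\<tau> - 1) / 2)) / real n"
      proof -
        have "exp (- ((1 + a) * ln (real n))) = exp (- a * ln (real n)) * exp (- ln (real n))" for a
          by (simp add: exp_add[symmetric] algebra_simps)
        then show ?thesis using n by (simp add: powr_def exp_minus inverse_eq_divide)
      qed
      finally have \<rho>k: "?\<rho> ^ k \<le> real n powr (- ((\<tau> - 1) / 2)) / real n" .
      have "survival n k \<sigma> \<le> (1 / (\<epsilon>\<^sup>2 / 8 * real n) + ?\<rho> ^ k) * ?W"
        by (rule survival_le_minority_weight[OF \<sigma> n s(1) \<epsilon>])
      also have "\<dots> \<le> (1 / (\<epsilon>\<^sup>2 / 8 * real n) + ?\<rho> ^ k) * (c * L * real n)"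
        using W \<rho> \<epsilon> n by (intro mult_left_mono add_nonneg_nonneg) auto
      also have "\<dots> \<le> (1 / (\<epsilon>\<^sup>2 / 8 * real n) + real n powr (- ((\<tau> - 1) / 2)) / real n) * (c * L * real n)"
        using \<rho>k c L by (intro mult_right_mono add_left_mono) auto
      also have "\<dots> = c * L / (\<epsilon>\<^sup>2 / 8) + c * L * real n powr (- ((\<tau> - 1) / 2))"
        using n \<epsilon> by (simp add: field_simps)
      also have "\<dots> \<le> \<eta>" using cL elim(1) by linarith
      finally show "survival n k \<sigma> \<le> \<eta>" .
    qed
  qed
  then show thesis using c that by blast
qed

section \<open>Macroscopic lead\<close>

lemma exp_neg_ln_tendsto_0:
  assumes "0 < a" shows "(\<lambda>n. exp (- (a * ln (real n)))) \<longlonglongrightarrow> 0"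
proof -
  have "filterlim (\<lambda>n. a * ln (real n)) at_top sequentially"
    using assms by (intro filterlim_tendsto_pos_mult_at_top[OF tendsto_const] filterlim_compose[OF ln_at_top filterlim_real_sequentially])
  then show ?thesis
    by (intro filterlim_compose[OF exp_at_bot]) (simp add: filterlim_uminus_at_bot)
qed

text \<open>
In the limit \<open>K d + z\<close> with \<open>K = 6 / c\<close> has derivative
\<open>K z d + (1 - 4 z - z\<^sup>2 - d\<^sup>2) / 2\<close>, and \<open>K d \<ge> 3\<close> makes the terms in \<open>z\<close> nonnegative together. What is
left is at least \<open>(1 - d\<^sup>2) / 2\<close>, bounded away from \<open>0\<close> until near unanimity. The potential
is bounded, so a linear decrease is also a geometric one.
\<close>

lemma step_mean_bulk_potential:
  fixes s c c2 :: real
  assumes \<sigma>: "valid n \<sigma>" and n: "2 \<le> n" and s: "s \<in> {1, -1}" and c: "0 < c" and c2: "0 < c2" "c2 < 1"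
    and lo: "c / 2 * real n \<le> s * lead n \<sigma>" and hi: "s * lead n \<sigma> \<le> (1 - c2) * real n"
  defines "f \<equiv> \<lambda>\<tau>. 6 / c + 2 - (6 / c * (s * lead n \<tau>) + mixed n \<tau>) / real n"
  shows "step_mean n f \<sigma> \<le> (1 - c2 / (2 * (6 / c + 2) * real n)) * f \<sigma>"
proof -
  define N D Z K where "N = real n" and "D = s * lead n \<sigma>" and "Z = mixed n \<sigma>" and "K = 6 / c"
  have N: "2 \<le> N" using n by (simp add: N_def)
  have K: "0 < K" using c by (simp add: K_def)
  have st: "0 \<le> Z" "Z \<le> N" "0 \<le> D" "D \<le> (1 - c2) * N"
    using state_bounds[OF \<sigma>] lo hi c N order_trans[of 0 "c / 2 * real n" D] by (auto simp: N_def D_def Z_def)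
  have KD: "3 * N \<le> K * D"
  proof -
    have "K * (c / 2 * N) \<le> K * D" using lo K by (intro mult_left_mono) (auto simp: N_def D_def)
    then show ?thesis using c by (simp add: K_def)
  qed
  have "step_mean n f \<sigma> \<le> (K + 2 - (K * D + Z) / N) + ((- K / N) * (D * Z) + (- 1 / N) * (N\<^sup>2 / 2 - 2 * N * Z - Z\<^sup>2 / 2 - D\<^sup>2 / 2 + 2 * Z)
       + 0 * (N\<^sup>2 / 2 + N * Z + 5 / 2 * Z\<^sup>2 - D\<^sup>2 / 2 - 4 * Z)) / (N * (N - 1)) + 0"
    unfolding f_def N_def D_def Z_def K_def
    by (rule step_mean_le_linear[OF \<sigma> n s, where g="\<lambda>D Z. 6 / c + 2 - (6 / c * D + Z) / real n"])
       (use n c in \<open>simp_all add: field_simps\<close>)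
  also have "\<dots> = f \<sigma> + (- (K * D * Z + (N\<^sup>2 / 2 - 2 * N * Z - Z\<^sup>2 / 2 - D\<^sup>2 / 2 + 2 * Z)) / N) / (N * (N - 1))"
    by (simp add: f_def K_def N_def D_def Z_def diff_divide_distrib add_divide_distrib)
  also have "\<dots> \<le> f \<sigma> + (- (c2 * N\<^sup>2 / 2) / N) / (N * (N - 1))"
  proof -
    have "3 * N * Z \<le> K * D * Z" using KD st by (intro mult_right_mono)
    moreover have "Z\<^sup>2 \<le> N * Z" using st by (simp add: power2_eq_square mult_right_mono)
    moreover have "D\<^sup>2 \<le> (1 - c2) * N\<^sup>2"
    proof -
      have "D * D \<le> (1 - c2) * N * N" using st c2 N by (intro mult_mono) (auto simp: mult_le_cancel_right1 intro: order_trans)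
      then show ?thesis by (simp add: power2_eq_square mult.assoc)
    qed
    then have "D\<^sup>2 \<le> N\<^sup>2 - c2 * N\<^sup>2" by (simp add: left_diff_distrib)
    moreover have "0 \<le> N * Z" using st N by simp
    ultimately have "c2 * N\<^sup>2 / 2 \<le> K * D * Z + (N\<^sup>2 / 2 - 2 * N * Z - Z\<^sup>2 / 2 - D\<^sup>2 / 2 + 2 * Z)"
      using st by linarith
    then show ?thesis using N by (intro add_left_mono divide_right_mono) auto
  qed
  also have "\<dots> \<le> f \<sigma> - c2 / (2 * N)"
  proof -
    have "c2 / (2 * N) \<le> c2 / (2 * (N - 1))" using N c2 by (intro divide_left_mono) auto
    then show ?thesis using N by (simp add: power2_eq_square)
  qed
  also have "\<dots> \<le> f \<sigma> - c2 / (2 * (K + 2) * N) * f \<sigma>"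
  proof -
    have "f \<sigma> \<le> K + 2"
      using st K N by (simp add: f_def D_def[symmetric] Z_def[symmetric] N_def[symmetric] K_def[symmetric])
    then have "c2 / (2 * (K + 2) * N) * f \<sigma> \<le> c2 / (2 * (K + 2) * N) * (K + 2)"
      using c2 K N by (intro mult_left_mono) auto
    also have "\<dots> = c2 / (2 * N)"
    proof -
      have "c2 / (2 * q * N) * q = c2 / (2 * N)" if "q \<noteq> 0" for q using that by simp
      note * = this
      show ?thesis by (rule *) (use K in simp)
    qed
    finally show ?thesis by simp
  qed
  finally show ?thesis by (simp add: K_def N_def algebra_simps)
qed

text \<open>
The drift of the lead is outward, so only its variance, at most \<open>4\<close> per step, can push it
below the level \<open>c\<close>.
\<close>

lemma step_mean_shortfall:
  fixes s c :: real
  assumes \<sigma>: "valid n \<sigma>" and n: "2 \<le> n" and s: "s \<in> {1, -1}" and lo: "0 \<le> s * lead n \<sigma>"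
  shows "step_mean n (\<lambda>\<tau>. (max (c - s * lead n \<tau>) 0)\<^sup>2) \<sigma> \<le> (max (c - s * lead n \<sigma>) 0)\<^sup>2 + 4"
proof -
  let ?p = "max (c - s * lead n \<sigma>) 0" and ?D = "s * lead n \<sigma>" and ?Z = "mixed n \<sigma>"
  have "step_mean n (\<lambda>\<tau>. (\<lambda>D Z. (max (c - D) 0)\<^sup>2) (s * lead n \<tau>) (mixed n \<tau>)) \<sigma> \<le> ?p\<^sup>2
    + ((- 2 * ?p) * (?D * ?Z) + 0 * ((real n)\<^sup>2 / 2 - 2 * real n * ?Z - ?Z\<^sup>2 / 2 - ?D\<^sup>2 / 2 + 2 * ?Z)
     + 0 * ((real n)\<^sup>2 / 2 + real n * ?Z + 5 / 2 * ?Z\<^sup>2 - ?D\<^sup>2 / 2 - 4 * ?Z)) / (real n * (real n - 1)) + 4"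
  proof (rule step_mean_le_linear[OF \<sigma> n s])
    fix a b :: real assume a: "\<bar>a\<bar> \<le> 2"
    have sq: "a\<^sup>2 \<le> 4" using a abs_le_square_iff[of a 2] by simp
    have "(max (x - a) 0)\<^sup>2 \<le> (max x 0)\<^sup>2 - 2 * max x 0 * a + a\<^sup>2" for x :: real
    proof (cases "0 \<le> x")
      case True
      have "(max (x - a) 0)\<^sup>2 \<le> (x - a)\<^sup>2" by (auto simp: max_def)
      then show ?thesis using True by (simp add: power2_eq_square algebra_simps)
    next
      case False
      then have "max (x - a) 0 \<le> \<bar>a\<bar>" by auto
      then have "(max (x - a) 0)\<^sup>2 \<le> \<bar>a\<bar>\<^sup>2" by (rule power_mono) simp
      then show ?thesis using False by simp
    qed
    from this[of "c - ?D"] sq show "(max (c - (?D + a)) 0)\<^sup>2 - ?p\<^sup>2 \<le> - 2 * ?p * a + 0 * b + 0 * a\<^sup>2 + 4"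
      by (simp add: algebra_simps)
  qed simp
  moreover have "0 \<le> ?p * (?D * ?Z)" using lo state_bounds(1)[OF \<sigma>] by simp
  then have "(- 2 * ?p) * (?D * ?Z) \<le> 0" by (simp only: mult.assoc mult_minus_left neg_le_0_iff_le)
  then have "((- 2 * ?p) * (?D * ?Z)) / (real n * (real n - 1)) \<le> 0"
    using n by (intro divide_nonpos_nonneg) simp_all
  ultimately show ?thesis by simp
qed

text \<open>
The second term bounds the probability that the lead has halved after \<open>j\<close> steps, the third the
probability that it is still between \<open>c n / 2\<close> and \<open>(1 - c2) n\<close>.
\<close>

lemma survival_bulk:
  fixes c c2 \<eta> :: real
  assumes \<sigma>: "valid n \<sigma>" and n: "2 \<le> n" and c: "0 < c" and c2: "0 < c2" "c2 < 1"
    and last: "\<And>\<tau>. valid n \<tau> \<Longrightarrow> (1 - c2) * real n \<le> \<bar>lead n \<tau>\<bar> \<Longrightarrow> survival n k \<tau> \<le> \<eta>" and \<eta>: "0 \<le> \<eta>"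
    and start: "c * real n \<le> \<bar>lead n \<sigma>\<bar>"
  shows "survival n (j + k) \<sigma> \<le> \<eta> + 16 * real j / (c * real n)\<^sup>2
      + (1 - c2 / (2 * (6 / c + 2) * real n)) ^ j * (6 / c + 2)"
proof -
  obtain s where s: "s \<in> {1, -1}" "s * lead n \<sigma> = \<bar>lead n \<sigma>\<bar>" by (rule sign_of_lead)
  have s_abs: "\<bar>s * x\<bar> = \<bar>x\<bar>" for x using s(1) by auto
  define p where "p \<tau> = (max (c * real n - s * lead n \<tau>) 0)\<^sup>2" for \<tau>
  define f where "f \<tau> = 6 / c + 2 - (6 / c * (s * lead n \<tau>) + mixed n \<tau>) / real n" for \<tau>
  define \<rho> where "\<rho> = 1 - c2 / (2 * (6 / c + 2) * real n)"
  define A where "A = 4 / (c * real n)\<^sup>2"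
  have A: "0 < A" using c n by (simp add: A_def)
  have \<rho>: "0 \<le> \<rho>"
  proof -
    have "2 * 1 * 1 \<le> 2 * (6 / c + 2) * real n" using c n by (intro mult_mono) auto
    then have "c2 \<le> 2 * (6 / c + 2) * real n" using c2 by linarith
    moreover have "0 < 2 * (6 / c + 2) * real n" using c n by (intro mult_pos_pos add_pos_pos) auto
    ultimately show ?thesis unfolding \<rho>_def by (simp only: diff_ge_0_iff_ge divide_le_eq_1_pos)
  qed
  have f1: "1 \<le> f \<tau>" if "valid n \<tau>" for \<tau>
  proof -
    have D: "s * lead n \<tau> \<le> real n" using state_bounds(5)[OF that] s_abs[of "lead n \<tau>"] by linarith
    have "(6 / c * (s * lead n \<tau>) + mixed n \<tau>) / real n \<le> (6 / c * real n + real n) / real n"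
      using D c n state_bounds(4)[OF that] by (intro divide_right_mono add_mono mult_left_mono) auto
    also have "\<dots> = 6 / c + 1" using n by (simp add: add_divide_distrib)
    finally show ?thesis by (simp add: f_def)
  qed
  have p0: "0 \<le> p \<tau>" for \<tau> by (simp add: p_def)
  let ?w = "\<lambda>j \<tau>. \<eta> + A * (p \<tau> + 4 * real j) + \<rho> ^ j * f \<tau>"
  have "survival n (j + k) \<sigma> \<le> ?w j \<sigma>"
  proof (rule survival_le_supersolution[where R="\<lambda>\<tau>. c / 2 * real n < s * lead n \<tau> \<and> s * lead n \<tau> < (1 - c2) * real n", OF n \<sigma>])
    fix j \<tau> assume \<tau>: "valid n \<tau>" and R: "\<not> (c / 2 * real n < s * lead n \<tau> \<and> s * lead n \<tau> < (1 - c2) * real n)"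
    have f0: "0 \<le> \<rho> ^ j * f \<tau>" using \<rho> f1[OF \<tau>] by simp
    have pj: "0 \<le> A * (p \<tau> + 4 * real j)" using A p0[of \<tau>] by simp
    show "survival n (j + k) \<tau> \<le> ?w j \<tau>"
    proof (cases "(1 - c2) * real n \<le> s * lead n \<tau>")
      case True
      then have "(1 - c2) * real n \<le> \<bar>lead n \<tau>\<bar>" using s_abs[of "lead n \<tau>"] by linarith
      then have "survival n (j + k) \<tau> \<le> \<eta>"
        using last[OF \<tau>] survival_antimono[OF \<tau> n, of k "j + k"] by fastforce
      then show ?thesis using f0 pj by linarith
    next
      case False
      then have "c / 2 * real n \<le> c * real n - s * lead n \<tau>" using R by linarith
      then have "c / 2 * real n \<le> max (c * real n - s * lead n \<tau>) 0" by (rule max.coboundedI1)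
      then have "(c / 2 * real n)\<^sup>2 \<le> p \<tau>"
        unfolding p_def by (rule power_mono) (use c in simp)
      then have "A * (c / 2 * real n)\<^sup>2 \<le> A * (p \<tau> + 4 * real j)" using A by (intro mult_left_mono) auto
      moreover have "A * (c / 2 * real n)\<^sup>2 = 1" using c n by (simp add: A_def power_mult_distrib power_divide)
      ultimately have "1 \<le> ?w j \<tau>" using f0 \<eta> by linarith
      then show ?thesis using survival_le_1[OF \<tau> n, of "j + k"] by linarith
    qed
  next
    fix \<tau> assume \<tau>: "valid n \<tau>"
    have "0 \<le> A * p \<tau>" using A p0[of \<tau>] by simp
    then show "survival n k \<tau> \<le> ?w 0 \<tau>"
      using survival_le_1[OF \<tau> n, of k] f1[OF \<tau>] \<eta> by simp
  next
    fix j \<tau> assume \<tau>: "valid n \<tau>" and R: "c / 2 * real n < s * lead n \<tau> \<and> s * lead n \<tau> < (1 - c2) * real n"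
    have lo: "0 \<le> s * lead n \<tau>" using R c n order_trans[of 0 "c / 2 * real n"] by auto
    have "step_mean n (?w j) \<tau> = step_mean n (\<lambda>_. \<eta> + A * (4 * real j)) \<tau> + A * step_mean n p \<tau> + \<rho> ^ j * step_mean n f \<tau>"
      unfolding step_mean_cmult[symmetric] step_mean_add[symmetric] by (simp add: algebra_simps)
    also have "\<dots> \<le> (\<eta> + A * (4 * real j)) + A * (p \<tau> + 4) + \<rho> ^ j * (\<rho> * f \<tau>)"
    proof (intro add_mono mult_left_mono)
      show "step_mean n (\<lambda>_. \<eta> + A * (4 * real j)) \<tau> \<le> \<eta> + A * (4 * real j)"
        by (simp add: step_mean_const[OF \<tau> n])
      show "step_mean n p \<tau> \<le> p \<tau> + 4"
        unfolding p_def by (rule step_mean_shortfall[OF \<tau> n s(1) lo])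
      show "step_mean n f \<tau> \<le> \<rho> * f \<tau>"
        unfolding f_def \<rho>_def using R by (intro step_mean_bulk_potential[OF \<tau> n s(1) c c2]) auto
    qed (use A \<rho> in auto)
    also have "\<dots> = ?w (Suc j) \<tau>" by (simp add: algebra_simps)
    finally show "step_mean n (?w j) \<tau> \<le> ?w (Suc j) \<tau>" .
  qed
  also have "?w j \<sigma> \<le> \<eta> + 16 * real j / (c * real n)\<^sup>2 + \<rho> ^ j * (6 / c + 2)"
  proof -
    have "p \<sigma> = 0" using start s(2) by (simp add: p_def)
    moreover have "f \<sigma> \<le> 6 / c + 2" using s(2) c n state_bounds(1)[OF \<sigma>] by (simp add: f_def)
    ultimately show ?thesis using \<rho> by (intro add_mono mult_left_mono) (auto simp: A_def)
  qed
  finally show ?thesis by (simp add: \<rho>_def)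
qed

lemma fast_consensus_macroscopic_lead:
  assumes \<tau>: "1 < \<tau>" and \<eta>: "0 < \<eta>" and c: "0 < c"
  shows "fast_consensus \<eta> \<tau> (\<lambda>n d. c * real n \<le> d)"
proof -
  define \<delta> where "\<delta> = (\<tau> - 1) / 3"
  have \<delta>: "0 < \<delta>" using \<tau> by (simp add: \<delta>_def)
  obtain c2 where c2: "0 < c2" "c2 < 1" and last: "fast_consensus (\<eta> / 2) (1 + \<delta>) (\<lambda>n d. (1 - c2) * real n \<le> d)"
    using fast_consensus_near_unanimity[of "1 + \<delta>" "\<eta> / 2"] \<delta> \<eta> by auto
  define r where "r = c2 / (2 * (6 / c + 2))"
  have r: "0 < r" "r \<le> 1"
  proof -
    have "0 < 6 / c" using c by simp
    have gen: "0 < 2 * (q + 2)" "c2 \<le> 2 * (q + 2)" if "0 < q" for q :: real using that c2 by simp_all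
    note pos = gen(1)[OF \<open>0 < 6 / c\<close>]
    from gen(2)[OF \<open>0 < 6 / c\<close>]
    show "r \<le> 1" unfolding r_def using pos by (simp only: divide_le_eq_1_pos)
    show "0 < r" unfolding r_def using c2(1) pos by (rule divide_pos_pos)
  qed
  let ?err = "\<lambda>n. 16 * (\<delta> * (real n * ln (real n)) + 1) / (c * real n)\<^sup>2 + exp (- ((r * \<delta>) * ln (real n))) * (6 / c + 2)"
  show ?thesis
  proof (rule fast_consensus_compose[OF last, where err="?err" and t=\<delta>])
    have "(\<lambda>n. 16 * (\<delta> * (real n * ln (real n)) + 1) / (c * real n)\<^sup>2) \<longlonglongrightarrow> 0"
      using c \<delta> by real_asymp
    moreover have "(\<lambda>n. exp (- ((r * \<delta>) * ln (real n))) * (6 / c + 2)) \<longlonglongrightarrow> 0"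
      using r \<delta> by (intro tendsto_mult_left_zero exp_neg_ln_tendsto_0) auto
    ultimately show "?err \<longlonglongrightarrow> 0" using tendsto_add by fastforce
    show "\<forall>\<^sub>F n in sequentially. \<forall>k. (\<forall>\<sigma>. valid n \<sigma> \<longrightarrow> (1 - c2) * real n \<le> \<bar>lead n \<sigma>\<bar> \<longrightarrow> survival n k \<sigma> \<le> \<eta> / 2) \<longrightarrow>
        (\<forall>\<sigma> j. valid n \<sigma> \<longrightarrow> c * real n \<le> \<bar>lead n \<sigma>\<bar> \<longrightarrow> \<delta> * (real n * ln (real n)) \<le> real j \<longrightarrow>
           real j \<le> \<delta> * (real n * ln (real n)) + 1 \<longrightarrow> survival n (j + k) \<sigma> \<le> \<eta> / 2 + ?err n)"
      using eventually_ge_at_top[of 2]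
    proof (eventually_elim, intro allI impI)
      fix n k \<sigma> j
      assume n: "2 \<le> n" and k: "\<forall>\<sigma>. valid n \<sigma> \<longrightarrow> (1 - c2) * real n \<le> \<bar>lead n \<sigma>\<bar> \<longrightarrow> survival n k \<sigma> \<le> \<eta> / 2"
        and \<sigma>: "valid n \<sigma>" "c * real n \<le> \<bar>lead n \<sigma>\<bar>"
        and j: "\<delta> * (real n * ln (real n)) \<le> real j" "real j \<le> \<delta> * (real n * ln (real n)) + 1"
      have "survival n (j + k) \<sigma> \<le> \<eta> / 2 + 16 * real j / (c * real n)\<^sup>2
          + (1 - c2 / (2 * (6 / c + 2) * real n)) ^ j * (6 / c + 2)"
        using k \<eta> by (intro survival_bulk[OF \<sigma>(1) n c c2 _ _ \<sigma>(2)]) auto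
      also have "c2 / (2 * (6 / c + 2) * real n) = r / real n" by (simp add: r_def)
      also have "\<eta> / 2 + 16 * real j / (c * real n)\<^sup>2 + (1 - r / real n) ^ j * (6 / c + 2) \<le>
          \<eta> / 2 + 16 * (\<delta> * (real n * ln (real n)) + 1) / (c * real n)\<^sup>2 + exp (- ((r * \<delta>) * ln (real n))) * (6 / c + 2)"
      proof (intro add_mono order_refl divide_right_mono mult_left_mono mult_right_mono j(2))
        have "(1 - r / real n) ^ j \<le> exp (- (r / real n * real j))"
          using r n by (intro one_minus_power_le_exp) (auto simp: field_simps)
        also have "r / real n * (\<delta> * (real n * ln (real n))) \<le> r / real n * real j"
          using r j(1) by (intro mult_left_mono) auto
        then have "exp (- (r / real n * real j)) \<le> exp (- ((r * \<delta>) * ln (real n)))" using n by simp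
        finally show "(1 - r / real n) ^ j \<le> exp (- ((r * \<delta>) * ln (real n)))" .
      qed (use c in auto)
      finally show "survival n (j + k) \<sigma> \<le> \<eta> / 2 + ?err n" by simp
    qed
  qed (use \<eta> \<delta> \<tau> in \<open>auto simp: \<delta>_def field_simps\<close>)
qed

abbreviation growth_rate :: real where "growth_rate \<equiv> sqrt 5 - 2"

section \<open>Growth of a small lead\<close>

lemma sqrt5_bounds: "2236 / 1000 < sqrt 5" "sqrt 5 < 2237 / 1000"
  by (rule real_less_rsqrt, simp add: power2_eq_square) (rule real_less_lsqrt, simp_all add: power2_eq_square)

lemma ln_one_plus_ge_cubic:
  fixes u :: real
  assumes "\<bar>u\<bar> \<le> 1 / 2"
  shows "u - u\<^sup>2 / 2 - \<bar>u\<bar> ^ 3 \<le> ln (1 + u)"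
proof (cases "0 \<le> u")
  case True
  have "ln (1 + 0) - 0 + 0\<^sup>2 / 2 \<le> ln (1 + u) - u + u\<^sup>2 / 2"
  proof (rule DERIV_nonneg_imp_nondecreasing[OF True])
    fix x :: real assume x: "0 \<le> x" "x \<le> u"
    have "((\<lambda>x. ln (1 + x) - x + x\<^sup>2 / 2) has_field_derivative (1 / (1 + x) - 1 + x)) (at x)"
      using x by (auto intro!: derivative_eq_intros simp: field_simps)
    moreover have "1 / (1 + x) - 1 + x = x\<^sup>2 / (1 + x)" using x by (simp add: field_simps power2_eq_square)
    ultimately show "\<exists>y. ((\<lambda>x. ln (1 + x) - x + x\<^sup>2 / 2) has_field_derivative y) (at x) \<and> 0 \<le> y"
      using x by (intro exI[of _ "x\<^sup>2 / (1 + x)"]) auto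
  qed
  then have "u - u\<^sup>2 / 2 \<le> ln (1 + u)" by simp
  moreover have "0 \<le> \<bar>u\<bar> ^ 3" by simp
  ultimately show ?thesis by linarith
next
  case False
  define t where "t = - u"
  have t: "0 \<le> t" "t \<le> 1 / 2" using False assms by (auto simp: t_def)
  have "ln (1 - 0) + 0 + 0\<^sup>2 / 2 + 0 ^ 3 \<le> ln (1 - t) + t + t\<^sup>2 / 2 + t ^ 3"
  proof (rule DERIV_nonneg_imp_nondecreasing[OF t(1)])
    fix x :: real assume x: "0 \<le> x" "x \<le> t"
    have "((\<lambda>x. ln (1 - x) + x + x\<^sup>2 / 2 + x ^ 3) has_field_derivative (- 1 / (1 - x) + 1 + x + 3 * x\<^sup>2)) (at x)"
      using x t by (auto intro!: derivative_eq_intros simp: field_simps)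
    moreover have "- 1 / (1 - x) + 1 + x + 3 * x\<^sup>2 = x\<^sup>2 * (2 - 3 * x) / (1 - x)"
      using x t by (simp add: field_simps power2_eq_square power3_eq_cube)
    ultimately show "\<exists>y. ((\<lambda>x. ln (1 - x) + x + x\<^sup>2 / 2 + x ^ 3) has_field_derivative y) (at x) \<and> 0 \<le> y"
      using x t by (intro exI[of _ "x\<^sup>2 * (2 - 3 * x) / (1 - x)"]) auto
  qed
  then show ?thesis using t by (simp add: t_def)
qed

lemma exp_le_quadratic:
  fixes x :: real
  assumes "x \<le> 1" shows "exp x \<le> 1 + x + x\<^sup>2"
proof (cases "0 \<le> x")
  case True
  then show ?thesis using exp_bound[of x] assms by simp
next
  case False
  have "1 - x \<le> exp (- x)" using exp_ge_add_one_self[of "- x"] by simp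
  then have "exp x \<le> 1 / (1 - x)" using False by (simp add: exp_minus field_simps)
  also have "\<dots> \<le> 1 + x + x\<^sup>2"
  proof -
    have "x * x\<^sup>2 \<le> 0" using False by (simp add: mult_nonpos_nonneg)
    then have "1 \<le> (1 + x + x\<^sup>2) * (1 - x)" by (simp add: algebra_simps power2_eq_square)
    then show ?thesis using False by (simp add: divide_le_eq)
  qed
  finally show ?thesis .
qed

text \<open>
A third-order expansion of the logarithm. The second-order term has to be exact, since near \<open>D = 0\<close>
the drift comes from the noise.
\<close>

lemma ln_square_increment:
  fixes D a M :: real
  assumes M: "400 \<le> M" and a: "\<bar>a\<bar> \<le> 2"
  defines "S \<equiv> D\<^sup>2 + M"
  shows "2 * D * a / S + a\<^sup>2 / S - 2 * D\<^sup>2 * a\<^sup>2 / S\<^sup>2 - 142 / (S * sqrt S) \<le> ln ((D + a)\<^sup>2 + M) - ln S"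
    and "\<bar>ln ((D + a)\<^sup>2 + M) - ln S\<bar> \<le> 8 / sqrt S"
proof -
  define r where "r = sqrt S"
  have S: "400 \<le> S" using M by (simp add: S_def add_increasing)
  have r: "20 \<le> r" unfolding r_def by (rule real_le_rsqrt) (use S in simp)
  have Sr: "S = r\<^sup>2" using S by (simp add: r_def)
  have D: "\<bar>D\<bar> \<le> r" unfolding r_def by (rule real_le_rsqrt) (use M in \<open>simp add: S_def\<close>)
  define v where "v = 2 * D * a + a\<^sup>2"
  have a2: "a\<^sup>2 \<le> 4" using a abs_le_square_iff[of a 2] by simp
  have Da: "\<bar>D * a\<bar> \<le> r * 2" unfolding abs_mult using D a r by (intro mult_mono) auto
  have v: "\<bar>v\<bar> \<le> 5 * r"
  proof -
    have "\<bar>v\<bar> \<le> 2 * \<bar>D * a\<bar> + a\<^sup>2" unfolding v_def by (simp add: abs_if)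
    then show ?thesis using Da a2 r by linarith
  qed
  define u where "u = v / S"
  have u: "\<bar>u\<bar> \<le> 5 / r"
  proof -
    have "\<bar>u\<bar> \<le> 5 * r / r\<^sup>2" unfolding u_def abs_divide Sr using v by (simp add: divide_right_mono)
    then show ?thesis using r by (simp add: power2_eq_square)
  qed
  have "5 / r \<le> 1 / 4" using r by (simp add: field_simps)
  then have u4: "\<bar>u\<bar> \<le> 1 / 4" using u by linarith
  have "(D + a)\<^sup>2 + M = S * (1 + u)"
    using S by (simp add: u_def v_def field_simps) (simp add: S_def power2_eq_square algebra_simps)
  then have ln: "ln ((D + a)\<^sup>2 + M) - ln S = ln (1 + u)"
    using S u4 by (simp add: ln_mult)
  have "u\<^sup>2 / 2 \<le> 2 * D\<^sup>2 * a\<^sup>2 / S\<^sup>2 + 17 / (S * r)"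
  proof -
    have "v\<^sup>2 = 4 * D\<^sup>2 * a\<^sup>2 + 4 * (D * a) * a\<^sup>2 + a\<^sup>2 * a\<^sup>2"
      by (simp add: v_def power2_eq_square algebra_simps)
    moreover have "D * a * a\<^sup>2 \<le> (r * 2) * 4"
      by (rule mult_mono) (use Da a2 r in \<open>auto simp: abs_le_iff\<close>)
    moreover have "a\<^sup>2 * a\<^sup>2 \<le> 4 * 4" using a2 by (intro mult_mono) auto
    ultimately have "v\<^sup>2 \<le> 4 * D\<^sup>2 * a\<^sup>2 + 34 * r" using r by linarith
    then have "v\<^sup>2 / (2 * S\<^sup>2) \<le> (4 * D\<^sup>2 * a\<^sup>2 + 34 * r) / (2 * S\<^sup>2)" by (rule divide_right_mono) simp
    also have "\<dots> = 2 * D\<^sup>2 * a\<^sup>2 / S\<^sup>2 + 17 * r / (S * S)" by (simp add: add_divide_distrib power2_eq_square)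
    also have "17 * r / (S * S) = 17 / (S * r)" using r by (simp add: Sr power2_eq_square)
    finally show ?thesis by (simp add: u_def power_divide)
  qed
  moreover have "\<bar>u\<bar> ^ 3 \<le> 125 / (S * r)"
  proof -
    have "\<bar>u\<bar> ^ 3 \<le> (5 / r) ^ 3" using u by (rule power_mono) simp
    then show ?thesis by (simp add: Sr power_divide power2_eq_square power3_eq_cube)
  qed
  moreover have "u - u\<^sup>2 / 2 - \<bar>u\<bar> ^ 3 \<le> ln (1 + u)" using u4 by (intro ln_one_plus_ge_cubic) auto
  moreover have "u = 2 * D * a / S + a\<^sup>2 / S" by (simp add: u_def v_def add_divide_distrib)
  moreover have "17 / (S * r) + 125 / (S * r) = 142 / (S * r)" by (simp add: add_divide_distrib[symmetric])
  ultimately show "2 * D * a / S + a\<^sup>2 / S - 2 * D\<^sup>2 * a\<^sup>2 / S\<^sup>2 - 142 / (S * sqrt S) \<le> ln ((D + a)\<^sup>2 + M) - ln S"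
    unfolding ln r_def[symmetric] by linarith
  have "\<bar>ln (1 + u) - u\<bar> \<le> 2 * u\<^sup>2" using u4 by (intro abs_ln_one_plus_x_minus_x_bound) auto
  moreover have "u\<^sup>2 \<le> 1 / 4 * \<bar>u\<bar>"
    using u4 mult_right_mono[of "\<bar>u\<bar>" "1 / 4" "\<bar>u\<bar>"] by (simp add: power2_eq_square)
  moreover have "5 / r * (3 / 2) \<le> 8 / r" using r by (simp add: field_simps)
  ultimately show "\<bar>ln ((D + a)\<^sup>2 + M) - ln S\<bar> \<le> 8 / sqrt S"
    unfolding ln r_def[symmetric] using u by linarith
qed

text \<open>
Twice \<open>ln D + \<beta> ln (Z + (sqrt 5 + 2) N)\<close>, with \<open>D\<^sup>2\<close> regularised on the scale \<open>sqrt N\<close> of the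
fluctuations. The negative root of \<open>1 - 4 z - z\<^sup>2\<close> is \<open>- (sqrt 5 + 2)\<close>, so the derivative of the second
logarithm along the limiting equations with \<open>d = 0\<close> is \<open>(growth_rate - z) / 2\<close>.
\<close>

definition potential :: "real \<Rightarrow> real \<Rightarrow> real \<Rightarrow> real \<Rightarrow> real" where
  "potential \<beta> N D Z = ln (D\<^sup>2 + 2 * N) + 2 * \<beta> * ln (Z + (sqrt 5 + 2) * N)"

lemma potential_increment:
  fixes D Z a b N \<beta> :: real
  assumes N: "400 \<le> N" and Z: "0 \<le> Z" and ab: "\<bar>a\<bar> \<le> 2" "\<bar>b\<bar> \<le> 2" and \<beta>: "0 \<le> \<beta>" "\<beta> \<le> 2"
  defines "S \<equiv> D\<^sup>2 + 2 * N" and "P \<equiv> Z + (sqrt 5 + 2) * N"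
  shows "2 * D / S * a + (1 / S - 2 * D\<^sup>2 / S\<^sup>2) * a\<^sup>2 + 2 * \<beta> / P * b - 150 / (N * sqrt N)
      \<le> potential \<beta> N (D + a) (Z + b) - potential \<beta> N D Z"
    and "\<bar>potential \<beta> N (D + a) (Z + b) - potential \<beta> N D Z\<bar> \<le> 12 / sqrt N"
proof -
  define l1 l2 where "l1 = ln ((D + a)\<^sup>2 + 2 * N) - ln S" and "l2 = ln (P + b) - ln P"
  have pot: "potential \<beta> N (D + a) (Z + b) - potential \<beta> N D Z = l1 + 2 * \<beta> * l2"
    by (simp add: potential_def l1_def l2_def S_def P_def algebra_simps)
  have SN: "N \<le> S" using N by (simp add: S_def add_increasing)
  have sN: "20 \<le> sqrt N" by (rule real_le_rsqrt) (use N in simp)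
  have P: "4 * N \<le> P"
  proof -
    have "4 * N \<le> (sqrt 5 + 2) * N" using sqrt5_bounds N by (intro mult_right_mono) auto
    then show ?thesis using Z by (simp add: P_def)
  qed
  have "N * 1 \<le> N * sqrt N" using N sN by (intro mult_left_mono) auto
  have sNN: "sqrt N \<le> N" using N sN real_sqrt_mult_self[of N] mult_right_mono[of 1 "sqrt N" "sqrt N"] by auto
  have l1: "2 * D / S * a + (1 / S - 2 * D\<^sup>2 / S\<^sup>2) * a\<^sup>2 - 142 / (N * sqrt N) \<le> l1" "\<bar>l1\<bar> \<le> 8 / sqrt N"
  proof -
    have M: "400 \<le> 2 * N" using N by simp
    have "142 / (S * sqrt S) \<le> 142 / (N * sqrt N)"
      using SN N by (intro divide_left_mono mult_mono mult_pos_pos) auto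
    moreover have "2 * D / S * a + (1 / S - 2 * D\<^sup>2 / S\<^sup>2) * a\<^sup>2 = 2 * D * a / S + a\<^sup>2 / S - 2 * D\<^sup>2 * a\<^sup>2 / S\<^sup>2"
      by (simp add: left_diff_distrib)
    ultimately show "2 * D / S * a + (1 / S - 2 * D\<^sup>2 / S\<^sup>2) * a\<^sup>2 - 142 / (N * sqrt N) \<le> l1"
      using ln_square_increment(1)[OF M ab(1), of D] unfolding l1_def S_def by linarith
    have "8 / sqrt S \<le> 8 / sqrt N" using SN N by (intro divide_left_mono) auto
    then show "\<bar>l1\<bar> \<le> 8 / sqrt N"
      using ln_square_increment(2)[OF M ab(1), of D] unfolding l1_def S_def by linarith
  qed
  define t where "t = b / P"
  have t: "\<bar>t\<bar> \<le> 1 / (2 * N)"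
  proof -
    have "\<bar>t\<bar> \<le> 2 / (4 * N)" unfolding t_def abs_divide using P N ab(2) by (intro frac_le) auto
    then show ?thesis by simp
  qed
  have "1 / (2 * N) \<le> 1 / 2" using N by (simp add: field_simps)
  then have t2: "\<bar>t\<bar> \<le> 1 / 2" using t by linarith
  have "P + b = P * (1 + t)" using P N by (simp add: t_def field_simps)
  then have l2: "l2 = ln (1 + t)" using P N t2 by (simp add: l2_def ln_mult)
  have "t\<^sup>2 \<le> (1 / (2 * N))\<^sup>2" using t by (metis abs_ge_zero power2_abs power_mono)
  then have tt: "2 * t\<^sup>2 \<le> 1 / (2 * N\<^sup>2)" by (simp add: power_divide power_mult_distrib)
  have l2t: "\<bar>l2 - t\<bar> \<le> 1 / (2 * N\<^sup>2)"
    using abs_ln_one_plus_x_minus_x_bound[OF t2] tt unfolding l2 by linarith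
  have NN: "1 / N\<^sup>2 \<le> 1 / (N * sqrt N)"
    unfolding power2_eq_square using N sNN by (intro divide_left_mono mult_left_mono mult_pos_pos) auto
  show "2 * D / S * a + (1 / S - 2 * D\<^sup>2 / S\<^sup>2) * a\<^sup>2 + 2 * \<beta> / P * b - 150 / (N * sqrt N)
      \<le> potential \<beta> N (D + a) (Z + b) - potential \<beta> N D Z"
  proof -
    have "2 * \<beta> * (t - l2) \<le> 2 * \<beta> * (1 / (2 * N\<^sup>2))" using l2t \<beta> by (intro mult_left_mono) auto
    also have "\<dots> \<le> 2 * 2 * (1 / (2 * N\<^sup>2))" using \<beta> by (intro mult_right_mono) auto
    also have "\<dots> = 2 * (1 / N\<^sup>2)" by simp
    also have "\<dots> \<le> 2 * (1 / (N * sqrt N))" using NN by simp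
    finally have "2 * \<beta> * t - 2 / (N * sqrt N) \<le> 2 * \<beta> * l2" by (simp add: right_diff_distrib)
    moreover have "2 * \<beta> * t = 2 * \<beta> / P * b" by (simp add: t_def)
    moreover have "142 / (N * sqrt N) + 2 / (N * sqrt N) \<le> 150 / (N * sqrt N)"
      using N by (simp add: add_divide_distrib[symmetric] divide_right_mono)
    ultimately show ?thesis unfolding pot using l1(1) by linarith
  qed
  have "\<bar>l2\<bar> \<le> 1 / N"
  proof -
    have "1 / (2 * N\<^sup>2) \<le> 1 / (2 * N)" using N by (simp add: power2_eq_square field_simps)
    then have "\<bar>l2\<bar> \<le> 1 / (2 * N) + 1 / (2 * N)" using t l2t by linarith
    then show ?thesis by simp
  qed
  moreover have "1 / N \<le> 1 / sqrt N" using sNN N by (intro divide_left_mono) auto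
  ultimately have "2 * \<beta> * \<bar>l2\<bar> \<le> 2 * 2 * (1 / sqrt N)" using \<beta> by (intro mult_mono) auto
  then show "\<bar>potential \<beta> N (D + a) (Z + b) - potential \<beta> N D Z\<bar> \<le> 12 / sqrt N"
    unfolding pot using l1(2) \<beta> abs_triangle_ineq[of l1 "2 * \<beta> * l2"] by (simp add: abs_mult)
qed

text \<open>
A lower bound \<open>\<eta>\<close> on the drift of the potential per unit of time turns into a geometric decay of
\<open>exp (- \<kappa> * potential)\<close>; the correction \<open>144 \<kappa>\<close> comes from the squared increments and is harmless
for small \<open>\<kappa>\<close>. The right-hand side of the assumption is the exact drift up to lower-order terms: the
growth of \<open>D\<close>, the contribution of the noise, and the relaxation of \<open>Z\<close>.
\<close>

lemma step_mean_exp_potential: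
  fixes \<beta> \<kappa> \<eta> :: real
  assumes \<sigma>: "valid n \<sigma>" and n: "400 \<le> n" and \<beta>: "0 \<le> \<beta>" "\<beta> \<le> 2" and \<kappa>: "0 < \<kappa>" "\<kappa> \<le> 1" and \<eta>: "0 \<le> \<eta>"
  defines "N \<equiv> real n" and "D \<equiv> lead n \<sigma>" and "Z \<equiv> mixed n \<sigma>"
  defines "S \<equiv> D\<^sup>2 + 2 * N" and "Q \<equiv> N\<^sup>2 / 2 + N * Z + 5 / 2 * Z\<^sup>2 - D\<^sup>2 / 2 - 4 * Z"
  defines "f \<equiv> \<lambda>\<tau>. exp (- (\<kappa> * potential \<beta> N (lead n \<tau>) (mixed n \<tau>)))"
  assumes drift: "\<eta> * N \<le> 2 * D\<^sup>2 / S * Z + Q / S * (1 - 2 * D\<^sup>2 / S) + \<beta> * (growth_rate * N - Z) - \<beta> * D\<^sup>2 / (4 * N)"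
  shows "step_mean n f \<sigma> \<le> (1 - \<kappa> * (\<eta> - 150 / sqrt N - 144 * \<kappa>) / N) * f \<sigma>"
proof -
  define P where "P = Z + (sqrt 5 + 2) * N"
  have N: "400 \<le> N" using n by (simp add: N_def)
  have st: "0 \<le> Z" "Z \<le> N" using state_bounds[OF \<sigma>] by (auto simp: N_def D_def Z_def)
  have S: "0 < S" using N by (simp add: S_def add_nonneg_pos)
  have sN: "20 \<le> sqrt N" by (rule real_le_rsqrt) (use N in simp)
  have P: "4 * N \<le> P"
  proof -
    have "4 * N \<le> (sqrt 5 + 2) * N" using sqrt5_bounds N by (intro mult_right_mono) auto
    then show ?thesis using st by (simp add: P_def)
  qed
  define A1 A2 B1 where "A1 = 2 * D / S" and "A2 = 1 / S - 2 * D\<^sup>2 / S\<^sup>2" and "B1 = 2 * \<beta> / P"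
  define E where "E = \<kappa> * (150 / (N * sqrt N)) + 144 * \<kappa>\<^sup>2 / N"
  define F where "F = f \<sigma>"
  have F: "0 < F" by (simp add: F_def f_def)
  have E: "0 \<le> E" using N \<kappa> by (simp add: E_def)
  let ?g = "\<lambda>D Z. exp (- (\<kappa> * potential \<beta> N D Z))"
  have inc: "?g (D + a) (Z + b) - ?g D Z \<le> (- F * \<kappa> * A1) * a + (- F * \<kappa> * B1) * b + (- F * \<kappa> * A2) * a\<^sup>2 + F * E"
    if ab: "\<bar>a\<bar> \<le> 2" "\<bar>b\<bar> \<le> 2" for a b
  proof -
    define G where "G = potential \<beta> N (D + a) (Z + b) - potential \<beta> N D Z"
    note G = potential_increment[OF N st(1) ab \<beta>, of D, folded S_def P_def G_def, folded A1_def A2_def B1_def]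
    have "\<bar>\<kappa> * G\<bar> \<le> 1 * (12 / sqrt N)" unfolding abs_mult using G(2) \<kappa> by (intro mult_mono) auto
    also have "\<dots> \<le> 1" using sN N by (simp add: divide_le_eq)
    finally have "- (\<kappa> * G) \<le> 1" by linarith
    then have "exp (- (\<kappa> * G)) \<le> 1 + - (\<kappa> * G) + (- (\<kappa> * G))\<^sup>2" by (rule exp_le_quadratic)
    also have "(- (\<kappa> * G))\<^sup>2 = \<kappa>\<^sup>2 * G\<^sup>2" by (simp add: power_mult_distrib)
    also have "\<kappa>\<^sup>2 * G\<^sup>2 \<le> \<kappa>\<^sup>2 * (144 / N)"
    proof -
      have "\<bar>G\<bar>\<^sup>2 \<le> (12 / sqrt N)\<^sup>2" using G(2) by (rule power_mono) simp
      then show ?thesis using N by (intro mult_left_mono) (auto simp: power_divide)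
    qed
    also have "- (\<kappa> * G) \<le> - (\<kappa> * (A1 * a + A2 * a\<^sup>2 + B1 * b - 150 / (N * sqrt N)))"
      using G(1) \<kappa> by simp
    finally have "exp (- (\<kappa> * G)) - 1 \<le> - (\<kappa> * (A1 * a + A2 * a\<^sup>2 + B1 * b)) + E"
      by (simp add: E_def algebra_simps)
    then have "F * (exp (- (\<kappa> * G)) - 1) \<le> F * (- (\<kappa> * (A1 * a + A2 * a\<^sup>2 + B1 * b)) + E)"
      using F by (intro mult_left_mono) auto
    moreover have "?g (D + a) (Z + b) - ?g D Z = F * (exp (- (\<kappa> * G)) - 1)"
      by (simp add: F_def f_def G_def D_def Z_def right_diff_distrib exp_add[symmetric] algebra_simps)
    ultimately show ?thesis by (simp add: algebra_simps)
  qed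
  have "step_mean n (\<lambda>\<tau>. ?g (1 * lead n \<tau>) (mixed n \<tau>)) \<sigma> \<le> ?g (1 * lead n \<sigma>) (mixed n \<sigma>)
    + ((- F * \<kappa> * A1) * (1 * lead n \<sigma> * mixed n \<sigma>)
      + (- F * \<kappa> * B1) * ((real n)\<^sup>2 / 2 - 2 * real n * mixed n \<sigma> - (mixed n \<sigma>)\<^sup>2 / 2 - (1 * lead n \<sigma>)\<^sup>2 / 2 + 2 * mixed n \<sigma>)
      + (- F * \<kappa> * A2) * ((real n)\<^sup>2 / 2 + real n * mixed n \<sigma> + 5 / 2 * (mixed n \<sigma>)\<^sup>2 - (1 * lead n \<sigma>)\<^sup>2 / 2 - 4 * mixed n \<sigma>))
      / (real n * (real n - 1)) + F * E"
    by (rule step_mean_le_linear[OF \<sigma> _ _ _, where g="?g"])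
       (use n inc F E in \<open>simp_all add: D_def Z_def\<close>)
  then have "step_mean n f \<sigma> \<le> F + ((- F * \<kappa> * A1) * (D * Z)
      + (- F * \<kappa> * B1) * (N\<^sup>2 / 2 - 2 * N * Z - Z\<^sup>2 / 2 - D\<^sup>2 / 2 + 2 * Z)
      + (- F * \<kappa> * A2) * Q) / (N * (N - 1)) + F * E"
    by (simp add: f_def F_def D_def Z_def N_def Q_def)
  also have "(- F * \<kappa> * A1) * (D * Z) + (- F * \<kappa> * B1) * (N\<^sup>2 / 2 - 2 * N * Z - Z\<^sup>2 / 2 - D\<^sup>2 / 2 + 2 * Z)
      + (- F * \<kappa> * A2) * Q = - (F * \<kappa>) * (A1 * (D * Z) + B1 * (N\<^sup>2 / 2 - 2 * N * Z - Z\<^sup>2 / 2 - D\<^sup>2 / 2 + 2 * Z) + A2 * Q)"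
    by (simp add: algebra_simps)
  also have "- (F * \<kappa>) * (A1 * (D * Z) + B1 * (N\<^sup>2 / 2 - 2 * N * Z - Z\<^sup>2 / 2 - D\<^sup>2 / 2 + 2 * Z) + A2 * Q) \<le> - (F * \<kappa>) * (\<eta> * N)"
  proof -
    have "A1 * (D * Z) = 2 * D\<^sup>2 / S * Z" by (simp add: A1_def power2_eq_square)
    moreover have "A2 * Q = Q / S * (1 - 2 * D\<^sup>2 / S)"
      by (simp add: A2_def right_diff_distrib left_diff_distrib power2_eq_square mult.commute)
    moreover have "B1 * (N\<^sup>2 / 2 - 2 * N * Z - Z\<^sup>2 / 2 - D\<^sup>2 / 2 + 2 * Z) \<ge> \<beta> * (growth_rate * N - Z) - \<beta> * D\<^sup>2 / (4 * N)"
    proof -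
      have "N\<^sup>2 / 2 - 2 * N * Z - Z\<^sup>2 / 2 - D\<^sup>2 / 2 + 2 * Z = (growth_rate * N - Z) * P / 2 - D\<^sup>2 / 2 + 2 * Z"
      proof -
        have "sqrt 5 * (sqrt 5 * x) = 5 * x" for x :: real
          by (simp only: mult.assoc[symmetric] real_sqrt_mult_self abs_numeral)
        then show ?thesis by (simp add: P_def field_simps power2_eq_square)
      qed
      moreover have "B1 * (w * P / 2 - D\<^sup>2 / 2 + 2 * Z) = \<beta> * w - \<beta> * D\<^sup>2 / P + 4 * \<beta> * Z / P" for w
        using P N by (simp add: B1_def field_simps)
      ultimately have "B1 * (N\<^sup>2 / 2 - 2 * N * Z - Z\<^sup>2 / 2 - D\<^sup>2 / 2 + 2 * Z) =
          \<beta> * (growth_rate * N - Z) - \<beta> * D\<^sup>2 / P + 4 * \<beta> * Z / P"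
        by (simp only:)
      moreover have "\<beta> * D\<^sup>2 / P \<le> \<beta> * D\<^sup>2 / (4 * N)" using P N \<beta> by (intro divide_left_mono) auto
      moreover have "0 \<le> 4 * \<beta> * Z / P" using P N \<beta> st by (intro divide_nonneg_nonneg) auto
      ultimately show ?thesis by linarith
    qed
    ultimately have "\<eta> * N \<le> A1 * (D * Z) + B1 * (N\<^sup>2 / 2 - 2 * N * Z - Z\<^sup>2 / 2 - D\<^sup>2 / 2 + 2 * Z) + A2 * Q"
      using drift by linarith
    then have "F * \<kappa> * (\<eta> * N) \<le> F * \<kappa> * (A1 * (D * Z) + B1 * (N\<^sup>2 / 2 - 2 * N * Z - Z\<^sup>2 / 2 - D\<^sup>2 / 2 + 2 * Z) + A2 * Q)"
      using F \<kappa> by (intro mult_left_mono) auto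
    then show ?thesis by (simp only: mult_minus_left neg_le_iff_le)
  qed
  also have "- (F * \<kappa>) * (\<eta> * N) / (N * (N - 1)) \<le> - (F * \<kappa>) * (\<eta> / N)"
  proof -
    have "\<eta> / N \<le> \<eta> / (N - 1)" using N \<eta> by (intro divide_left_mono) auto
    also have "\<dots> = \<eta> * N / (N * (N - 1))" using N by simp
    finally have "(F * \<kappa>) * (\<eta> / N) \<le> (F * \<kappa>) * (\<eta> * N / (N * (N - 1)))" using F \<kappa> by (intro mult_left_mono) auto
    also have "\<dots> = (F * \<kappa>) * (\<eta> * N) / (N * (N - 1))" by (rule times_divide_eq_right)
    finally show ?thesis by (simp only: mult_minus_left minus_divide_left[symmetric] neg_le_iff_le)
  qed
  finally have "step_mean n f \<sigma> \<le> F + - (F * \<kappa>) * (\<eta> / N) + F * E"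
    using N by (simp add: divide_right_mono)
  also have "\<dots> = (1 - \<kappa> * (\<eta> - 150 / sqrt N - 144 * \<kappa>) / N) * F"
  proof -
    define d where "d = 150 / sqrt N"
    have "150 / (N * sqrt N) = d / N" by (simp add: d_def)
    then show ?thesis
      unfolding d_def[symmetric] E_def
      by (simp add: diff_divide_distrib add_divide_distrib algebra_simps power2_eq_square)
  qed
  finally show ?thesis by (simp add: F_def)
qed

text \<open>
For \<open>\<beta> = 1 / 2\<close> the drift is positive uniformly in \<open>Z\<close>. Close to \<open>D = 0\<close> it is due to the noise, and
far from \<open>0\<close> to the growth of the lead. In between the noise term is negative, and if in addition
\<open>Z\<close> is small, the relaxation of \<open>Z\<close> compensates.
\<close>

lemma lead_escapes_drift:
  fixes N D Z :: real
  assumes N: "400 \<le> N" and D: "D\<^sup>2 \<le> N\<^sup>2 / 100" and Z: "0 \<le> Z" "Z \<le> N"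
  defines "S \<equiv> D\<^sup>2 + 2 * N" and "Q \<equiv> N\<^sup>2 / 2 + N * Z + 5 / 2 * Z\<^sup>2 - D\<^sup>2 / 2 - 4 * Z"
  shows "1 / 20 * N \<le> 2 * D\<^sup>2 / S * Z + Q / S * (1 - 2 * D\<^sup>2 / S) + 1 / 2 * (growth_rate * N - Z) - 1 / 2 * D\<^sup>2 / (4 * N)"
proof -
  define \<theta> where "\<theta> = D\<^sup>2 / S"
  have S: "0 < S" using N by (simp add: S_def add_nonneg_pos)
  have \<theta>: "0 \<le> \<theta>" "\<theta> \<le> 1" using S N by (auto simp: \<theta>_def S_def)
  have S1: "1 / S = (1 - \<theta>) / (2 * N)" using S N by (simp add: \<theta>_def field_simps) (simp add: S_def)
  define \<phi> where "\<phi> = (1 - \<theta>) * (1 - 2 * \<theta>)"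
  \<comment> \<open>\<open>q0 - q1\<close> is the noise coefficient, with its leading part \<open>q0\<close>.\<close>
  define q0 q1 where "q0 = N / 4 + Z / 2 + 5 * Z\<^sup>2 / (4 * N)" and "q1 = D\<^sup>2 / (4 * N) + 2 * Z / N"
  have QS: "Q / S * (1 - 2 * D\<^sup>2 / S) = (q0 - q1) * \<phi>"
  proof -
    have "Q / S * (1 - 2 * D\<^sup>2 / S) = Q * (1 / S) * (1 - 2 * \<theta>)" by (simp add: \<theta>_def)
    also have "\<dots> = Q / (2 * N) * \<phi>" unfolding S1 \<phi>_def by simp
    also have "Q / (2 * N) = q0 - q1"
      using N by (simp add: Q_def q0_def q1_def field_simps power2_eq_square)
    finally show ?thesis .
  qed
  have D4: "D\<^sup>2 / (4 * N) \<le> N / 400"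
  proof -
    have "D\<^sup>2 / (4 * N) \<le> (N\<^sup>2 / 100) / (4 * N)" using D N by (intro divide_right_mono) auto
    then show ?thesis using N by (simp add: power2_eq_square)
  qed
  have q1: "0 \<le> q1" "q1 \<le> N / 400 + N / 200"
  proof -
    show "0 \<le> q1" using N Z by (simp add: q1_def)
    have "2 * Z / N \<le> 2" using N Z by (simp add: divide_le_eq)
    then show "q1 \<le> N / 400 + N / 200" using D4 N by (simp add: q1_def)
  qed
  \<comment> \<open>The minimum of \<open>\<phi>\<close> is \<open>- 1 / 8\<close>, at \<open>\<theta> = 3 / 4\<close>.\<close>
  have "0 \<le> 2 * (\<theta> - 3 / 4)\<^sup>2" by simp
  then have \<phi>1: "- (1 / 8) \<le> \<phi>" by (simp add: \<phi>_def power2_eq_square algebra_simps)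
  have \<phi>2: "\<phi> \<le> 1" "1 - 3 * \<theta> \<le> \<phi>"
  proof -
    have "\<theta> * \<theta> \<le> \<theta> * 1" using \<theta> by (intro mult_left_mono) auto
    then show "\<phi> \<le> 1" using \<theta> by (simp add: \<phi>_def algebra_simps)
    have "0 \<le> \<theta> * \<theta>" by simp
    then show "1 - 3 * \<theta> \<le> \<phi>" by (simp add: \<phi>_def algebra_simps)
  qed
  have q1\<phi>: "q1 * \<phi> \<le> N / 400 + N / 200"
    using mult_left_mono[OF \<phi>2(1) q1(1)] q1(2) by simp
  have gr: "236 / 1000 * N \<le> growth_rate * N" using sqrt5_bounds N by (intro mult_right_mono) auto
  have ZZ: "Z\<^sup>2 / N \<le> Z" using Z N by (simp add: divide_le_eq power2_eq_square mult_left_mono)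
  have ZZ0: "0 \<le> Z\<^sup>2 / N" using N by simp
  have q0: "N / 4 + Z / 2 \<le> q0" "q0 \<le> N / 4 + Z / 2 + 5 / 4 * Z"
    using ZZ ZZ0 by (simp_all add: q0_def)
  have main: "3 / 40 * N \<le> 2 * \<theta> * Z + q0 * \<phi> + 1 / 2 * (236 / 1000 * N - Z) - N / 400"
  proof (cases "\<theta> \<le> 1 / 2")
    case True
    then have \<phi>0: "0 \<le> \<phi>" using \<theta> by (simp add: \<phi>_def)
    have "Z / 2 * (1 - 3 * \<theta>) \<le> Z / 2 * \<phi>" using \<phi>2 Z by (intro mult_left_mono) auto
    also have "\<dots> \<le> q0 * \<phi>" using q0 N Z \<phi>0 by (intro mult_right_mono) auto
    finally have "Z / 2 - 3 / 2 * (\<theta> * Z) \<le> q0 * \<phi>" by (simp add: algebra_simps)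
    moreover have "0 \<le> \<theta> * Z" using \<theta> Z by simp
    moreover have "3 / 40 * N \<le> 2 * T + R + 1 / 2 * (236 / 1000 * N - Z) - N / 400"
      if "Z / 2 - 3 / 2 * T \<le> R" "0 \<le> T" for T R
      using that N by (simp add: field_simps)
    ultimately show ?thesis by (simp only: mult.assoc)
  next
    case False
    have "1 / 2 * Z \<le> \<theta> * Z" using False Z by (intro mult_right_mono) auto
    moreover have "- (1 / 8) * q0 \<le> \<phi> * q0" using \<phi>1 q0 N Z by (intro mult_right_mono) auto
    moreover have "3 / 40 * N \<le> 2 * T + R + 1 / 2 * (236 / 1000 * N - Z) - N / 400"
      if "1 / 2 * Z \<le> T" "- (1 / 8) * q0 \<le> R" for T R
      using that N q0 Z(1) by (simp add: field_simps)
    ultimately show ?thesis by (simp only: mult.assoc mult.commute[of \<phi> q0])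
  qed
  have gen: "1 / 20 * N \<le> T + (R - V) + 1 / 2 * (G - Z) - 1 / 2 * W"
    if "3 / 40 * N \<le> T + R + 1 / 2 * (236 / 1000 * N - Z) - N / 400" "V \<le> N / 400 + N / 200"
      "236 / 1000 * N \<le> G" "W \<le> N / 400" for T R V G W
    using that N by (simp add: field_simps)
  have eqs: "2 * D\<^sup>2 / S * Z = 2 * \<theta> * Z" "1 / 2 * D\<^sup>2 / (4 * N) = 1 / 2 * (D\<^sup>2 / (4 * N))"
    "(q0 - q1) * \<phi> = q0 * \<phi> - q1 * \<phi>"
    by (simp_all add: \<theta>_def left_diff_distrib)
  show ?thesis
    unfolding QS eqs by (rule gen[OF main q1\<phi> gr D4])
qed

lemma potential_bounds:
  fixes N D Z \<beta> :: real
  assumes N: "400 \<le> N" and Z: "0 \<le> Z" "Z \<le> N" and \<beta>: "0 \<le> \<beta>"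
  defines "l0 \<equiv> ln ((sqrt 5 + 2) * N)"
  shows "ln (D\<^sup>2 + 2 * N) + 2 * \<beta> * l0 \<le> potential \<beta> N D Z"
    and "potential \<beta> N D Z \<le> ln (D\<^sup>2 + 2 * N) + 2 * \<beta> * l0 + \<beta> / 2"
proof -
  let ?c = "sqrt 5 + 2"
  have c: "4 \<le> ?c" using sqrt5_bounds by simp
  have cN: "0 < ?c * N" using c N by simp
  have "l0 \<le> ln (Z + ?c * N)" unfolding l0_def using cN Z by simp
  then show "ln (D\<^sup>2 + 2 * N) + 2 * \<beta> * l0 \<le> potential \<beta> N D Z"
    unfolding potential_def using \<beta> by (simp add: mult_left_mono)
  have "ln (Z + ?c * N) \<le> ln (?c * N * (1 + 1 / 4))"
  proof (subst ln_le_cancel_iff)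
    have "4 * N \<le> ?c * N" using c N by (intro mult_right_mono) auto
    then have "Z \<le> ?c * N * (1 / 4)" using Z by linarith
    then show "Z + ?c * N \<le> ?c * N * (1 + 1 / 4)" unfolding distrib_left[of "?c * N"] by linarith
  qed (use cN Z in auto)
  also have "\<dots> = l0 + ln (1 + 1 / 4)" unfolding l0_def using cN by (subst ln_mult) auto
  also have "ln (1 + 1 / 4 :: real) \<le> 1 / 4" by (rule ln_add_one_self_le_self) simp
  finally have "ln (Z + ?c * N) \<le> l0 + 1 / 4" by simp
  then have "2 * \<beta> * ln (Z + ?c * N) \<le> 2 * \<beta> * (l0 + 1 / 4)" using \<beta> by (intro mult_left_mono) auto
  then show "potential \<beta> N D Z \<le> ln (D\<^sup>2 + 2 * N) + 2 * \<beta> * l0 + \<beta> / 2"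
    unfolding potential_def by (simp add: distrib_left)
qed

text \<open>
Escape from balance. The last factor compares the potential on the boundary \<open>K\<close> with its least
value, so for \<open>K\<close> slightly above \<open>sqrt n\<close> it is a small power of \<open>n\<close>.
\<close>

lemma survival_escape:
  fixes K \<eta> :: real
  assumes \<sigma>: "valid n \<sigma>" and n: "225000000 \<le> n" and K: "0 \<le> K" "K\<^sup>2 \<le> (real n)\<^sup>2 / 100"
    and last: "\<And>\<tau>. valid n \<tau> \<Longrightarrow> K \<le> \<bar>lead n \<tau>\<bar> \<Longrightarrow> survival n k \<tau> \<le> \<eta>" and \<eta>: "0 \<le> \<eta>"
  shows "survival n (j + k) \<sigma> \<le> \<eta> + (1 - 3 / 1440000 / real n) ^ j *
      exp (1 / 14400 * (ln (K\<^sup>2 + 2 * real n) - ln (2 * real n) + 1 / 4))"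
proof -
  define N where "N = real n"
  have N: "225000000 \<le> N" using n by (simp add: N_def)
  have n2: "2 \<le> n" "400 \<le> n" using n by auto
  define l0 where "l0 = ln ((sqrt 5 + 2) * N)"
  define Gm where "Gm = ln (K\<^sup>2 + 2 * N) + 2 * (1 / 2) * l0 + (1 / 2) / 2"
  define G where "G \<tau> = potential (1 / 2) N (lead n \<tau>) (mixed n \<tau>)" for \<tau>
  \<comment> \<open>Then \<open>144 \<kappa> = 1 / 100\<close>; as \<open>150 / sqrt N \<le> 1 / 100\<close>, a drift of \<open>3 / 100\<close> remains out of \<open>1 / 20\<close>.\<close>
  define \<kappa> where "\<kappa> = (1 / 14400 :: real)"
  define \<rho> where "\<rho> = 1 - 3 / 1440000 / N"
  have \<rho>: "0 \<le> \<rho>" using N by (simp add: \<rho>_def field_simps)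
  let ?F = "\<lambda>\<tau>. exp (\<kappa> * Gm) * exp (- (\<kappa> * G \<tau>))"
  have pb: "ln ((lead n \<tau>)\<^sup>2 + 2 * N) + 2 * (1 / 2) * l0 \<le> G \<tau>"
    "G \<tau> \<le> ln ((lead n \<tau>)\<^sup>2 + 2 * N) + 2 * (1 / 2) * l0 + (1 / 2) / 2" if "valid n \<tau>" for \<tau>
    using potential_bounds[of N "mixed n \<tau>" "1 / 2" "lead n \<tau>"] state_bounds[OF that] N
    unfolding G_def l0_def N_def by auto
  have "survival n (j + k) \<sigma> \<le> \<eta> + \<rho> ^ j * ?F \<sigma>"
  proof (rule survival_le_supersolution[where R="\<lambda>\<tau>. \<bar>lead n \<tau>\<bar> < K" and w="\<lambda>j \<tau>. \<eta> + \<rho> ^ j * ?F \<tau>", OF n2(1) \<sigma>])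
    fix j \<tau> assume \<tau>: "valid n \<tau>" "\<not> \<bar>lead n \<tau>\<bar> < K"
    then have "survival n (j + k) \<tau> \<le> \<eta>"
      using last[OF \<tau>(1)] survival_antimono[OF \<tau>(1) n2(1), of k "j + k"] by fastforce
    moreover have "0 \<le> \<rho> ^ j * ?F \<tau>" using \<rho> by simp
    ultimately show "survival n (j + k) \<tau> \<le> \<eta> + \<rho> ^ j * ?F \<tau>" by linarith
  next
    fix \<tau> assume \<tau>: "valid n \<tau>" "\<bar>lead n \<tau>\<bar> < K"
    have "(lead n \<tau>)\<^sup>2 \<le> K\<^sup>2" using \<tau>(2) K abs_le_square_iff[of "lead n \<tau>" K] by simp
    then have "ln ((lead n \<tau>)\<^sup>2 + 2 * N) \<le> ln (K\<^sup>2 + 2 * N)"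
      using N by (subst ln_le_cancel_iff) (auto simp: add_nonneg_pos)
    then have "0 \<le> \<kappa> * (Gm - G \<tau>)" using pb(2)[OF \<tau>(1)] by (simp add: Gm_def \<kappa>_def)
    then have "1 \<le> exp (\<kappa> * (Gm - G \<tau>))" by simp
    also have "\<dots> = ?F \<tau>" by (simp add: exp_add[symmetric] right_diff_distrib)
    finally show "survival n k \<tau> \<le> \<eta> + \<rho> ^ 0 * ?F \<tau>" using survival_le_1[OF \<tau>(1) n2(1), of k] \<eta> by simp
  next
    fix j \<tau> assume \<tau>: "valid n \<tau>" "\<bar>lead n \<tau>\<bar> < K"
    have "(lead n \<tau>)\<^sup>2 \<le> K\<^sup>2" using \<tau>(2) K abs_le_square_iff[of "lead n \<tau>" K] by simp
    then have D: "(lead n \<tau>)\<^sup>2 \<le> N\<^sup>2 / 100" using K by (simp add: N_def)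
    have "step_mean n (\<lambda>\<tau>. exp (- (\<kappa> * G \<tau>))) \<tau> \<le> (1 - \<kappa> * (1 / 20 - 150 / sqrt N - 144 * \<kappa>) / N) * exp (- (\<kappa> * G \<tau>))"
      unfolding G_def N_def
      by (rule step_mean_exp_potential[OF \<tau>(1) n2(2)])
         (use lead_escapes_drift[of N "lead n \<tau>" "mixed n \<tau>"] D state_bounds[OF \<tau>(1)] N in \<open>simp_all add: \<kappa>_def N_def\<close>)
    also have "\<dots> \<le> \<rho> * exp (- (\<kappa> * G \<tau>))"
    proof (intro mult_right_mono)
      have "15000 \<le> sqrt N" by (rule real_le_rsqrt) (use N in simp)
      then have "150 / sqrt N \<le> 150 / 15000" using N by (intro divide_left_mono) auto
      then have "3 / 100 \<le> 1 / 20 - 150 / sqrt N - 144 * \<kappa>" by (simp add: \<kappa>_def)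
      then have "\<kappa> * (3 / 100) / N \<le> \<kappa> * (1 / 20 - 150 / sqrt N - 144 * \<kappa>) / N"
        using N by (intro divide_right_mono mult_left_mono) (auto simp: \<kappa>_def)
      then show "1 - \<kappa> * (1 / 20 - 150 / sqrt N - 144 * \<kappa>) / N \<le> \<rho>" by (simp add: \<rho>_def \<kappa>_def)
    qed simp
    finally have 1: "step_mean n (\<lambda>\<tau>. exp (- (\<kappa> * G \<tau>))) \<tau> \<le> \<rho> * exp (- (\<kappa> * G \<tau>))" .
    have "step_mean n (\<lambda>\<tau>. \<eta> + \<rho> ^ j * ?F \<tau>) \<tau> = \<eta> + (\<rho> ^ j * exp (\<kappa> * Gm)) * step_mean n (\<lambda>\<tau>. exp (- (\<kappa> * G \<tau>))) \<tau>"
      unfolding step_mean_add step_mean_const[OF \<tau>(1) n2(1)] step_mean_cmult by simp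
    also have "\<dots> \<le> \<eta> + (\<rho> ^ j * exp (\<kappa> * Gm)) * (\<rho> * exp (- (\<kappa> * G \<tau>)))"
      using 1 \<rho> by (intro add_left_mono mult_left_mono) auto
    finally show "step_mean n (\<lambda>\<tau>. \<eta> + \<rho> ^ j * ?F \<tau>) \<tau> \<le> \<eta> + \<rho> ^ Suc j * ?F \<tau>" by (simp add: ac_simps)
  qed
  also have "\<dots> \<le> \<eta> + \<rho> ^ j * exp (1 / 14400 * (ln (K\<^sup>2 + 2 * N) - ln (2 * N) + 1 / 4))"
  proof (intro add_left_mono mult_left_mono)
    have "ln (2 * N) \<le> ln ((lead n \<sigma>)\<^sup>2 + 2 * N)" using N by (subst ln_le_cancel_iff) (auto simp: add_nonneg_pos)
    then have "Gm - G \<sigma> \<le> ln (K\<^sup>2 + 2 * N) - ln (2 * N) + 1 / 4" using pb(1)[OF \<sigma>] by (simp add: Gm_def)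
    then have "\<kappa> * (Gm - G \<sigma>) \<le> 1 / 14400 * (ln (K\<^sup>2 + 2 * N) - ln (2 * N) + 1 / 4)" by (simp add: \<kappa>_def)
    moreover have "?F \<sigma> = exp (\<kappa> * (Gm - G \<sigma>))" by (simp add: exp_add[symmetric] right_diff_distrib)
    ultimately show "?F \<sigma> \<le> exp (1 / 14400 * (ln (K\<^sup>2 + 2 * N) - ln (2 * N) + 1 / 4))" by simp
  qed (use \<rho> in simp)
  finally show ?thesis by (simp add: \<rho>_def N_def)
qed

text \<open>
For \<open>\<beta> = 2\<close> the terms in \<open>Z\<close> cancel and the drift is close to \<open>2 * growth_rate\<close>, whatever \<open>Z\<close> is, as
long as the lead is large against \<open>sqrt N\<close> and small against \<open>N\<close>.
\<close>

lemma lead_grows_drift: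
  fixes N D Z \<epsilon> :: real
  assumes N: "400 \<le> N" and \<epsilon>: "0 < \<epsilon>" and D: "32 / \<epsilon> * N \<le> D\<^sup>2" "D\<^sup>2 \<le> \<epsilon> / 2 * N\<^sup>2"
    and Z: "0 \<le> Z" "Z \<le> N" "\<bar>D\<bar> \<le> N - Z"
  defines "S \<equiv> D\<^sup>2 + 2 * N" and "Q \<equiv> N\<^sup>2 / 2 + N * Z + 5 / 2 * Z\<^sup>2 - D\<^sup>2 / 2 - 4 * Z"
  shows "(2 * growth_rate - \<epsilon> / 2) * N \<le>
    2 * D\<^sup>2 / S * Z + Q / S * (1 - 2 * D\<^sup>2 / S) + 2 * (growth_rate * N - Z) - 2 * D\<^sup>2 / (4 * N)"
proof -
  define \<theta> where "\<theta> = D\<^sup>2 / S"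
  have S: "0 < S" "32 / \<epsilon> * N \<le> S" using N D by (auto simp: S_def add_nonneg_pos)
  have \<theta>: "0 \<le> \<theta>" "\<theta> \<le> 1" using S N by (auto simp: \<theta>_def S_def)
  have inv: "1 / S \<le> \<epsilon> / (32 * N)"
  proof -
    have "0 < 32 / \<epsilon> * N" using N \<epsilon> by simp
    then have "1 / S \<le> 1 / (32 / \<epsilon> * N)" using S by (intro frac_le) auto
    then show ?thesis using \<epsilon> by simp
  qed
  have \<theta>1: "1 - \<theta> \<le> \<epsilon> / 16"
  proof -
    have "1 - \<theta> = 2 * N * (1 / S)" using S by (simp add: \<theta>_def field_simps) (simp add: S_def)
    also have "\<dots> \<le> 2 * N * (\<epsilon> / (32 * N))" using inv N by (intro mult_left_mono) auto
    finally show ?thesis using N by simp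
  qed
  have ZN: "Z\<^sup>2 \<le> N\<^sup>2" "N * Z \<le> N\<^sup>2" using Z N by (auto simp: power2_eq_square intro: mult_mono)
  have Q: "Q \<le> 4 * N\<^sup>2" unfolding Q_def using ZN Z(1) zero_le_power2[of D] by linarith
  have Q0: "- 4 * N\<^sup>2 \<le> Q"
  proof -
    have "D\<^sup>2 \<le> N\<^sup>2" using Z abs_le_square_iff[of D N] by simp
    moreover have "4 * N \<le> N * N" using N by (intro mult_right_mono) auto
    then have "4 * Z \<le> N * N" using Z by linarith
    moreover have "0 \<le> N * Z" using N Z by simp
    ultimately show ?thesis unfolding Q_def power2_eq_square using zero_le_square[of Z] zero_le_square[of N] by linarith
  qed
  have b1: "\<bar>Q / S * (1 - 2 * \<theta>)\<bar> \<le> \<epsilon> / 8 * N"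
  proof -
    have "\<bar>Q / S * (1 - 2 * \<theta>)\<bar> = \<bar>Q\<bar> * (1 / S) * \<bar>1 - 2 * \<theta>\<bar>" using S by (simp add: abs_mult)
    also have "\<dots> \<le> (4 * N\<^sup>2) * (\<epsilon> / (32 * N)) * 1"
      using Q Q0 inv \<theta> S \<epsilon> N by (intro mult_mono) auto
    also have "\<dots> = \<epsilon> / 8 * N" using N by (simp add: power2_eq_square)
    finally show ?thesis .
  qed
  have b2: "(1 - \<theta>) * Z \<le> \<epsilon> / 16 * N" using \<theta>1 Z \<theta> \<epsilon> by (intro mult_mono) auto
  have b3: "2 * D\<^sup>2 / (4 * N) \<le> \<epsilon> / 4 * N"
  proof -
    have "2 * D\<^sup>2 / (4 * N) \<le> 2 * (\<epsilon> / 2 * N\<^sup>2) / (4 * N)" using D N by (intro divide_right_mono mult_left_mono) auto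
    then show ?thesis using N by (simp add: power2_eq_square)
  qed
  have eqs: "2 * D\<^sup>2 / S * Z = 2 * (Z - (1 - \<theta>) * Z)" "Q / S * (1 - 2 * D\<^sup>2 / S) = Q / S * (1 - 2 * \<theta>)"
    "(2 * growth_rate - \<epsilon> / 2) * N = 2 * (growth_rate * N) - \<epsilon> / 2 * N"
    by (simp_all add: \<theta>_def algebra_simps)
  have "2 * G - \<epsilon> / 2 * N \<le> 2 * (Z - V) + R + 2 * (G - Z) - W"
    if "\<bar>R\<bar> \<le> \<epsilon> / 8 * N" "V \<le> \<epsilon> / 16 * N" "W \<le> \<epsilon> / 4 * N" for G R V W
    using that by (simp add: abs_le_iff)
  from this[OF b1 b2 b3] show ?thesis unfolding eqs .
qed

text \<open>
The second term bounds the probability that the lead falls back to order \<open>sqrt n\<close>, the third the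
probability that it grows too slowly.
\<close>

lemma survival_growth:
  fixes \<epsilon> \<eta> :: real
  assumes \<sigma>: "valid n \<sigma>" and n: "400 \<le> n" and \<epsilon>: "0 < \<epsilon>" "\<epsilon> \<le> 1 / 4" and small: "150 / sqrt (real n) \<le> \<epsilon> / 10"
    and last: "\<And>\<tau>. valid n \<tau> \<Longrightarrow> \<epsilon> / 2 * (real n)\<^sup>2 \<le> (lead n \<tau>)\<^sup>2 \<Longrightarrow> survival n k \<tau> \<le> \<eta>" and \<eta>: "0 \<le> \<eta>"
    and start: "lead n \<sigma> \<noteq> 0"
  shows "survival n (j + k) \<sigma> \<le> \<eta>
    + exp (\<epsilon> / 1440 * (ln ((32 / \<epsilon> + 2) * real n) + 1 - ln ((lead n \<sigma>)\<^sup>2)))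
    + (1 - \<epsilon> / 1440 * (2 * growth_rate - \<epsilon>) / real n) ^ j
      * exp (\<epsilon> / 1440 * (ln ((real n)\<^sup>2 + 2 * real n) + 1 - ln ((lead n \<sigma>)\<^sup>2)))"
proof -
  define N where "N = real n"
  have N: "400 \<le> N" using n by (simp add: N_def)
  have n2: "2 \<le> n" using n by auto
  define l0 where "l0 = ln ((sqrt 5 + 2) * N)"
  define G where "G \<tau> = potential 2 N (lead n \<tau>) (mixed n \<tau>)" for \<tau>
  \<comment> \<open>With \<open>144 \<kappa> = \<epsilon> / 10\<close> the errors fit into the gap between \<open>2 g - \<epsilon> / 2\<close> and \<open>2 g - \<epsilon>\<close>, \<open>g\<close> being the growth rate.\<close>
  define \<kappa> where "\<kappa> = \<epsilon> / 1440"
  \<comment> \<open>Upper bounds for the potential: \<open>g1\<close> below the region of growth, \<open>g2\<close> everywhere.\<close>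
  define g1 g2 where "g1 = ln ((32 / \<epsilon> + 2) * N) + 4 * l0 + 1" and "g2 = ln (N\<^sup>2 + 2 * N) + 4 * l0 + 1"
  define \<rho> where "\<rho> = 1 - \<kappa> * (2 * growth_rate - \<epsilon>) / N"
  have \<kappa>: "0 < \<kappa>" "\<kappa> \<le> 1" using \<epsilon> by (auto simp: \<kappa>_def)
  have gr: "0 < 2 * growth_rate - \<epsilon>" "2 * growth_rate - \<epsilon> \<le> 1" using sqrt5_bounds \<epsilon> by auto
  have \<rho>: "0 \<le> \<rho>" "\<rho> \<le> 1"
  proof -
    have "\<kappa> * (2 * growth_rate - \<epsilon>) \<le> 1 * 1" using \<kappa> gr by (intro mult_mono) auto
    then have "\<kappa> * (2 * growth_rate - \<epsilon>) / N \<le> 1" using N by (simp add: divide_le_eq)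
    then show "0 \<le> \<rho>" by (simp add: \<rho>_def)
    show "\<rho> \<le> 1" using \<kappa> gr N by (simp add: \<rho>_def)
  qed
  let ?f = "\<lambda>\<tau>. exp (- (\<kappa> * G \<tau>))"
  have pb: "ln ((lead n \<tau>)\<^sup>2 + 2 * N) + 4 * l0 \<le> G \<tau>" "G \<tau> \<le> ln ((lead n \<tau>)\<^sup>2 + 2 * N) + 4 * l0 + 1"
    if "valid n \<tau>" for \<tau>
    using potential_bounds[of N "mixed n \<tau>" 2 "lead n \<tau>"] state_bounds[OF that] N
    unfolding G_def l0_def N_def by auto
  have ef: "exp (\<kappa> * g) * ?f \<tau> = exp (\<kappa> * (g - G \<tau>))" for g \<tau>
    by (simp add: exp_add[symmetric] right_diff_distrib)
  have "survival n (j + k) \<sigma> \<le> \<eta> + exp (\<kappa> * g1) * ?f \<sigma> + \<rho> ^ j * exp (\<kappa> * g2) * ?f \<sigma>"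
  proof (rule survival_le_supersolution[where R="\<lambda>\<tau>. 32 / \<epsilon> * N \<le> (lead n \<tau>)\<^sup>2 \<and> (lead n \<tau>)\<^sup>2 \<le> \<epsilon> / 2 * N\<^sup>2"
      and w="\<lambda>j \<tau>. \<eta> + exp (\<kappa> * g1) * ?f \<tau> + \<rho> ^ j * exp (\<kappa> * g2) * ?f \<tau>", OF n2 \<sigma>])
    fix j \<tau> assume \<tau>: "valid n \<tau>" and R: "\<not> (32 / \<epsilon> * N \<le> (lead n \<tau>)\<^sup>2 \<and> (lead n \<tau>)\<^sup>2 \<le> \<epsilon> / 2 * N\<^sup>2)"
    have nn: "0 \<le> exp (\<kappa> * g1) * ?f \<tau>" "0 \<le> \<rho> ^ j * exp (\<kappa> * g2) * ?f \<tau>" using \<rho> by auto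
    show "survival n (j + k) \<tau> \<le> \<eta> + exp (\<kappa> * g1) * ?f \<tau> + \<rho> ^ j * exp (\<kappa> * g2) * ?f \<tau>"
    proof (cases "\<epsilon> / 2 * N\<^sup>2 \<le> (lead n \<tau>)\<^sup>2")
      case True
      then have "survival n (j + k) \<tau> \<le> \<eta>"
        using last[OF \<tau>] survival_antimono[OF \<tau> n2, of k "j + k"] unfolding N_def by fastforce
      then show ?thesis using nn by linarith
    next
      case False
      then have "(lead n \<tau>)\<^sup>2 + 2 * N \<le> (32 / \<epsilon> + 2) * N" using R by (simp add: distrib_right)
      then have "ln ((lead n \<tau>)\<^sup>2 + 2 * N) \<le> ln ((32 / \<epsilon> + 2) * N)"
        using N \<epsilon> by (subst ln_le_cancel_iff) (auto simp: add_nonneg_pos add_pos_pos)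
      then have "0 \<le> \<kappa> * (g1 - G \<tau>)" using pb(2)[OF \<tau>] \<kappa> by (simp add: g1_def)
      then have "1 \<le> exp (\<kappa> * g1) * ?f \<tau>" unfolding ef by simp
      then show ?thesis using survival_le_1[OF \<tau> n2, of "j + k"] nn \<eta> by linarith
    qed
  next
    fix \<tau> assume \<tau>: "valid n \<tau>"
    have "(lead n \<tau>)\<^sup>2 \<le> N\<^sup>2" using state_bounds(5)[OF \<tau>] abs_le_square_iff[of "lead n \<tau>" N] by (simp add: N_def)
    then have "ln ((lead n \<tau>)\<^sup>2 + 2 * N) \<le> ln (N\<^sup>2 + 2 * N)"
      using N by (subst ln_le_cancel_iff) (auto simp: add_nonneg_pos)
    then have "0 \<le> \<kappa> * (g2 - G \<tau>)" using pb(2)[OF \<tau>] \<kappa> by (simp add: g2_def)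
    then have "1 \<le> exp (\<kappa> * g2) * ?f \<tau>" unfolding ef by simp
    moreover have "0 \<le> exp (\<kappa> * g1) * ?f \<tau>" by simp
    ultimately show "survival n k \<tau> \<le> \<eta> + exp (\<kappa> * g1) * ?f \<tau> + \<rho> ^ 0 * exp (\<kappa> * g2) * ?f \<tau>"
      using survival_le_1[OF \<tau> n2, of k] \<eta> by (simp only: power_0 mult_1_left)
  next
    fix j \<tau> assume \<tau>: "valid n \<tau>" and R: "32 / \<epsilon> * N \<le> (lead n \<tau>)\<^sup>2 \<and> (lead n \<tau>)\<^sup>2 \<le> \<epsilon> / 2 * N\<^sup>2"
    have e0: "0 \<le> 2 * growth_rate - \<epsilon> / 2" using sqrt5_bounds \<epsilon> by simp
    have "step_mean n ?f \<tau> \<le> (1 - \<kappa> * ((2 * growth_rate - \<epsilon> / 2) - 150 / sqrt N - 144 * \<kappa>) / N) * ?f \<tau>"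
      unfolding G_def N_def
      by (rule step_mean_exp_potential[OF \<tau> n _ _ \<kappa> e0])
         (use lead_grows_drift[OF N \<epsilon>(1), of "lead n \<tau>" "mixed n \<tau>"] R state_bounds[OF \<tau>] in \<open>simp_all add: N_def\<close>)
    also have "\<dots> \<le> \<rho> * ?f \<tau>"
    proof (intro mult_right_mono)
      have "2 * growth_rate - \<epsilon> \<le> (2 * growth_rate - \<epsilon> / 2) - 150 / sqrt N - 144 * \<kappa>"
        using small \<epsilon> by (simp add: \<kappa>_def N_def)
      then have "\<kappa> * (2 * growth_rate - \<epsilon>) / N \<le> \<kappa> * ((2 * growth_rate - \<epsilon> / 2) - 150 / sqrt N - 144 * \<kappa>) / N"
        using N \<kappa> by (intro divide_right_mono mult_left_mono) auto
      then show "1 - \<kappa> * ((2 * growth_rate - \<epsilon> / 2) - 150 / sqrt N - 144 * \<kappa>) / N \<le> \<rho>" by (simp add: \<rho>_def)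
    qed simp
    finally have 1: "step_mean n ?f \<tau> \<le> \<rho> * ?f \<tau>" .
    have "step_mean n (\<lambda>\<tau>. \<eta> + exp (\<kappa> * g1) * ?f \<tau> + \<rho> ^ j * exp (\<kappa> * g2) * ?f \<tau>) \<tau> =
        \<eta> + exp (\<kappa> * g1) * step_mean n ?f \<tau> + \<rho> ^ j * exp (\<kappa> * g2) * step_mean n ?f \<tau>"
      unfolding step_mean_add step_mean_const[OF \<tau> n2] step_mean_cmult by simp
    also have "\<dots> \<le> \<eta> + exp (\<kappa> * g1) * (1 * ?f \<tau>) + \<rho> ^ j * exp (\<kappa> * g2) * (\<rho> * ?f \<tau>)"
    proof (intro add_mono order_refl mult_left_mono 1)
      have "\<rho> * ?f \<tau> \<le> 1 * ?f \<tau>" using \<rho> by (intro mult_right_mono) auto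
      then show "step_mean n ?f \<tau> \<le> 1 * ?f \<tau>" using 1 by linarith
    qed (use \<rho> in auto)
    finally show "step_mean n (\<lambda>\<tau>. \<eta> + exp (\<kappa> * g1) * ?f \<tau> + \<rho> ^ j * exp (\<kappa> * g2) * ?f \<tau>) \<tau> \<le>
        \<eta> + exp (\<kappa> * g1) * ?f \<tau> + \<rho> ^ Suc j * exp (\<kappa> * g2) * ?f \<tau>" by (simp add: ac_simps)
  qed
  also have "\<dots> \<le> \<eta> + exp (\<kappa> * (ln ((32 / \<epsilon> + 2) * N) + 1 - ln ((lead n \<sigma>)\<^sup>2)))
      + \<rho> ^ j * exp (\<kappa> * (ln (N\<^sup>2 + 2 * N) + 1 - ln ((lead n \<sigma>)\<^sup>2)))"
  proof -
    have "ln ((lead n \<sigma>)\<^sup>2) \<le> ln ((lead n \<sigma>)\<^sup>2 + 2 * N)" using N start by (subst ln_le_cancel_iff) (auto simp: add_nonneg_pos)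
    then have G: "ln ((lead n \<sigma>)\<^sup>2) + 4 * l0 \<le> G \<sigma>" using pb(1)[OF \<sigma>] by linarith
    have "exp (\<kappa> * g1) * ?f \<sigma> \<le> exp (\<kappa> * (ln ((32 / \<epsilon> + 2) * N) + 1 - ln ((lead n \<sigma>)\<^sup>2)))"
      unfolding ef using G \<kappa> by (simp add: g1_def)
    moreover have "exp (\<kappa> * g2) * ?f \<sigma> \<le> exp (\<kappa> * (ln (N\<^sup>2 + 2 * N) + 1 - ln ((lead n \<sigma>)\<^sup>2)))"
      unfolding ef using G \<kappa> by (simp add: g2_def)
    ultimately show ?thesis
      using \<rho> unfolding mult.assoc by (intro add_mono order_refl mult_left_mono) auto
  qed
  finally show ?thesis by (simp add: \<rho>_def N_def \<kappa>_def)
qed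

text \<open>
The square of the lead has to grow from \<open>n powr (1 + 2 \<delta>)\<close> to order \<open>n\<^sup>2\<close> at rate \<open>2 * growth_rate\<close>.
\<close>

lemma fast_consensus_mesoscopic_lead:
  assumes \<tau>: "1 + 1 / (2 * growth_rate) < \<tau>" and \<eta>: "0 < \<eta>" and \<delta>: "0 < \<delta>"
  shows "fast_consensus \<eta> \<tau> (\<lambda>n d. real n powr (1 / 2 + \<delta>) \<le> d)"
proof -
  define g where "g = growth_rate"
  have g: "0 < g" using sqrt5_bounds by (simp add: g_def)
  define \<xi> where "\<xi> = (\<tau> - 1 - 1 / (2 * g)) / 3"
  have \<xi>: "0 < \<xi>" using \<tau> by (simp add: \<xi>_def g_def)
  define t where "t = 1 / (2 * g) + \<xi>"
  have t: "0 < t" using g \<xi> by (simp add: t_def add_pos_pos)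
  \<comment> \<open>The surplus \<open>\<xi>\<close> of time pays for the loss \<open>\<epsilon>\<close> of the growth rate.\<close>
  define \<epsilon> where "\<epsilon> = min (1 / 4) (g * \<xi> / t)"
  have \<epsilon>0: "0 < \<epsilon>" using g \<xi> t by (simp add: \<epsilon>_def)
  have \<epsilon>4: "\<epsilon> \<le> 1 / 4" unfolding \<epsilon>_def by (rule min.cobounded1)
  note \<epsilon> = \<epsilon>0 \<epsilon>4
  have rate: "1 + g * \<xi> \<le> (2 * g - \<epsilon>) * t"
  proof -
    have "\<epsilon> \<le> g * \<xi> / t" by (simp add: \<epsilon>_def)
    then have "\<epsilon> * t \<le> g * \<xi>" using t by (simp add: pos_le_divide_eq)
    moreover have "2 * g * t = 1 + 2 * (g * \<xi>)" using g by (simp add: t_def field_simps)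
    ultimately show ?thesis unfolding left_diff_distrib by linarith
  qed
  define c where "c = sqrt (\<epsilon> / 2)"
  have c: "0 < c" "c\<^sup>2 = \<epsilon> / 2" using \<epsilon> by (auto simp: c_def)
  define \<kappa> where "\<kappa> = \<epsilon> / 1440"
  have \<kappa>: "0 < \<kappa>" "\<kappa> \<le> 1" using \<epsilon> by (auto simp: \<kappa>_def)
  define C1 where "C1 = ln (32 / \<epsilon> + 2) + 1"
  let ?err = "\<lambda>n. exp (\<kappa> * C1) * exp (- ((2 * \<delta> * \<kappa>) * ln (real n)))
     + exp (\<kappa> * (ln 3 + 1)) * exp (- ((\<kappa> * (2 * \<delta> + g * \<xi>)) * ln (real n)))"
  have last: "fast_consensus (\<eta> / 2) (1 + \<xi>) (\<lambda>n d. c * real n \<le> d)"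
    using \<xi> \<eta> c by (intro fast_consensus_macroscopic_lead) auto
  have small: "\<forall>\<^sub>F n in sequentially. 150 / sqrt (real n) \<le> \<epsilon> / 10"
  proof -
    have "(\<lambda>n. 150 / sqrt (real n)) \<longlonglongrightarrow> 0" by real_asymp
    from order_tendstoD(2)[OF this, of "\<epsilon> / 10"] show ?thesis
      using \<epsilon> by (auto elim: eventually_mono)
  qed
  show ?thesis
  proof (rule fast_consensus_compose[OF last, where err="?err" and t=t])
    show "?err \<longlonglongrightarrow> 0"
      using \<delta> \<kappa> g \<xi> by (intro tendsto_add_zero tendsto_mult_right_zero exp_neg_ln_tendsto_0 mult_pos_pos add_pos_pos) auto
    show "\<forall>\<^sub>F n in sequentially. \<forall>k. (\<forall>\<sigma>. valid n \<sigma> \<longrightarrow> c * real n \<le> \<bar>lead n \<sigma>\<bar> \<longrightarrow> survival n k \<sigma> \<le> \<eta> / 2) \<longrightarrow>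
        (\<forall>\<sigma> j. valid n \<sigma> \<longrightarrow> real n powr (1 / 2 + \<delta>) \<le> \<bar>lead n \<sigma>\<bar> \<longrightarrow> t * (real n * ln (real n)) \<le> real j \<longrightarrow>
           real j \<le> t * (real n * ln (real n)) + 1 \<longrightarrow> survival n (j + k) \<sigma> \<le> \<eta> / 2 + ?err n)"
      using eventually_ge_at_top[of 400] small
    proof (eventually_elim, intro allI impI)
      fix n k \<sigma> j
      assume n: "400 \<le> n" and small: "150 / sqrt (real n) \<le> \<epsilon> / 10"
        and k: "\<forall>\<sigma>. valid n \<sigma> \<longrightarrow> c * real n \<le> \<bar>lead n \<sigma>\<bar> \<longrightarrow> survival n k \<sigma> \<le> \<eta> / 2"
        and \<sigma>: "valid n \<sigma>" "real n powr (1 / 2 + \<delta>) \<le> \<bar>lead n \<sigma>\<bar>"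
        and j: "t * (real n * ln (real n)) \<le> real j"
      define l where "l = ln (real n)"
      have l: "0 \<le> l" using n by (simp add: l_def)
      have pw: "0 < real n powr (1 / 2 + \<delta>)" using n by simp
      then have D0: "lead n \<sigma> \<noteq> 0" using \<sigma>(2) by auto
      have D: "(1 + 2 * \<delta>) * l \<le> ln ((lead n \<sigma>)\<^sup>2)"
      proof -
        have "ln (real n powr (1 / 2 + \<delta>)) \<le> ln \<bar>lead n \<sigma>\<bar>"
          using \<sigma>(2) pw D0 by (subst ln_le_cancel_iff) auto
        then have "(1 / 2 + \<delta>) * l \<le> ln \<bar>lead n \<sigma>\<bar>" using n by (simp add: ln_powr l_def)
        moreover have "ln ((lead n \<sigma>)\<^sup>2) = 2 * ln \<bar>lead n \<sigma>\<bar>"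
          using D0 ln_realpow[of "\<bar>lead n \<sigma>\<bar>" 2] by simp
        ultimately show ?thesis by (simp add: algebra_simps)
      qed
      have "survival n (j + k) \<sigma> \<le> \<eta> / 2
        + exp (\<epsilon> / 1440 * (ln ((32 / \<epsilon> + 2) * real n) + 1 - ln ((lead n \<sigma>)\<^sup>2)))
        + (1 - \<epsilon> / 1440 * (2 * growth_rate - \<epsilon>) / real n) ^ j
          * exp (\<epsilon> / 1440 * (ln ((real n)\<^sup>2 + 2 * real n) + 1 - ln ((lead n \<sigma>)\<^sup>2)))"
      proof (rule survival_growth[OF \<sigma>(1) n \<epsilon> small _ _ D0])
        fix \<tau> assume \<tau>: "valid n \<tau>" "\<epsilon> / 2 * (real n)\<^sup>2 \<le> (lead n \<tau>)\<^sup>2"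
        then have "(c * real n)\<^sup>2 \<le> (lead n \<tau>)\<^sup>2" by (simp only: power_mult_distrib c(2))
        then have "\<bar>c * real n\<bar> \<le> \<bar>lead n \<tau>\<bar>" by (simp add: abs_le_square_iff)
        then show "survival n k \<tau> \<le> \<eta> / 2" using k \<tau>(1) c by (auto simp: abs_mult)
      qed (use \<eta> in simp)
      also have "\<dots> \<le> \<eta> / 2 + exp (\<kappa> * C1) * exp (- ((2 * \<delta> * \<kappa>) * l))
         + exp (\<kappa> * (ln 3 + 1)) * exp (- ((\<kappa> * (2 * \<delta> + g * \<xi>)) * l))"
      proof (intro add_mono order_refl)
        have "ln ((32 / \<epsilon> + 2) * real n) = ln (32 / \<epsilon> + 2) + l"
          using n \<epsilon> unfolding l_def by (intro ln_mult_pos) (auto simp: add_pos_pos)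
        then have "ln ((32 / \<epsilon> + 2) * real n) + 1 - ln ((lead n \<sigma>)\<^sup>2) \<le> C1 - 2 * \<delta> * l"
          using D by (simp add: C1_def algebra_simps)
        then have "\<kappa> * (ln ((32 / \<epsilon> + 2) * real n) + 1 - ln ((lead n \<sigma>)\<^sup>2)) \<le> \<kappa> * (C1 - 2 * \<delta> * l)"
          using \<kappa> by (intro mult_left_mono) auto
        also have "\<kappa> * (C1 - 2 * \<delta> * l) = \<kappa> * C1 + - ((2 * \<delta> * \<kappa>) * l)" by (simp add: algebra_simps)
        finally show "exp (\<epsilon> / 1440 * (ln ((32 / \<epsilon> + 2) * real n) + 1 - ln ((lead n \<sigma>)\<^sup>2)))
            \<le> exp (\<kappa> * C1) * exp (- ((2 * \<delta> * \<kappa>) * l))"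
          unfolding exp_add[symmetric] \<kappa>_def by simp
        have gr: "0 < 2 * g - \<epsilon>" "2 * g - \<epsilon> \<le> 1" using sqrt5_bounds \<epsilon> by (auto simp: g_def)
        have "\<kappa> * (2 * g - \<epsilon>) \<le> 1 * 1" using \<kappa> gr by (intro mult_mono) auto
        then have "\<kappa> * (2 * g - \<epsilon>) / real n \<le> 1" using n by (simp add: divide_le_eq)
        then have p1: "(1 - \<kappa> * (2 * g - \<epsilon>) / real n) ^ j \<le> exp (- (\<kappa> * (2 * g - \<epsilon>) / real n * real j))"
          by (rule one_minus_power_le_exp)
        have "\<kappa> * (2 * g - \<epsilon>) / real n * (t * (real n * l)) \<le> \<kappa> * (2 * g - \<epsilon>) / real n * real j"
          using j \<kappa> gr by (intro mult_left_mono) (auto simp: l_def)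
        then have "\<kappa> * ((2 * g - \<epsilon>) * t) * l \<le> \<kappa> * (2 * g - \<epsilon>) / real n * real j"
          using n by (simp add: ac_simps)
        moreover have "\<kappa> * (1 + g * \<xi>) * l \<le> \<kappa> * ((2 * g - \<epsilon>) * t) * l"
          using rate \<kappa> l by (intro mult_right_mono mult_left_mono) auto
        ultimately have "exp (- (\<kappa> * (2 * g - \<epsilon>) / real n * real j)) \<le> exp (- (\<kappa> * (1 + g * \<xi>) * l))" by simp
        with p1 have p: "(1 - \<kappa> * (2 * g - \<epsilon>) / real n) ^ j \<le> exp (- (\<kappa> * (1 + g * \<xi>) * l))"
          by (rule order_trans)
        have "ln ((real n)\<^sup>2 + 2 * real n) \<le> ln (3 * (real n)\<^sup>2)"
        proof (subst ln_le_cancel_iff)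
          have "real n * 1 \<le> real n * real n" using n by (intro mult_left_mono) auto
          then show "(real n)\<^sup>2 + 2 * real n \<le> 3 * (real n)\<^sup>2" by (simp add: power2_eq_square)
        qed (use n in \<open>auto simp: add_pos_pos\<close>)
        also have "\<dots> = ln 3 + 2 * l" using n by (simp add: ln_mult ln_realpow l_def)
        finally have "ln ((real n)\<^sup>2 + 2 * real n) + 1 - ln ((lead n \<sigma>)\<^sup>2) \<le> ln 3 + 1 + (l - 2 * \<delta> * l)"
          using D by (simp add: algebra_simps)
        then have "\<kappa> * (ln ((real n)\<^sup>2 + 2 * real n) + 1 - ln ((lead n \<sigma>)\<^sup>2)) \<le> \<kappa> * (ln 3 + 1 + (l - 2 * \<delta> * l))"
          using \<kappa> by (intro mult_left_mono) auto
        then have "exp (\<kappa> * (ln ((real n)\<^sup>2 + 2 * real n) + 1 - ln ((lead n \<sigma>)\<^sup>2))) \<le> exp (\<kappa> * (ln 3 + 1 + (l - 2 * \<delta> * l)))"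
          by simp
        with p have "(1 - \<kappa> * (2 * g - \<epsilon>) / real n) ^ j * exp (\<kappa> * (ln ((real n)\<^sup>2 + 2 * real n) + 1 - ln ((lead n \<sigma>)\<^sup>2)))
            \<le> exp (- (\<kappa> * (1 + g * \<xi>) * l)) * exp (\<kappa> * (ln 3 + 1 + (l - 2 * \<delta> * l)))"
          by (intro mult_mono) auto
        also have "\<dots> = exp (\<kappa> * (ln 3 + 1)) * exp (- ((\<kappa> * (2 * \<delta> + g * \<xi>)) * l))"
          unfolding exp_add[symmetric] by (simp add: algebra_simps)
        finally show "(1 - \<epsilon> / 1440 * (2 * growth_rate - \<epsilon>) / real n) ^ j
          * exp (\<epsilon> / 1440 * (ln ((real n)\<^sup>2 + 2 * real n) + 1 - ln ((lead n \<sigma>)\<^sup>2)))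
          \<le> exp (\<kappa> * (ln 3 + 1)) * exp (- ((\<kappa> * (2 * \<delta> + g * \<xi>)) * l))"
          unfolding \<kappa>_def g_def .
      qed
      finally show "survival n (j + k) \<sigma> \<le> \<eta> / 2 + ?err n" by (simp add: l_def)
    qed
  qed (use \<eta> t \<xi> in \<open>auto simp: t_def \<xi>_def field_simps\<close>)
qed

lemma fast_consensus_from_anywhere:
  assumes \<tau>: "1 + 1 / (2 * growth_rate) < \<tau>" and \<eta>: "0 < \<eta>"
  shows "fast_consensus \<eta> \<tau> (\<lambda>_ _. True)"
proof -
  define \<xi> where "\<xi> = (\<tau> - 1 - 1 / (2 * growth_rate)) / 3"
  have \<xi>: "0 < \<xi>" using \<tau> by (simp add: \<xi>_def)
  \<comment> \<open>The cost \<open>2 \<delta>\<close> in the exponent has to stay below the gain \<open>3 / 100 * \<xi>\<close>.\<close>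
  define \<delta> where "\<delta> = min (1 / 8) (\<xi> / 100)"
  have \<delta>: "0 < \<delta>" "\<delta> \<le> 1 / 8" "\<delta> \<le> \<xi> / 100" using \<xi> by (auto simp: \<delta>_def)
  have last: "fast_consensus (\<eta> / 2) (1 + 1 / (2 * growth_rate) + \<xi>) (\<lambda>n d. real n powr (1 / 2 + \<delta>) \<le> d)"
    using \<xi> \<eta> \<delta> by (intro fast_consensus_mesoscopic_lead) auto
  let ?err = "\<lambda>n. exp 1 * exp (- ((\<xi> / 1440000) * ln (real n)))"
  have big: "\<forall>\<^sub>F n in sequentially. real n powr (5 / 4) \<le> (real n)\<^sup>2 / 100" by real_asymp
  have gr: "0 < growth_rate" using sqrt5_bounds by simp
  show ?thesis
  proof (rule fast_consensus_compose[OF last, where err="?err" and t=\<xi>])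
    show "?err \<longlonglongrightarrow> 0" using \<xi> by (intro tendsto_mult_right_zero exp_neg_ln_tendsto_0) auto
    show "\<forall>\<^sub>F n in sequentially. \<forall>k. (\<forall>\<sigma>. valid n \<sigma> \<longrightarrow> real n powr (1 / 2 + \<delta>) \<le> \<bar>lead n \<sigma>\<bar> \<longrightarrow> survival n k \<sigma> \<le> \<eta> / 2) \<longrightarrow>
        (\<forall>\<sigma> j. valid n \<sigma> \<longrightarrow> True \<longrightarrow> \<xi> * (real n * ln (real n)) \<le> real j \<longrightarrow>
           real j \<le> \<xi> * (real n * ln (real n)) + 1 \<longrightarrow> survival n (j + k) \<sigma> \<le> \<eta> / 2 + ?err n)"
      using eventually_ge_at_top[of 225000000] big
    proof (eventually_elim, intro allI impI)
      fix n k \<sigma> j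
      assume n: "225000000 \<le> n" and big: "real n powr (5 / 4) \<le> (real n)\<^sup>2 / 100"
        and k: "\<forall>\<sigma>. valid n \<sigma> \<longrightarrow> real n powr (1 / 2 + \<delta>) \<le> \<bar>lead n \<sigma>\<bar> \<longrightarrow> survival n k \<sigma> \<le> \<eta> / 2"
        and \<sigma>: "valid n \<sigma>" and j: "\<xi> * (real n * ln (real n)) \<le> real j"
      define l where "l = ln (real n)"
      have n1: "1 \<le> real n" using n by simp
      have l: "0 \<le> l" using n1 by (simp add: l_def)
      let ?K = "real n powr (1 / 2 + \<delta>)"
      have K2: "?K\<^sup>2 = real n powr (1 + 2 * \<delta>)"
        by (simp add: power2_eq_square powr_add[symmetric])
      have "real n powr (1 + 2 * \<delta>) \<le> real n powr (5 / 4)" using n1 \<delta> by (intro powr_mono) auto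
      then have K: "?K\<^sup>2 \<le> (real n)\<^sup>2 / 100" using big K2 by simp
      have "survival n (j + k) \<sigma> \<le> \<eta> / 2 + (1 - 3 / 1440000 / real n) ^ j *
          exp (1 / 14400 * (ln (?K\<^sup>2 + 2 * real n) - ln (2 * real n) + 1 / 4))"
        using k \<eta> by (intro survival_escape[OF \<sigma> n _ K]) auto
      also have "\<dots> \<le> \<eta> / 2 + exp (- (3 / 1440000 * \<xi> * l)) * exp (1 / 14400 * (1 + 2 * \<delta> * l))"
      proof (intro add_left_mono mult_mono)
        have "(1 - 3 / 1440000 / real n) ^ j \<le> exp (- (3 / 1440000 / real n * real j))"
          using n1 by (intro one_minus_power_le_exp) (simp add: divide_le_eq)
        also have "3 / 1440000 / real n * (\<xi> * (real n * l)) \<le> 3 / 1440000 / real n * real j"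
          using j unfolding l_def by (intro mult_left_mono) auto
        then have "exp (- (3 / 1440000 / real n * real j)) \<le> exp (- (3 / 1440000 * \<xi> * l))"
          using n1 by simp
        finally show "(1 - 3 / 1440000 / real n) ^ j \<le> exp (- (3 / 1440000 * \<xi> * l))" .
        have "real n powr 1 \<le> real n powr (1 + 2 * \<delta>)" using n1 \<delta> by (intro powr_mono) auto
        then have "?K\<^sup>2 + 2 * real n \<le> 3 * real n powr (1 + 2 * \<delta>)" using n1 unfolding K2 by simp
        also have "real n powr (1 + 2 * \<delta>) = real n * real n powr (2 * \<delta>)" using n1 by (simp add: powr_add)
        finally have "?K\<^sup>2 + 2 * real n \<le> (2 * real n) * (3 / 2 * real n powr (2 * \<delta>))" by simp
        then have "ln (?K\<^sup>2 + 2 * real n) \<le> ln ((2 * real n) * (3 / 2 * real n powr (2 * \<delta>)))"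
          using n1 by (subst ln_le_cancel_iff) (auto simp: add_nonneg_pos)
        also have "\<dots> = ln (2 * real n) + (ln (3 / 2) + ln (real n powr (2 * \<delta>)))"
        proof -
          have "0 < real n powr (2 * \<delta>)" using n1 by simp
          then show ?thesis
            using n1 ln_mult_pos[of "2 * real n" "3 / 2 * real n powr (2 * \<delta>)"] ln_mult_pos[of "3 / 2" "real n powr (2 * \<delta>)"] by linarith
        qed
        also have "ln (real n powr (2 * \<delta>)) = 2 * \<delta> * l" using n1 by (simp add: ln_powr l_def)
        also have "ln (3 / 2 :: real) \<le> 1 / 2" using ln_add_one_self_le_self[of "1 / 2"] by simp
        finally show "exp (1 / 14400 * (ln (?K\<^sup>2 + 2 * real n) - ln (2 * real n) + 1 / 4)) \<le> exp (1 / 14400 * (1 + 2 * \<delta> * l))"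
          by simp
      qed (use n1 in \<open>auto simp: divide_le_eq\<close>)
      also have "\<dots> \<le> \<eta> / 2 + exp 1 * exp (- ((\<xi> / 1440000) * l))"
      proof -
        have "\<delta> * l \<le> \<xi> / 100 * l" using \<delta> l by (intro mult_right_mono) auto
        moreover have "- (3 / 1440000 * B) + 1 / 14400 * (1 + 2 * A) \<le> 1 + - (B / 1440000)"
          if "A \<le> B / 100" for A B :: real using that by (simp add: field_simps)
        from this[of "\<delta> * l" "\<xi> * l"]
        have "\<delta> * l \<le> \<xi> / 100 * l \<Longrightarrow> - (3 / 1440000 * \<xi> * l) + 1 / 14400 * (1 + 2 * \<delta> * l) \<le> 1 + - ((\<xi> / 1440000) * l)"
          by (simp only: mult.assoc times_divide_eq_left)
        ultimately have "- (3 / 1440000 * \<xi> * l) + 1 / 14400 * (1 + 2 * \<delta> * l) \<le> 1 + - ((\<xi> / 1440000) * l)" by blast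
        then show ?thesis unfolding exp_add[symmetric] by simp
      qed
      finally show "survival n (j + k) \<sigma> \<le> \<eta> / 2 + ?err n" by (simp add: l_def)
    qed
    define q where "q = 1 / (2 * growth_rate)"
    have "\<xi> = (\<tau> - 1 - q) / 3" by (simp only: q_def \<xi>_def)
    then have q: "0 \<le> q" "\<tau> = 1 + q + 3 * \<xi>" using gr by (simp_all add: q_def[symmetric]) (simp add: q_def)
    show "\<eta> / 2 < \<eta>" "0 \<le> \<xi>" using \<eta> \<xi> by simp_all
    show "0 \<le> 1 + 1 / (2 * growth_rate) + \<xi>" "\<xi> + (1 + 1 / (2 * growth_rate) + \<xi>) < \<tau>"
      unfolding q_def[symmetric] q(2) using q(1) \<xi> by simp_all
  qed
qed

section \<open>Lower bound for the survival probability\<close>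

text \<open>
The margin \<open>n - D\<close>, that is \<open>2 Y + Z\<close>, has drift at least \<open>- (n - D) / (n - 1)\<close>, and its variance is
also at most proportional to it, which is why an exponential of it is almost reproduced.
\<close>

lemma step_mean_exp_margin:
  fixes s \<epsilon> \<mu> :: real
  assumes \<sigma>: "valid n \<sigma>" and n: "2 \<le> n" and s: "s \<in> {1, -1}" and \<mu>: "0 < \<mu>" "7 * \<mu> \<le> \<epsilon>" "2 * \<mu> \<le> 1"
  shows "step_mean n (\<lambda>\<tau>. exp (- (\<mu> * (real n - s * lead n \<tau>)))) \<sigma>
    \<le> exp (- (\<mu> * (1 - (1 + \<epsilon>) / (real n - 1)) * (real n - s * lead n \<sigma>)))"
proof -
  define N D Z where "N = real n" and "D = s * lead n \<sigma>" and "Z = mixed n \<sigma>"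
  define W where "W = N - D"
  define F where "F = exp (- (\<mu> * W))"
  have N: "2 \<le> N" using n by (simp add: N_def)
  have "\<bar>D\<bar> = \<bar>lead n \<sigma>\<bar>" using s by (auto simp: D_def)
  then have st: "0 \<le> Z" "\<bar>D\<bar> \<le> N - Z" "Z \<le> N" "\<bar>D\<bar> \<le> N"
    using state_bounds[OF \<sigma>] by (auto simp: N_def Z_def)
  have W: "0 \<le> W" "Z \<le> W" using st by (auto simp: W_def)
  have DZ: "D * Z \<le> N * W"
  proof (cases "0 \<le> D")
    case True
    then show ?thesis using st W by (intro mult_mono) auto
  next
    case False
    then have "D * Z \<le> 0" using st by (intro mult_nonpos_nonneg) auto
    also have "0 \<le> N * W" using N W by simp
    finally show ?thesis .
  qed
  define Q where "Q = N\<^sup>2 / 2 + N * Z + 5 / 2 * Z\<^sup>2 - D\<^sup>2 / 2 - 4 * Z"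
  have Q: "Q \<le> 7 * (N * W)"
  proof -
    have "N\<^sup>2 - D\<^sup>2 = (N + D) * W" by (simp add: W_def power2_eq_square algebra_simps)
    also have "\<dots> \<le> (2 * N) * W" using st W by (intro mult_right_mono) auto
    finally have "N\<^sup>2 - D\<^sup>2 \<le> 2 * (N * W)" by simp
    moreover have "N * Z \<le> N * W" using N W by (intro mult_left_mono) auto
    moreover have "Z\<^sup>2 \<le> N * W" unfolding power2_eq_square using st W N by (intro mult_mono) auto
    moreover have "0 \<le> N * W" using N W by simp
    ultimately show ?thesis using st(1) unfolding Q_def by linarith
  qed
  have "step_mean n (\<lambda>\<tau>. (\<lambda>D Z. exp (- (\<mu> * (N - D)))) (s * lead n \<tau>) (mixed n \<tau>)) \<sigma> \<le> F
     + ((F * \<mu>) * (D * Z) + 0 * (N\<^sup>2 / 2 - 2 * N * Z - Z\<^sup>2 / 2 - D\<^sup>2 / 2 + 2 * Z) + (F * \<mu>\<^sup>2) * Q) / (N * (N - 1)) + 0"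
    unfolding F_def W_def Q_def N_def D_def Z_def
  proof (rule step_mean_le_linear[OF \<sigma> n s])
    fix a b :: real assume a: "\<bar>a\<bar> \<le> 2"
    let ?W = "real n - s * lead n \<sigma>"
    have "\<mu> * a \<le> \<mu> * 2" using a \<mu> by (intro mult_left_mono) auto
    then have "\<mu> * a \<le> 1" using \<mu> by linarith
    then have "exp (\<mu> * a) \<le> 1 + \<mu> * a + (\<mu> * a)\<^sup>2" by (rule exp_le_quadratic)
    then have "exp (- (\<mu> * ?W)) * (exp (\<mu> * a) - 1) \<le> exp (- (\<mu> * ?W)) * (\<mu> * a + (\<mu> * a)\<^sup>2)"
      by (intro mult_left_mono) auto
    moreover have "exp (- (\<mu> * (real n - (s * lead n \<sigma> + a)))) = exp (- (\<mu> * ?W)) * exp (\<mu> * a)"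
      unfolding exp_add[symmetric] by (simp add: algebra_simps)
    ultimately show "exp (- (\<mu> * (real n - (s * lead n \<sigma> + a)))) - exp (- (\<mu> * ?W)) \<le>
        exp (- (\<mu> * ?W)) * \<mu> * a + 0 * b + exp (- (\<mu> * ?W)) * \<mu>\<^sup>2 * a\<^sup>2 + 0"
      by (simp add: algebra_simps power_mult_distrib)
  qed simp
  also have "\<dots> \<le> F + F * (\<mu> * (1 + \<epsilon>) * (N * W)) / (N * (N - 1))"
  proof -
    have F: "0 < F" by (simp add: F_def)
    have "\<mu> * (D * Z) + \<mu>\<^sup>2 * Q \<le> \<mu> * (N * W) + \<mu>\<^sup>2 * (7 * (N * W))"
      using DZ Q \<mu> by (intro add_mono mult_left_mono) auto
    also have "\<mu>\<^sup>2 * (7 * (N * W)) = \<mu> * ((7 * \<mu>) * (N * W))" by (simp add: power2_eq_square)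
    also have "\<dots> \<le> \<mu> * (\<epsilon> * (N * W))" using \<mu> N W by (intro mult_left_mono mult_right_mono) auto
    finally have "\<mu> * (D * Z) + \<mu>\<^sup>2 * Q \<le> \<mu> * (1 + \<epsilon>) * (N * W)" by (simp add: algebra_simps)
    then have "F * (\<mu> * (D * Z) + \<mu>\<^sup>2 * Q) \<le> F * (\<mu> * (1 + \<epsilon>) * (N * W))" using F by (intro mult_left_mono) auto
    then have "(F * (\<mu> * (D * Z) + \<mu>\<^sup>2 * Q)) / (N * (N - 1)) \<le> F * (\<mu> * (1 + \<epsilon>) * (N * W)) / (N * (N - 1))"
      using N by (intro divide_right_mono) auto
    then show ?thesis by (simp add: algebra_simps)
  qed
  also have "\<dots> = F * (1 + \<mu> * ((1 + \<epsilon>) / (N - 1)) * W)"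
  proof -
    have "F * (\<mu> * (1 + \<epsilon>) * (N * W)) / (N * (N - 1)) = F * (\<mu> * ((1 + \<epsilon>) / (N - 1)) * W)" using N by simp
    then show ?thesis by (simp only: distrib_left mult_1_right)
  qed
  also have "\<dots> \<le> F * exp (\<mu> * ((1 + \<epsilon>) / (N - 1)) * W)"
    using exp_ge_add_one_self by (intro mult_left_mono) (auto simp: F_def)
  also have "\<dots> = exp (- (\<mu> * (1 - (1 + \<epsilon>) / (N - 1)) * W))"
    unfolding F_def exp_add[symmetric] by (simp add: algebra_simps)
  finally show ?thesis by (simp add: N_def D_def W_def)
qed

lemma step_mean_diff: "step_mean n (\<lambda>\<tau>. f \<tau> - h \<tau>) \<sigma> = step_mean n f \<sigma> - step_mean n h \<sigma>"
  by (simp add: step_mean_def sum_subtractf diff_divide_distrib)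

lemma survival_ge_margin:
  fixes \<epsilon> \<mu> :: real
  assumes \<sigma>: "valid n \<sigma>" and n: "2 \<le> n" and \<mu>: "0 < \<mu>" "7 * \<mu> \<le> \<epsilon>" "2 * \<mu> \<le> 1" and \<epsilon>: "1 + \<epsilon> < real n - 1"
  shows "1 - survival n k \<sigma> \<le> 2 * exp (- (\<mu> * (1 - (1 + \<epsilon>) / (real n - 1)) ^ k * (real n - \<bar>lead n \<sigma>\<bar>)))"
proof -
  define r where "r = 1 - (1 + \<epsilon>) / (real n - 1)"
  have r: "0 < r" "r \<le> 1" using \<epsilon> \<mu> by (auto simp: r_def)
  let ?e = "\<lambda>k s \<tau>. exp (- (\<mu> * r ^ k * (real n - s * lead n \<tau>)))"
  have "1 - survival n k \<sigma> \<le> ?e k 1 \<sigma> + ?e k (-1) \<sigma>"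
    using \<sigma>
  proof (induction k arbitrary: \<sigma>)
    case (0 \<sigma>)
    show ?case
    proof (cases "consensus n \<sigma>")
      case True
      then have "\<bar>lead n \<sigma>\<bar> = real n" using consensus_lead(3)[OF 0] by simp
      then have "?e 0 1 \<sigma> = 1 \<or> ?e 0 (-1) \<sigma> = 1" by (auto simp: abs_if split: if_splits)
      moreover have "0 < ?e 0 1 \<sigma>" "0 < ?e 0 (-1) \<sigma>" by simp_all
      ultimately show ?thesis using True by (auto simp: survival_0 simp del: exp_gt_zero)
    qed (simp add: survival_0)
  next
    case (Suc k \<sigma>)
    have rate: "0 < \<mu> * r ^ k" "\<mu> * r ^ k \<le> \<mu>"
      using r \<mu> by (auto intro!: mult_left_le power_le_one)
    have "1 - survival n (Suc k) \<sigma> = step_mean n (\<lambda>\<tau>. 1 - survival n k \<tau>) \<sigma>"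
      unfolding step_mean_diff step_mean_const[OF Suc.prems n] survival_Suc ..
    also have "\<dots> \<le> step_mean n (\<lambda>\<tau>. ?e k 1 \<tau> + ?e k (-1) \<tau>) \<sigma>"
      by (intro step_mean_mono Suc)
    also have "\<dots> = step_mean n (?e k 1) \<sigma> + step_mean n (?e k (-1)) \<sigma>" by (rule step_mean_add)
    also have "\<dots> \<le> exp (- (\<mu> * r ^ k * r * (real n - 1 * lead n \<sigma>))) + exp (- (\<mu> * r ^ k * r * (real n - (-1) * lead n \<sigma>)))"
      unfolding r_def[symmetric]
      using step_mean_exp_margin[OF Suc.prems n, of 1 "\<mu> * r ^ k" \<epsilon>]
        step_mean_exp_margin[OF Suc.prems n, of "-1" "\<mu> * r ^ k" \<epsilon>] rate \<mu>
      unfolding r_def[symmetric] by (intro add_mono) auto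
    finally show ?case by (simp add: ac_simps)
  qed
  also have "?e k s \<sigma> \<le> exp (- (\<mu> * r ^ k * (real n - \<bar>lead n \<sigma>\<bar>)))" if "s \<in> {1, -1}" for s
  proof -
    have "real n - \<bar>lead n \<sigma>\<bar> \<le> real n - s * lead n \<sigma>" using that by auto
    then show ?thesis using r \<mu> by (simp add: mult_left_mono)
  qed
  from add_mono[OF this[of 1] this[of "-1"]]
  have "?e k 1 \<sigma> + ?e k (-1) \<sigma> \<le> 2 * exp (- (\<mu> * r ^ k * (real n - \<bar>lead n \<sigma>\<bar>)))" by simp
  finally show ?thesis by (simp add: r_def)
qed

text \<open>
The exponential of the potential with \<open>\<beta> = 2\<close>, scaled, and without regularisation because only
an upper bound on its growth is wanted.
\<close>

definition weighted_lead_square :: "real \<Rightarrow> real \<Rightarrow> real \<Rightarrow> real" where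
  "weighted_lead_square N D Z = D\<^sup>2 * (Z / N + (sqrt 5 + 2)) ^ 4"

lemma weighted_lead_square_increment:
  fixes N D Z a b :: real
  assumes N: "2 \<le> N" and D: "\<bar>D\<bar> \<le> N" and Z: "0 \<le> Z" "Z \<le> N" and ab: "\<bar>a\<bar> \<le> 2" "\<bar>b\<bar> \<le> 2"
  defines "\<zeta> \<equiv> Z / N + (sqrt 5 + 2)"
  shows "weighted_lead_square N (D + a) (Z + b) - weighted_lead_square N D Z
    \<le> 2 * D * \<zeta> ^ 4 * a + 4 * D\<^sup>2 * \<zeta> ^ 3 / N * b + 22000"
proof -
  define h where "h = b / N"
  have \<zeta>: "4 \<le> \<zeta>" "\<zeta> \<le> 6"
  proof -
    have "0 \<le> Z / N" "Z / N \<le> 1" using Z N by (auto simp: divide_le_eq)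
    then show "4 \<le> \<zeta>" "\<zeta> \<le> 6" using sqrt5_bounds by (auto simp: \<zeta>_def)
  qed
  have h: "\<bar>h\<bar> \<le> 2 / N" "\<bar>h\<bar> \<le> 1"
  proof -
    show 1: "\<bar>h\<bar> \<le> 2 / N" unfolding h_def abs_divide using ab N by (intro frac_le) auto
    have "2 / N \<le> 1" using N by simp
    then show "\<bar>h\<bar> \<le> 1" using 1 by linarith
  qed
  define R where "R = 6 * \<zeta>\<^sup>2 * h\<^sup>2 + 4 * \<zeta> * h ^ 3 + h ^ 4"
  have expand: "(\<zeta> + h) ^ 4 = \<zeta> ^ 4 + 4 * \<zeta> ^ 3 * h + R"
    by (simp add: R_def power2_eq_square power3_eq_cube power4_eq_xxxx algebra_simps)
  have h2: "h\<^sup>2 \<le> 4 / N\<^sup>2"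
    using power_mono[OF h(1), of 2] N by (simp add: power_divide)
  have R: "\<bar>R\<bar> \<le> 241 * h\<^sup>2"
  proof -
    have "\<zeta>\<^sup>2 \<le> 6\<^sup>2" using \<zeta> by (intro power_mono) auto
    then have "6 * \<zeta>\<^sup>2 * h\<^sup>2 \<le> 216 * h\<^sup>2" by (intro mult_right_mono) auto
    moreover have "\<bar>4 * \<zeta> * h ^ 3\<bar> \<le> 24 * h\<^sup>2"
    proof -
      have "\<bar>4 * \<zeta> * h ^ 3\<bar> = 4 * \<zeta> * (\<bar>h\<bar> * h\<^sup>2)" using \<zeta> by (simp add: abs_mult power3_eq_cube power2_eq_square)
      also have "\<dots> \<le> 24 * (1 * h\<^sup>2)" using \<zeta> h by (intro mult_mono) auto
      finally show ?thesis by simp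
    qed
    moreover have "h ^ 4 \<le> h\<^sup>2"
    proof -
      have "h\<^sup>2 \<le> 1" using h(2) abs_le_square_iff[of h 1] by simp
      then have "h\<^sup>2 * h\<^sup>2 \<le> 1 * h\<^sup>2" by (intro mult_right_mono) auto
      then show ?thesis by (simp add: power4_eq_xxxx power2_eq_square)
    qed
    moreover have "0 \<le> 6 * \<zeta>\<^sup>2 * h\<^sup>2" "0 \<le> h ^ 4" by auto
    ultimately show ?thesis unfolding R_def by linarith
  qed
  have RN: "\<bar>R\<bar> \<le> 964 / N\<^sup>2" using R h2 by linarith
  have D2: "D\<^sup>2 \<le> N\<^sup>2" using D abs_le_square_iff[of D N] by simp
  have t1: "D\<^sup>2 * R \<le> 964"
  proof -
    have "D\<^sup>2 * R \<le> D\<^sup>2 * \<bar>R\<bar>" by (intro mult_left_mono) auto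
    also have "\<dots> \<le> N\<^sup>2 * (964 / N\<^sup>2)" using D2 RN by (intro mult_mono) auto
    finally show ?thesis using N by simp
  qed
  have t2: "2 * D * a * (4 * \<zeta> ^ 3 * h + R) \<le> 10768"
  proof -
    have "\<zeta> ^ 3 \<le> 6 ^ 3" using \<zeta> by (intro power_mono) auto
    then have "4 * \<zeta> ^ 3 * \<bar>h\<bar> \<le> 864 * (2 / N)" using h \<zeta> by (intro mult_mono) auto
    moreover have "964 / N\<^sup>2 \<le> 964 / N" using N by (simp add: power2_eq_square divide_le_eq field_simps)
    ultimately have x: "\<bar>4 * \<zeta> ^ 3 * h + R\<bar> \<le> 2692 / N"
      using RN abs_triangle_ineq[of "4 * \<zeta> ^ 3 * h" R] \<zeta> by (simp add: abs_mult)
    have "2 * D * a * (4 * \<zeta> ^ 3 * h + R) \<le> \<bar>2 * D * a\<bar> * \<bar>4 * \<zeta> ^ 3 * h + R\<bar>" by (simp add: abs_mult[symmetric])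
    also have "\<dots> \<le> (2 * N * 2) * (2692 / N)"
    proof (rule mult_mono[OF _ x])
      have "\<bar>D\<bar> * \<bar>a\<bar> \<le> N * 2" using D ab N by (intro mult_mono) auto
      then show "\<bar>2 * D * a\<bar> \<le> 2 * N * 2" by (simp add: abs_mult)
    qed (use N in auto)
    also have "\<dots> = 10768" using N by simp
    finally show ?thesis .
  qed
  have t3: "a\<^sup>2 * (\<zeta> + h) ^ 4 \<le> 9604"
  proof -
    have "a\<^sup>2 \<le> 4" using ab(1) abs_le_square_iff[of a 2] by simp
    moreover have "(\<zeta> + h) ^ 4 \<le> 7 ^ 4" using \<zeta> h by (intro power_mono) auto
    ultimately have "a\<^sup>2 * (\<zeta> + h) ^ 4 \<le> 4 * 7 ^ 4" by (intro mult_mono) auto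
    then show ?thesis by simp
  qed
  have "weighted_lead_square N (D + a) (Z + b) - weighted_lead_square N D Z = (D + a)\<^sup>2 * (\<zeta> + h) ^ 4 - D\<^sup>2 * \<zeta> ^ 4"
    by (simp add: weighted_lead_square_def \<zeta>_def h_def add_divide_distrib algebra_simps)
  also have "\<dots> = D\<^sup>2 * ((\<zeta> + h) ^ 4 - \<zeta> ^ 4) + 2 * D * a * (\<zeta> + h) ^ 4 + a\<^sup>2 * (\<zeta> + h) ^ 4"
    by (simp add: power2_eq_square algebra_simps)
  also have "\<dots> = D\<^sup>2 * (4 * \<zeta> ^ 3 * h) + D\<^sup>2 * R + 2 * D * \<zeta> ^ 4 * a + 2 * D * a * (4 * \<zeta> ^ 3 * h + R) + a\<^sup>2 * (\<zeta> + h) ^ 4"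
    unfolding expand by (simp add: algebra_simps)
  also have "D\<^sup>2 * (4 * \<zeta> ^ 3 * h) = 4 * D\<^sup>2 * \<zeta> ^ 3 / N * b" by (simp add: h_def)
  finally show ?thesis using t1 t2 t3 by linarith
qed

text \<open>
The growth rate holds for every configuration, as the neglected terms in \<open>D\<close> have the right sign.
The additive constant is the noise.
\<close>

lemma step_mean_weighted_lead_square:
  assumes \<sigma>: "valid n \<sigma>" and n: "2 \<le> n"
  defines "V \<equiv> \<lambda>\<tau>. weighted_lead_square (real n) (lead n \<tau>) (mixed n \<tau>)"
  shows "step_mean n V \<sigma> \<le> (1 + 2 * growth_rate / (real n - 1)) * V \<sigma> + 26000"
proof -
  define N D Z where "N = real n" and "D = lead n \<sigma>" and "Z = mixed n \<sigma>"
  define \<zeta> where "\<zeta> = Z / N + (sqrt 5 + 2)"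
  have N: "2 \<le> N" using n by (simp add: N_def)
  have st: "0 \<le> Z" "Z \<le> N" "\<bar>D\<bar> \<le> N" using state_bounds[OF \<sigma>] by (auto simp: N_def D_def Z_def)
  have \<zeta>: "4 \<le> \<zeta>" "\<zeta> \<le> 6"
  proof -
    have "0 \<le> Z / N" "Z / N \<le> 1" using st N by (auto simp: divide_le_eq)
    then show "4 \<le> \<zeta>" "\<zeta> \<le> 6" using sqrt5_bounds by (auto simp: \<zeta>_def)
  qed
  have V: "V \<sigma> = D\<^sup>2 * \<zeta> ^ 4" by (simp add: V_def weighted_lead_square_def N_def D_def Z_def \<zeta>_def)
  define B where "B = N\<^sup>2 / 2 - 2 * N * Z - Z\<^sup>2 / 2 - D\<^sup>2 / 2 + 2 * Z"
  have B: "B \<le> (growth_rate * N - Z) * (N * \<zeta>) / 2 + 2 * Z"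
  proof -
    have "sqrt 5 * (sqrt 5 * x) = 5 * x" for x :: real
      by (simp only: mult.assoc[symmetric] real_sqrt_mult_self abs_numeral)
    moreover have "N * \<zeta> = Z + (sqrt 5 + 2) * N" using N by (simp add: \<zeta>_def distrib_left mult.commute)
    ultimately have "(growth_rate * N - Z) * (N * \<zeta>) = N\<^sup>2 - 4 * N * Z - Z\<^sup>2"
      by (simp add: field_simps power2_eq_square)
    then show ?thesis unfolding B_def using zero_le_power2[of D] by linarith
  qed
  have D2: "D\<^sup>2 \<le> N\<^sup>2" using st abs_le_square_iff[of D N] by simp
  have "step_mean n (\<lambda>\<tau>. weighted_lead_square (real n) (1 * lead n \<tau>) (mixed n \<tau>)) \<sigma> \<le>
      weighted_lead_square N (1 * lead n \<sigma>) Z + ((2 * D * \<zeta> ^ 4) * (1 * lead n \<sigma> * Z) + (4 * D\<^sup>2 * \<zeta> ^ 3 / N) *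
        (N\<^sup>2 / 2 - 2 * N * Z - Z\<^sup>2 / 2 - (1 * lead n \<sigma>)\<^sup>2 / 2 + 2 * Z)
       + 0 * (N\<^sup>2 / 2 + N * Z + 5 / 2 * Z\<^sup>2 - (1 * lead n \<sigma>)\<^sup>2 / 2 - 4 * Z)) / (N * (N - 1)) + 22000"
    unfolding N_def Z_def
    by (rule step_mean_le_linear[OF \<sigma> n])
       (use weighted_lead_square_increment[OF N st(3,1,2)] in \<open>simp_all add: N_def D_def Z_def \<zeta>_def\<close>)
  then have "step_mean n V \<sigma> \<le> V \<sigma> + ((2 * D * \<zeta> ^ 4) * (D * Z) + (4 * D\<^sup>2 * \<zeta> ^ 3 / N) * B) / (N * (N - 1)) + 22000"
    by (simp add: V_def D_def Z_def N_def B_def)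
  also have "((2 * D * \<zeta> ^ 4) * (D * Z) + (4 * D\<^sup>2 * \<zeta> ^ 3 / N) * B) / (N * (N - 1)) \<le>
      (2 * growth_rate * N * V \<sigma> + 1728 * N\<^sup>2) / (N * (N - 1))"
  proof (rule divide_right_mono)
    have "(4 * D\<^sup>2 * \<zeta> ^ 3 / N) * B \<le> (4 * D\<^sup>2 * \<zeta> ^ 3 / N) * ((growth_rate * N - Z) * (N * \<zeta>) / 2 + 2 * Z)"
      using B \<zeta> N by (intro mult_left_mono) auto
    also have "\<dots> = 2 * (growth_rate * N - Z) * (D\<^sup>2 * \<zeta> ^ 4) + 8 * D\<^sup>2 * \<zeta> ^ 3 * (Z / N)"
    proof -
      have "(4 * D\<^sup>2 * c3 / N) * (w * (N * z) / 2 + 2 * Z) = 2 * w * (D\<^sup>2 * (c3 * z)) + 8 * D\<^sup>2 * c3 * (Z / N)" for c3 w z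
        using N by (simp add: field_simps)
      note this[of "\<zeta> ^ 3" "growth_rate * N - Z" \<zeta>]
      moreover have "\<zeta> ^ 3 * \<zeta> = \<zeta> ^ 4" by (simp add: power3_eq_cube power4_eq_xxxx)
      ultimately show ?thesis by (simp only:)
    qed
    also have "8 * D\<^sup>2 * \<zeta> ^ 3 * (Z / N) \<le> 8 * N\<^sup>2 * 6 ^ 3 * 1"
    proof (intro mult_mono D2)
      show "\<zeta> ^ 3 \<le> 6 ^ 3" using \<zeta> by (intro power_mono) auto
      show "Z / N \<le> 1" using st N by (simp add: divide_le_eq)
    qed (use \<zeta> st N in auto)
    finally have "(4 * D\<^sup>2 * \<zeta> ^ 3 / N) * B \<le> 2 * (growth_rate * N - Z) * V \<sigma> + 1728 * N\<^sup>2" by (simp add: V)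
    moreover have "(2 * D * \<zeta> ^ 4) * (D * Z) = 2 * Z * V \<sigma>" by (simp add: V power2_eq_square)
    moreover have "2 * (growth_rate * N - Z) * V \<sigma> = 2 * growth_rate * N * V \<sigma> - 2 * Z * V \<sigma>"
      by (simp add: algebra_simps)
    ultimately show "(2 * D * \<zeta> ^ 4) * (D * Z) + (4 * D\<^sup>2 * \<zeta> ^ 3 / N) * B \<le> 2 * growth_rate * N * V \<sigma> + 1728 * N\<^sup>2"
      by linarith
  qed (use N in simp)
  also have "\<dots> \<le> 2 * growth_rate / (N - 1) * V \<sigma> + 3456"
  proof -
    have "2 * growth_rate * N * V \<sigma> / (N * (N - 1)) = 2 * growth_rate / (N - 1) * V \<sigma>" using N by simp
    moreover have "1728 * N\<^sup>2 / (N * (N - 1)) \<le> 3456" using N by (simp add: power2_eq_square divide_le_eq)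
    ultimately show ?thesis by (simp add: add_divide_distrib)
  qed
  finally show ?thesis by (simp add: N_def distrib_right)
qed

text \<open>
A lead beyond \<open>n / 2\<close> is controlled by Markov's inequality, where \<open>z + sqrt 5 + 2 \<ge> 4\<close> yields
the factor \<open>4 / 4 ^ 4 = 1 / 64\<close>.
\<close>

lemma survival_ge_balanced:
  assumes \<sigma>: "valid n \<sigma>" and n: "2 \<le> n" and \<eta>: "0 \<le> \<eta>"
    and last: "\<And>\<tau>. valid n \<tau> \<Longrightarrow> \<bar>lead n \<tau>\<bar> \<le> real n / 2 \<Longrightarrow> 1 - survival n k \<tau> \<le> \<eta>"
  shows "1 - survival n (j + k) \<sigma> \<le> \<eta> + 1 / (64 * (real n)\<^sup>2) * ((1 + 2 * growth_rate / (real n - 1)) ^ j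
      * (weighted_lead_square (real n) (lead n \<sigma>) (mixed n \<sigma>) + 26000 * real j))"
  using \<sigma>
proof (induction j arbitrary: \<sigma>)
  case (0 \<sigma>)
  have V0: "0 \<le> weighted_lead_square (real n) (lead n \<sigma>) (mixed n \<sigma>)" by (simp add: weighted_lead_square_def)
  show ?case
  proof (cases "\<bar>lead n \<sigma>\<bar> \<le> real n / 2")
    case True
    have "0 \<le> 1 / (64 * (real n)\<^sup>2) * weighted_lead_square (real n) (lead n \<sigma>) (mixed n \<sigma>)" using V0 by simp
    then show ?thesis using last[OF 0 True] by simp
  next
    case False
    then have "(real n / 2)\<^sup>2 \<le> (lead n \<sigma>)\<^sup>2" using abs_le_square_iff[of "real n / 2" "lead n \<sigma>"] by simp
    moreover have "4 ^ 4 \<le> (mixed n \<sigma> / real n + (sqrt 5 + 2)) ^ 4"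
      using sqrt5_bounds state_bounds[OF 0] n by (intro power_mono) (auto intro: add_increasing)
    ultimately have "(real n / 2)\<^sup>2 * 4 ^ 4 \<le> weighted_lead_square (real n) (lead n \<sigma>) (mixed n \<sigma>)"
      unfolding weighted_lead_square_def by (intro mult_mono) auto
    then have "1 \<le> 1 / (64 * (real n)\<^sup>2) * weighted_lead_square (real n) (lead n \<sigma>) (mixed n \<sigma>)"
      using n by (simp add: power_divide field_simps)
    then show ?thesis using survival_nonneg[of n k \<sigma>] \<eta> by simp
  qed
next
  case (Suc j \<sigma>)
  define q where "q = 1 + 2 * growth_rate / (real n - 1)"
  define A where "A = 1 / (64 * (real n)\<^sup>2)"
  define V where "V \<tau> = weighted_lead_square (real n) (lead n \<tau>) (mixed n \<tau>)" for \<tau>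
  have q: "1 \<le> q" using sqrt5_bounds n by (simp add: q_def)
  have A: "0 \<le> A" by (simp add: A_def)
  have "1 - survival n (Suc j + k) \<sigma> = step_mean n (\<lambda>\<tau>. 1 - survival n (j + k) \<tau>) \<sigma>"
    unfolding step_mean_diff step_mean_const[OF Suc.prems n] by (simp add: survival_Suc)
  also have "\<dots> \<le> step_mean n (\<lambda>\<tau>. (\<eta> + A * q ^ j * (26000 * real j)) + (A * q ^ j) * V \<tau>) \<sigma>"
    using Suc.IH by (intro step_mean_mono Suc.prems) (simp add: q_def A_def V_def algebra_simps)
  also have "\<dots> = (\<eta> + A * q ^ j * (26000 * real j)) + (A * q ^ j) * step_mean n V \<sigma>"
    unfolding step_mean_add step_mean_const[OF Suc.prems n] step_mean_cmult ..
  also have "\<dots> \<le> (\<eta> + A * q ^ j * (26000 * real j)) + (A * q ^ j) * (q * V \<sigma> + 26000)"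
    using step_mean_weighted_lead_square[OF Suc.prems n] A q unfolding V_def q_def
    by (intro add_left_mono mult_left_mono) auto
  also have "\<dots> = \<eta> + A * (q ^ Suc j * V \<sigma> + q ^ j * (26000 * real (Suc j)))" by (simp add: algebra_simps)
  also have "\<dots> \<le> \<eta> + A * (q ^ Suc j * V \<sigma> + q ^ Suc j * (26000 * real (Suc j)))"
    using A q by (intro add_left_mono mult_left_mono mult_right_mono power_increasing) auto
  finally show ?case by (simp only: q_def A_def V_def distrib_left)
qed

text \<open>
The steps are divided into a time slightly below \<open>1 / (2 g) ln n\<close>, in which the lead stays below
\<open>n / 2\<close>, and a time slightly below \<open>ln n\<close>, in which the minority survives.
\<close>

lemma slow_consensus:
  assumes \<tau>: "\<tau> < 1 + 1 / (2 * growth_rate)" and \<eta>: "0 < \<eta>"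
  shows "\<forall>\<^sub>F n in sequentially. \<forall>\<sigma> k. valid n \<sigma> \<longrightarrow> lead n \<sigma> = 0 \<longrightarrow>
    real k \<le> \<tau> * (real n * ln (real n)) \<longrightarrow> 1 - \<eta> \<le> survival n k \<sigma>"
proof -
  define g where "g = growth_rate"
  have g: "0 < g" "g \<le> 1 / 4" using sqrt5_bounds by (auto simp: g_def)
  define q where "q = 1 / (2 * g)"
  have q: "2 \<le> q" "2 * g * q = 1" using g by (auto simp: q_def field_simps)
  have \<tau>q: "\<tau> < 1 + q" using \<tau> by (simp add: q_def g_def)
  define \<xi> where "\<xi> = min (1 / 2) ((1 + q - \<tau>) / 3)"
  have \<xi>0: "0 < \<xi>" using \<tau>q by (simp add: \<xi>_def)
  have \<xi>1: "\<xi> \<le> 1 / 2" "\<xi> \<le> (1 + q - \<tau>) / 3" unfolding \<xi>_def by (rule min.cobounded1 min.cobounded2)+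
  define t1 t2 where "t1 = q - \<xi>" and "t2 = 1 - \<xi>"
  have t: "0 < t1" "0 < t2" using q \<xi>0 \<xi>1 by (auto simp: t1_def t2_def)
  define \<epsilon> \<mu> where "\<epsilon> = \<xi> / 2" and "\<mu> = \<epsilon> / 7"
  have \<epsilon>: "0 < \<epsilon>" "\<epsilon> \<le> 1 / 4" using \<xi>0 \<xi>1 by (auto simp: \<epsilon>_def)
  have \<mu>: "0 < \<mu>" "7 * \<mu> \<le> \<epsilon>" "2 * \<mu> \<le> 1" using \<epsilon> by (auto simp: \<mu>_def)
  let ?x = "\<lambda>n. (1 + \<epsilon>) / (real n - 1)"
  have e1: "\<forall>\<^sub>F n in sequentially. real n * (?x n + 2 * (?x n)\<^sup>2) < 1 + 2 * \<epsilon>"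
  proof -
    have "(\<lambda>n. real n * (?x n + 2 * (?x n)\<^sup>2)) \<longlonglongrightarrow> 1 + \<epsilon>" using \<epsilon> by real_asymp
    then show ?thesis using \<epsilon> by (intro order_tendstoD(2)) auto
  qed
  have e2: "\<forall>\<^sub>F n in sequentially. 2 * exp (- (\<mu> / 2 * exp (\<xi>\<^sup>2 * ln (real n)))) < \<eta> / 2"
  proof -
    have "filterlim (\<lambda>n. \<xi>\<^sup>2 * ln (real n)) at_top sequentially"
      using \<xi>0 by (intro filterlim_tendsto_pos_mult_at_top[OF tendsto_const] filterlim_compose[OF ln_at_top filterlim_real_sequentially]) auto
    then have "filterlim (\<lambda>n. \<mu> / 2 * exp (\<xi>\<^sup>2 * ln (real n))) at_top sequentially"
      using \<mu> by (intro filterlim_tendsto_pos_mult_at_top[OF tendsto_const _ filterlim_compose[OF exp_at_top]]) simp_all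
    then have "(\<lambda>n. exp (- (\<mu> / 2 * exp (\<xi>\<^sup>2 * ln (real n))))) \<longlonglongrightarrow> 0"
      by (intro filterlim_compose[OF exp_at_bot]) (simp add: filterlim_uminus_at_bot)
    from order_tendstoD(2)[OF tendsto_mult_right_zero[OF this, of 2], of "\<eta> / 2"] show ?thesis
      using \<eta> by simp
  qed
  have e3: "\<forall>\<^sub>F n in sequentially. real n / (real n - 1) < 1 + g * \<xi>"
  proof -
    have "(\<lambda>n. real n / (real n - 1)) \<longlonglongrightarrow> 1" by real_asymp
    then show ?thesis using g \<xi>0 by (intro order_tendstoD(2)) auto
  qed
  have e4: "\<forall>\<^sub>F n in sequentially. 26000 / 64 * t1 * (ln (real n) * exp (- (g * \<xi> * ln (real n)))) < \<eta> / 2"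
  proof -
    define c where "c = g * \<xi>"
    have "0 < c" using g \<xi>0 by (simp add: c_def)
    then have "(\<lambda>n. ln (real n) * exp (- (c * ln (real n)))) \<longlonglongrightarrow> 0" by real_asymp
    from order_tendstoD(2)[OF tendsto_mult_right_zero[OF this, of "26000 / 64 * t1"], of "\<eta> / 2"] show ?thesis
      using \<eta> unfolding c_def by simp
  qed
  have e5: "\<forall>\<^sub>F n in sequentially. 2 / \<xi> \<le> real n * ln (real n)"
    using filterlim_n_ln_n by (simp add: filterlim_at_top)
  show ?thesis
    using e1 e2 e3 e4 e5 eventually_ge_at_top[of 10]
  proof eventually_elim
    case (elim n)
    define N l where "N = real n" and "l = real n * ln (real n)"
    have N: "10 \<le> N" using elim(6) by (simp add: N_def)
    have n2: "2 \<le> n" using elim(6) by simp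
    have lnN: "0 \<le> ln N" using N by simp
    have l: "l = N * ln N" by (simp add: l_def N_def)
    have l0: "0 \<le> l" unfolding l using N lnN by simp
    define k1 k2 where "k1 = nat \<lfloor>t1 * l\<rfloor>" and "k2 = nat \<lfloor>t2 * l\<rfloor>"
    have k1: "real k1 \<le> t1 * l" "t1 * l \<le> real k1 + 1" and k2: "real k2 \<le> t2 * l" "t2 * l \<le> real k2 + 1"
      using t l0 by (auto simp: k1_def k2_def mult_nonneg_nonneg)
    define x where "x = (1 + \<epsilon>) / (N - 1)"
    have x: "0 < x" "x \<le> 1 / 2"
    proof -
      show "0 < x" using N \<epsilon> by (simp add: x_def)
      have "1 + \<epsilon> \<le> 1 / 2 * (N - 1)" using N \<epsilon> by simp
      then show "x \<le> 1 / 2" using N by (simp add: x_def pos_divide_le_eq)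
    qed
    have r: "exp (\<xi>\<^sup>2 * ln N) \<le> (1 - x) ^ k2 * N"
    proof -
      have "\<bar>ln (1 + (- x)) - (- x)\<bar> \<le> 2 * (- x)\<^sup>2"
        using x by (intro abs_ln_one_plus_x_minus_x_bound) auto
      then have "- (x + 2 * x\<^sup>2) \<le> ln (1 - x)" by (simp add: abs_le_iff)
      then have "real k2 * - (x + 2 * x\<^sup>2) \<le> real k2 * ln (1 - x)" by (intro mult_left_mono) auto
      moreover have "real k2 * (x + 2 * x\<^sup>2) \<le> (1 - \<xi>\<^sup>2) * ln N"
      proof -
        have "real k2 * (x + 2 * x\<^sup>2) \<le> (t2 * l) * (x + 2 * x\<^sup>2)" using k2 x by (intro mult_right_mono) auto
        also have "\<dots> = t2 * ln N * (N * (x + 2 * x\<^sup>2))" by (simp add: l)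
        also have "\<dots> \<le> t2 * ln N * (1 + 2 * \<epsilon>)"
          using elim(1) t lnN by (intro mult_left_mono) (auto simp: x_def N_def)
        also have "\<dots> = (1 - \<xi>\<^sup>2) * ln N" by (simp add: t2_def \<epsilon>_def power2_eq_square algebra_simps)
        finally show ?thesis .
      qed
      ultimately have "\<xi>\<^sup>2 * ln N \<le> real k2 * ln (1 - x) + ln N" by (simp add: algebra_simps)
      then have "exp (\<xi>\<^sup>2 * ln N) \<le> exp (real k2 * ln (1 - x) + ln N)" by simp
      also have "\<dots> = (1 - x) ^ k2 * N" using x N by (simp add: exp_add exp_of_nat_mult)
      finally show ?thesis .
    qed
    have last: "1 - survival n k2 \<tau> \<le> \<eta> / 2" if \<tau>: "valid n \<tau>" and d: "\<bar>lead n \<tau>\<bar> \<le> real n / 2" for \<tau>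
    proof -
      have "1 - survival n k2 \<tau> \<le> 2 * exp (- (\<mu> * (1 - (1 + \<epsilon>) / (real n - 1)) ^ k2 * (real n - \<bar>lead n \<tau>\<bar>)))"
        using N \<epsilon> by (intro survival_ge_margin[OF \<tau> n2 \<mu>]) (auto simp: N_def)
      also have "\<dots> \<le> 2 * exp (- (\<mu> / 2 * exp (\<xi>\<^sup>2 * ln (real n))))"
      proof -
        have "\<mu> / 2 * exp (\<xi>\<^sup>2 * ln N) \<le> \<mu> / 2 * ((1 - x) ^ k2 * N)" using r \<mu> by (intro mult_left_mono) auto
        also have "\<dots> = \<mu> * (1 - x) ^ k2 * (N / 2)" by simp
        also have "\<dots> \<le> \<mu> * (1 - x) ^ k2 * (N - \<bar>lead n \<tau>\<bar>)" using d \<mu> x by (intro mult_left_mono) (auto simp: N_def)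
        finally show ?thesis by (simp add: N_def x_def)
      qed
      finally show ?thesis using elim(2) by linarith
    qed
    show ?case
    proof (intro allI impI)
      fix \<sigma> k assume \<sigma>: "valid n \<sigma>" "lead n \<sigma> = 0" and k: "real k \<le> \<tau> * (real n * ln (real n))"
      have "2 \<le> \<xi> * l" using elim(5) \<xi>0 by (simp add: l_def divide_le_eq mult.commute)
      also have "\<xi> * l \<le> (t1 + t2 - \<tau>) * l" using \<xi>1 l0 by (intro mult_right_mono) (auto simp: t1_def t2_def field_simps)
      finally have "\<tau> * l + 2 \<le> t1 * l + t2 * l" by (simp add: algebra_simps)
      then have kk: "k \<le> k1 + k2" using k k1 k2 unfolding l_def[symmetric] by linarith
      have "1 - survival n (k1 + k2) \<sigma> \<le> \<eta> / 2 + 1 / (64 * (real n)\<^sup>2) * ((1 + 2 * growth_rate / (real n - 1)) ^ k1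
          * (weighted_lead_square (real n) (lead n \<sigma>) (mixed n \<sigma>) + 26000 * real k1))"
        using \<eta> last by (intro survival_ge_balanced[OF \<sigma>(1) n2]) auto
      also have "\<dots> = \<eta> / 2 + 1 / (64 * N\<^sup>2) * ((1 + 2 * g / (N - 1)) ^ k1 * (26000 * real k1))"
        using \<sigma>(2) by (simp add: weighted_lead_square_def N_def g_def)
      also have "\<dots> \<le> \<eta> / 2 + 1 / (64 * N\<^sup>2) * ((N * exp (- (g * \<xi> * ln N))) * (26000 * (t1 * l)))"
      proof (intro add_left_mono mult_left_mono mult_mono)
        have p: "0 \<le> 2 * g / (N - 1)" using g N by simp
        have "(1 + 2 * g / (N - 1)) ^ k1 \<le> exp (2 * g / (N - 1)) ^ k1" using p by (intro power_mono) auto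
        also have "\<dots> = exp (2 * g / (N - 1) * real k1)" by (simp add: exp_of_nat_mult[symmetric] mult.commute)
        also have "2 * g / (N - 1) * real k1 \<le> 2 * g / (N - 1) * (t1 * l)" using p k1 by (intro mult_left_mono)
        also have "2 * g / (N - 1) * (t1 * l) = (2 * g * t1 * ln N) * (N / (N - 1))" by (simp add: l)
        also have "\<dots> \<le> (2 * g * t1 * ln N) * (1 + g * \<xi>)"
          using elim(3) g t lnN by (intro mult_left_mono) (auto simp: N_def)
        also have "\<dots> = (1 - 2 * (g * \<xi>)) * (1 + g * \<xi>) * ln N"
        proof -
          have "2 * g * t1 = 1 - 2 * (g * \<xi>)" using q(2) by (simp add: t1_def algebra_simps)
          then show ?thesis by (simp only: ac_simps)
        qed
        also have "\<dots> \<le> (1 - g * \<xi>) * ln N"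
        proof (rule mult_right_mono)
          have "0 \<le> (g * \<xi>) * (g * \<xi>)" by simp
          then show "(1 - 2 * (g * \<xi>)) * (1 + g * \<xi>) \<le> 1 - g * \<xi>" by (simp add: algebra_simps)
        qed (rule lnN)
        also have "exp ((1 - g * \<xi>) * ln N) = N * exp (- (g * \<xi> * ln N))"
        proof -
          have "exp ((1 - g * \<xi>) * ln N) = exp (ln N) * exp (- (g * \<xi> * ln N))"
            unfolding exp_add[symmetric] by (simp add: algebra_simps)
          then show ?thesis using N by simp
        qed
        finally show "(1 + 2 * g / (N - 1)) ^ k1 \<le> N * exp (- (g * \<xi> * ln N))" by simp
      qed (use N k1 in auto)
      also have "\<dots> = \<eta> / 2 + 26000 / 64 * t1 * (ln N * exp (- (g * \<xi> * ln N)))"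
        using N by (simp add: l power2_eq_square)
      also have "\<dots> \<le> \<eta>" using elim(4) by (simp add: N_def)
      finally have "1 - \<eta> \<le> survival n (k1 + k2) \<sigma>" by simp
      also have "\<dots> \<le> survival n k \<sigma>" using \<sigma>(1) n2 kk by (rule survival_antimono)
      finally show "1 - \<eta> \<le> survival n k \<sigma>" .
    qed
  qed
qed

section \<open>The Poisson number of rings\<close>

definition poisson_weight :: "real \<Rightarrow> nat \<Rightarrow> real" where
  "poisson_weight r k = exp (- r) * r ^ k / fact k"

lemma poisson_weight_nonneg: "0 \<le> r \<Longrightarrow> 0 \<le> poisson_weight r k"
  by (simp add: poisson_weight_def)

lemma sum_power_fact_le_exp:
  fixes x :: real
  assumes "0 \<le> x" "finite A"
  shows "(\<Sum>k\<in>A. x ^ k / fact k) \<le> exp x"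
proof -
  have s: "(\<lambda>k. x ^ k / fact k) sums exp x"
    using exp_converges[of x] by (simp add: divide_inverse mult.commute)
  then have "(\<Sum>k\<in>A. x ^ k / fact k) \<le> (\<Sum>k. x ^ k / fact k)"
    using assms by (intro sum_le_suminf) (auto simp: sums_iff)
  then show ?thesis using s by (simp add: sums_iff)
qed

lemma poisson_chernoff:
  fixes r \<theta> c :: real
  assumes r: "0 \<le> r" and A: "finite A" and \<theta>: "\<And>k. k \<in> A \<Longrightarrow> \<theta> * c \<le> \<theta> * real k"
  shows "(\<Sum>k\<in>A. poisson_weight r k) \<le> exp (r * (exp \<theta> - 1) - \<theta> * c)"
proof -
  have "(\<Sum>k\<in>A. poisson_weight r k) \<le> (\<Sum>k\<in>A. exp (- r - \<theta> * c) * ((r * exp \<theta>) ^ k / fact k))"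
  proof (rule sum_mono)
    fix k assume "k \<in> A"
    then have "1 \<le> exp (\<theta> * real k - \<theta> * c)" using \<theta> by simp
    then have "poisson_weight r k * 1 \<le> poisson_weight r k * exp (\<theta> * real k - \<theta> * c)"
      using poisson_weight_nonneg[OF r] by (intro mult_left_mono) auto
    also have "\<dots> = exp (- r - \<theta> * c) * ((r * exp \<theta>) ^ k / fact k)"
      by (simp add: poisson_weight_def exp_diff exp_minus power_mult_distrib exp_of_nat_mult[symmetric] field_simps)
    finally show "poisson_weight r k \<le> exp (- r - \<theta> * c) * ((r * exp \<theta>) ^ k / fact k)" by simp
  qed
  also have "\<dots> = exp (- r - \<theta> * c) * (\<Sum>k\<in>A. (r * exp \<theta>) ^ k / fact k)" by (simp add: sum_distrib_left)
  also have "\<dots> \<le> exp (- r - \<theta> * c) * exp (r * exp \<theta>)"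
    using r A by (intro mult_left_mono sum_power_fact_le_exp) auto
  also have "\<dots> = exp (r * (exp \<theta> - 1) - \<theta> * c)" unfolding exp_add[symmetric] by (simp add: algebra_simps)
  finally show ?thesis .
qed

lemma poisson_deviation:
  fixes r \<delta> :: real
  assumes r: "0 \<le> r" and A: "finite A" and \<delta>: "0 < \<delta>" "\<delta> \<le> 1"
    and far: "(\<forall>k\<in>A. real k \<le> (1 - \<delta>) * r) \<or> (\<forall>k\<in>A. (1 + \<delta>) * r \<le> real k)"
  shows "(\<Sum>k\<in>A. poisson_weight r k) \<le> exp (- (\<delta>\<^sup>2 / 4 * r))"
proof -
  have "(\<Sum>k\<in>A. poisson_weight r k) \<le> exp (r * (exp (s * \<delta> / 2) - 1) - s * \<delta> / 2 * ((1 + s * \<delta>) * r))"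
    if "s = 1 \<and> (\<forall>k\<in>A. (1 + \<delta>) * r \<le> real k) \<or> s = -1 \<and> (\<forall>k\<in>A. real k \<le> (1 - \<delta>) * r)" for s
  proof (rule poisson_chernoff[OF r A])
    fix k assume k: "k \<in> A"
    show "s * \<delta> / 2 * ((1 + s * \<delta>) * r) \<le> s * \<delta> / 2 * real k"
      using that
    proof
      assume "s = 1 \<and> (\<forall>k\<in>A. (1 + \<delta>) * r \<le> real k)"
      then show ?thesis using k \<delta> by (intro mult_left_mono) auto
    next
      assume "s = -1 \<and> (\<forall>k\<in>A. real k \<le> (1 - \<delta>) * r)"
      then show ?thesis using k \<delta> by (intro mult_left_mono_neg) auto
    qed
  qed
  moreover have "exp (r * (exp (s * \<delta> / 2) - 1) - s * \<delta> / 2 * ((1 + s * \<delta>) * r)) \<le> exp (- (\<delta>\<^sup>2 / 4 * r))"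
    if s: "s = 1 \<or> s = -1" for s
  proof -
    have ss: "s * s = 1" using s by auto
    have "exp (s * \<delta> / 2) \<le> 1 + s * \<delta> / 2 + (s * \<delta> / 2)\<^sup>2" using s \<delta> by (intro exp_le_quadratic) auto
    also have "(s * \<delta> / 2)\<^sup>2 = \<delta>\<^sup>2 / 4" using ss by (simp add: power2_eq_square)
    finally have "r * (exp (s * \<delta> / 2) - 1) \<le> r * (s * \<delta> / 2 + \<delta>\<^sup>2 / 4)" using r by (intro mult_left_mono) auto
    moreover have "s * \<delta> / 2 * ((1 + s * \<delta>) * r) = r * (s * \<delta> / 2) + r * (\<delta>\<^sup>2 / 2)"
    proof -
      have "s * \<delta> / 2 * ((1 + s * \<delta>) * r) = r * (s * \<delta> / 2) + r * ((s * s) * \<delta>\<^sup>2 / 2)"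
        by (simp add: power2_eq_square algebra_simps)
      then show ?thesis by (simp add: ss)
    qed
    ultimately have "r * (exp (s * \<delta> / 2) - 1) - s * \<delta> / 2 * ((1 + s * \<delta>) * r)
        \<le> r * (s * \<delta> / 2 + \<delta>\<^sup>2 / 4) - (r * (s * \<delta> / 2) + r * (\<delta>\<^sup>2 / 2))" by linarith
    also have "\<dots> = - (\<delta>\<^sup>2 / 4 * r)" by (simp add: algebra_simps)
    finally show ?thesis by (simp only: exp_le_cancel_iff)
  qed
  ultimately show ?thesis using far order_trans by blast
qed

lemma poisson_weight_sum_tendsto:
  "(\<lambda>m. \<Sum>k\<le>m. poisson_weight r k) \<longlonglongrightarrow> 1"
proof -
  have "(\<lambda>k. r ^ k / fact k) sums exp r"
    using exp_converges[of r] by (simp add: divide_inverse mult.commute)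
  then have "(\<lambda>k. exp (- r) * (r ^ k / fact k)) sums (exp (- r) * exp r)" by (rule sums_mult)
  then have "poisson_weight r sums 1" by (simp add: poisson_weight_def[abs_def] exp_minus)
  then show ?thesis by (simp add: sums_def_le)
qed

section \<open>The consensus time\<close>

lemma initial_config_valid: "valid n (initial_config X Y)"
  by (auto simp: valid_def initial_config_def)

lemma initial_config_lead:
  assumes "X + Y + Z = n" shows "lead n (initial_config X Y) = real X - real Y"
  using type_counts_initial_config[OF assms] lead_mixed_number_of(1)[OF initial_config_valid[of n X Y]]
  by (simp add: type_counts_def number_of_def)

lemma step_mean_power_consensus:
  assumes "valid n \<sigma>" "2 \<le> n"
  shows "(step_mean n ^^ k) (indicator {\<sigma>. consensus n \<sigma>}) \<sigma> = 1 - survival n k \<sigma>"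
  using assms(1)
proof (induction k arbitrary: \<sigma>)
  case (Suc k)
  have "step_mean n ((step_mean n ^^ k) (indicator {\<sigma>. consensus n \<sigma>})) \<sigma> = step_mean n (\<lambda>\<tau>. 1 - survival n k \<tau>) \<sigma>"
    using Suc by (intro antisym step_mean_mono) auto
  then show ?case
    using Suc.prems by (simp add: step_mean_diff step_mean_const[OF _ assms(2)] survival_Suc)
qed (simp add: survival_0 indicator_def)

abbreviation late_probability :: "real \<Rightarrow> nat \<Rightarrow> nat \<Rightarrow> nat \<Rightarrow> real" where
  "late_probability c n X Y \<equiv>
     \<P>(\<omega> in naming_space n. consensus_time n X Y \<omega> / ereal (ln (real n)) > ereal c)"

lemma late_probability_upper:
  assumes n: "2 \<le> n" and c: "0 < c" and \<delta>: "0 < \<delta>" "\<delta> \<le> 1" and \<eta>: "0 \<le> \<eta>"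
    and surv: "\<And>k. (1 - \<delta>) * (c * (real n * ln (real n))) \<le> real k \<Longrightarrow> survival n k (initial_config X Y) \<le> \<eta>"
  shows "late_probability c n X Y \<le> \<eta> + exp (- (\<delta>\<^sup>2 / 4 * (c * (real n * ln (real n)))))"
proof -
  define r where "r = real n * (c * ln (real n))"
  have r: "0 \<le> r" "r = c * (real n * ln (real n))" using n c by (simp_all add: r_def)
  define A where "A m = {k. k \<le> m \<and> real k < (1 - \<delta>) * r}" for m
  have bound: "late_probability c n X Y \<le> 1 - (1 - \<eta>) * (\<Sum>k\<le>m. poisson_weight r k) + exp (- (\<delta>\<^sup>2 / 4 * r))" if "\<eta> \<le> 1" for m
  proof -
    have fin: "finite (A m)" by (rule finite_subset[of _ "{..m}"]) (auto simp: A_def)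
    have tail: "(\<Sum>k\<in>A m. poisson_weight r k) \<le> exp (- (\<delta>\<^sup>2 / 4 * r))"
      by (rule poisson_deviation[OF r(1) fin \<delta>]) (auto simp: A_def)
    have "(1 - \<eta>) * (\<Sum>k\<le>m. poisson_weight r k) = (1 - \<eta>) * (\<Sum>k\<in>{..m} - A m. poisson_weight r k) + (1 - \<eta>) * (\<Sum>k\<in>A m. poisson_weight r k)"
      by (subst sum.subset_diff[of "A m" "{..m}"]) (auto simp: A_def distrib_left)
    also have "(1 - \<eta>) * (\<Sum>k\<in>A m. poisson_weight r k) \<le> 1 * exp (- (\<delta>\<^sup>2 / 4 * r))"
      using tail \<eta> that poisson_weight_nonneg[OF r(1)] by (intro mult_mono sum_nonneg) auto
    also have "(1 - \<eta>) * (\<Sum>k\<in>{..m} - A m. poisson_weight r k) \<le> (\<Sum>k\<in>{..m} - A m. poisson_weight r k * (1 - survival n k (initial_config X Y)))"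
      unfolding sum_distrib_left
    proof (rule sum_mono)
      fix k assume "k \<in> {..m} - A m"
      then have "survival n k (initial_config X Y) \<le> \<eta>" using surv r(2) by (auto simp: A_def)
      then show "(1 - \<eta>) * poisson_weight r k \<le> poisson_weight r k * (1 - survival n k (initial_config X Y))"
        unfolding mult.commute[of "1 - \<eta>"] using poisson_weight_nonneg[OF r(1)] by (intro mult_left_mono) auto
    qed
    also have "\<dots> \<le> (\<Sum>k\<le>m. poisson_weight r k * (1 - survival n k (initial_config X Y)))"
      using survival_le_1[OF initial_config_valid n] poisson_weight_nonneg[OF r(1)]
      by (intro sum_mono2) auto
    also have "\<dots> = (\<Sum>k\<le>m. exp (- (real n * (c * ln (real n)))) * (real n * (c * ln (real n))) ^ k / fact k *
        (step_mean n ^^ k) (indicator {\<sigma>. consensus n \<sigma>}) (initial_config X Y))"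
      by (simp add: step_mean_power_consensus[OF initial_config_valid n] poisson_weight_def r_def)
    finally show ?thesis
      using prob_consensus_time_gt_le[OF n, of "c * ln (real n)" c X Y m] c n by simp
  qed
  show ?thesis
  proof (cases "\<eta> \<le> 1")
    case True
    have "(\<lambda>m. 1 - (1 - \<eta>) * (\<Sum>k\<le>m. poisson_weight r k) + exp (- (\<delta>\<^sup>2 / 4 * r))) \<longlonglongrightarrow> 1 - (1 - \<eta>) * 1 + exp (- (\<delta>\<^sup>2 / 4 * r))"
      by (intro tendsto_intros poisson_weight_sum_tendsto)
    then have "late_probability c n X Y \<le> 1 - (1 - \<eta>) * 1 + exp (- (\<delta>\<^sup>2 / 4 * r))"
      by (rule LIMSEQ_le_const) (use bound[OF True] in auto)
    then show ?thesis by (simp add: r)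
  next
    case False
    have "late_probability c n X Y \<le> 1"
      using prob_space.prob_le_1[OF prob_space_naming_space] .
    then show ?thesis using False by (simp add: add_increasing2)
  qed
qed

lemma late_probability_lower:
  assumes n: "2 \<le> n" and c: "c < c'" "0 < c'" and \<delta>: "0 < \<delta>" "\<delta> \<le> 1" and \<eta>: "0 \<le> \<eta>" "\<eta> \<le> 1"
    and surv: "\<And>k. real k \<le> (1 + \<delta>) * (c' * (real n * ln (real n))) \<Longrightarrow> 1 - \<eta> \<le> survival n k (initial_config X Y)"
  shows "1 - \<eta> - exp (- (\<delta>\<^sup>2 / 4 * (c' * (real n * ln (real n))))) \<le> late_probability c n X Y"
proof -
  define r where "r = real n * (c' * ln (real n))"
  have r: "0 \<le> r" "r = c' * (real n * ln (real n))" using n c by (simp_all add: r_def)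
  define A where "A m = {k. k \<le> m \<and> (1 + \<delta>) * r < real k}" for m
  have bound: "(1 - \<eta>) * (\<Sum>k\<le>m. poisson_weight r k) - exp (- (\<delta>\<^sup>2 / 4 * r)) \<le> late_probability c n X Y" for m
  proof -
    have fin: "finite (A m)" by (rule finite_subset[of _ "{..m}"]) (auto simp: A_def)
    have tail: "(\<Sum>k\<in>A m. poisson_weight r k) \<le> exp (- (\<delta>\<^sup>2 / 4 * r))"
      by (rule poisson_deviation[OF r(1) fin \<delta>]) (auto simp: A_def)
    have "(1 - \<eta>) * (\<Sum>k\<le>m. poisson_weight r k) = (1 - \<eta>) * (\<Sum>k\<in>{..m} - A m. poisson_weight r k) + (1 - \<eta>) * (\<Sum>k\<in>A m. poisson_weight r k)"
      by (subst sum.subset_diff[of "A m" "{..m}"]) (auto simp: A_def distrib_left)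
    also have "(1 - \<eta>) * (\<Sum>k\<in>A m. poisson_weight r k) \<le> 1 * exp (- (\<delta>\<^sup>2 / 4 * r))"
      using tail \<eta> poisson_weight_nonneg[OF r(1)] by (intro mult_mono sum_nonneg) auto
    also have "(1 - \<eta>) * (\<Sum>k\<in>{..m} - A m. poisson_weight r k) \<le> (\<Sum>k\<in>{..m} - A m. poisson_weight r k * survival n k (initial_config X Y))"
      unfolding sum_distrib_left
    proof (rule sum_mono)
      fix k assume "k \<in> {..m} - A m"
      then have "1 - \<eta> \<le> survival n k (initial_config X Y)" using surv r(2) by (auto simp: A_def)
      then show "(1 - \<eta>) * poisson_weight r k \<le> poisson_weight r k * survival n k (initial_config X Y)"
        unfolding mult.commute[of "1 - \<eta>"] using poisson_weight_nonneg[OF r(1)] by (intro mult_left_mono) auto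
    qed
    also have "\<dots> \<le> (\<Sum>k\<le>m. poisson_weight r k * survival n k (initial_config X Y))"
      using survival_nonneg poisson_weight_nonneg[OF r(1)] by (intro sum_mono2) auto
    also have "\<dots> = (\<Sum>k\<le>m. exp (- (real n * (c' * ln (real n)))) * (real n * (c' * ln (real n))) ^ k / fact k *
        (step_mean n ^^ k) (indicator {\<sigma>. \<not> consensus n \<sigma>}) (initial_config X Y))"
      by (simp add: survival_def poisson_weight_def r_def)
    also have "\<dots> \<le> late_probability c n X Y"
      using c n by (intro prob_consensus_time_gt_ge) auto
    finally show ?thesis by simp
  qed
  have "(\<lambda>m. (1 - \<eta>) * (\<Sum>k\<le>m. poisson_weight r k) - exp (- (\<delta>\<^sup>2 / 4 * r))) \<longlonglongrightarrow> (1 - \<eta>) * 1 - exp (- (\<delta>\<^sup>2 / 4 * r))"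
    by (intro tendsto_intros poisson_weight_sum_tendsto)
  then have "(1 - \<eta>) * 1 - exp (- (\<delta>\<^sup>2 / 4 * r)) \<le> late_probability c n X Y"
    by (rule LIMSEQ_le_const2) (use bound in auto)
  then show ?thesis by (simp add: r)
qed

lemma exp_n_ln_n_small:
  assumes "0 < a" "0 < \<eta>"
  shows "\<forall>\<^sub>F n in sequentially. exp (- (a * (real n * ln (real n)))) < \<eta>"
proof -
  have "filterlim (\<lambda>n. a * (real n * ln (real n))) at_top sequentially"
    using assms by (intro filterlim_tendsto_pos_mult_at_top[OF tendsto_const] filterlim_n_ln_n) auto
  then have "(\<lambda>n. exp (- (a * (real n * ln (real n))))) \<longlonglongrightarrow> 0"
    by (intro filterlim_compose[OF exp_at_bot]) (simp add: filterlim_uminus_at_bot)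
  then show ?thesis using assms by (intro order_tendstoD(2)) auto
qed

lemma late_probability_le_1: "late_probability c n X Y \<le> 1"
  using prob_space.prob_le_1[OF prob_space_naming_space] .

lemma consensus_const_growth_rate: "consensus_const = 1 + 1 / (2 * growth_rate)"
  by (simp add: consensus_const_def inverse_eq_divide algebra_simps)

theorem theorem2:
  fixes \<alpha> :: real
  assumes "\<alpha> > 0"
  shows "(\<lambda>n. SUP (X, Y, Z) \<in> {(X, Y, Z). X + Y + Z = n}.
            \<P>(\<omega> in naming_space n.
              consensus_time n X Y \<omega> / ereal (ln (real n)) > ereal (consensus_const + \<alpha>)))
           \<longlonglongrightarrow> 0
         \<and>
         (\<lambda>n. SUP (X, Y, Z) \<in> {(X, Y, Z). X + Y + Z = n}.
            \<P>(\<omega> in naming_space n.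
              consensus_time n X Y \<omega> / ereal (ln (real n)) > ereal (consensus_const - \<alpha>)))
           \<longlonglongrightarrow> 1"
proof
  let ?\<gamma> = "consensus_const"
  let ?S = "\<lambda>n. {(X, Y, Z). X + Y + Z = n} :: (nat \<times> nat \<times> nat) set"
  have \<gamma>: "0 < ?\<gamma>" unfolding consensus_const_growth_rate using sqrt5_bounds by (simp add: add_pos_pos)
  have ne: "(n, 0, 0) \<in> ?S n" for n by simp
  have bdd: "bdd_above ((\<lambda>(X, Y, Z). late_probability c n X Y) ` ?S n)" for c n
    using late_probability_le_1 by (intro bdd_aboveI2[of _ _ 1]) auto
  have SUP0: "0 \<le> (SUP (X, Y, Z)\<in>?S n. late_probability c n X Y)" for c n
    by (rule cSUP_upper2[OF bdd ne]) simp
  have SUP1: "(SUP (X, Y, Z)\<in>?S n. late_probability c n X Y) \<le> b"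
    if "\<And>X Y. late_probability c n X Y \<le> b" for c n b
  proof (rule cSUP_least)
    show "?S n \<noteq> {}" using ne by blast
  qed (use that in auto)
  show "(\<lambda>n. SUP (X, Y, Z)\<in>?S n. late_probability (?\<gamma> + \<alpha>) n X Y) \<longlonglongrightarrow> 0"
  proof (rule LIMSEQ_I)
    fix \<eta> :: real assume \<eta>: "0 < \<eta>"
    define c \<delta> where "c = ?\<gamma> + \<alpha>" and "\<delta> = \<alpha> / (2 * c)"
    have c: "0 < c" using \<gamma> assms by (simp add: c_def)
    have \<delta>: "0 < \<delta>" "\<delta> \<le> 1" "(1 - \<delta>) * c = ?\<gamma> + \<alpha> / 2"
      using c assms \<gamma> by (auto simp: \<delta>_def c_def field_simps)
    have fast: "fast_consensus (\<eta> / 3) (?\<gamma> + \<alpha> / 2) (\<lambda>_ _. True)"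
      using assms \<eta> by (intro fast_consensus_from_anywhere) (auto simp: consensus_const_growth_rate)
    have "\<forall>\<^sub>F n in sequentially. exp (- (\<delta>\<^sup>2 / 4 * c * (real n * ln (real n)))) < \<eta> / 3"
      using \<delta> c \<eta> by (intro exp_n_ln_n_small) auto
    then have "\<forall>\<^sub>F n in sequentially. norm ((SUP (X, Y, Z)\<in>?S n. late_probability c n X Y) - 0) < \<eta>"
      using fast[unfolded fast_consensus_def] eventually_ge_at_top[of 2]
    proof eventually_elim
      case (elim n)
      have "late_probability c n X Y \<le> \<eta> / 3 + exp (- (\<delta>\<^sup>2 / 4 * (c * (real n * ln (real n)))))" for X Y
      proof (rule late_probability_upper[OF elim(3) c \<delta>(1,2)])
        fix k assume "(1 - \<delta>) * (c * (real n * ln (real n))) \<le> real k"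
        then have "(?\<gamma> + \<alpha> / 2) * (real n * ln (real n)) \<le> real k"
          unfolding \<delta>(3)[symmetric] by (simp only: mult.assoc)
        then show "survival n k (initial_config X Y) \<le> \<eta> / 3" using elim(2) initial_config_valid by blast
      qed (use \<eta> in simp)
      then have "(SUP (X, Y, Z)\<in>?S n. late_probability c n X Y) \<le> \<eta> / 3 + exp (- (\<delta>\<^sup>2 / 4 * (c * (real n * ln (real n)))))"
        by (rule SUP1)
      also have "\<dots> < \<eta>" using elim(1) \<eta> by (simp add: mult.assoc)
      finally show ?case using SUP0[of n c] by simp
    qed
    then show "\<exists>no. \<forall>n\<ge>no. norm ((SUP (X, Y, Z)\<in>?S n. late_probability (?\<gamma> + \<alpha>) n X Y) - 0) < \<eta>"
      by (simp add: eventually_sequentially c_def)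
  qed
  show "(\<lambda>n. SUP (X, Y, Z)\<in>?S n. late_probability (?\<gamma> - \<alpha>) n X Y) \<longlonglongrightarrow> 1"
  proof (rule LIMSEQ_I)
    fix \<eta>' :: real assume \<eta>': "0 < \<eta>'"
    define \<eta> where "\<eta> = min 1 \<eta>'"
    have \<eta>: "0 < \<eta>" "\<eta> \<le> 1" "\<eta> \<le> \<eta>'" using \<eta>' by (auto simp: \<eta>_def)
    \<comment> \<open>The second term keeps the time \<open>c' ln n\<close> positive when \<open>\<alpha>\<close> is large.\<close>
    define c c' where "c = ?\<gamma> - \<alpha>" and "c' = max (?\<gamma> - \<alpha> / 2) (?\<gamma> / 2)"
    have c: "c < c'" "0 < c'" "c' < ?\<gamma>" using \<gamma> assms by (auto simp: c_def c'_def max_def)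
    define \<delta> where "\<delta> = min 1 ((?\<gamma> - c') / (2 * c'))"
    have \<delta>0: "0 < \<delta>" "\<delta> \<le> 1" using c by (auto simp: \<delta>_def)
    have "\<delta> * c' \<le> (?\<gamma> - c') / (2 * c') * c'" using c by (intro mult_right_mono) (auto simp: \<delta>_def)
    also have "\<dots> = (?\<gamma> - c') / 2" using c by simp
    finally have \<delta>: "(1 + \<delta>) * c' \<le> (?\<gamma> + c') / 2" by (simp add: field_simps)
    have slow: "\<forall>\<^sub>F n in sequentially. \<forall>\<sigma> k. valid n \<sigma> \<longrightarrow> lead n \<sigma> = 0 \<longrightarrow>
        real k \<le> (?\<gamma> + c') / 2 * (real n * ln (real n)) \<longrightarrow> 1 - \<eta> / 3 \<le> survival n k \<sigma>"
    proof (rule slow_consensus)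
      show "(?\<gamma> + c') / 2 < 1 + 1 / (2 * growth_rate)"
        unfolding consensus_const_growth_rate[symmetric] using c by simp
    qed (use \<eta> in simp)
    have "\<forall>\<^sub>F n in sequentially. exp (- (\<delta>\<^sup>2 / 4 * c' * (real n * ln (real n)))) < \<eta> / 3"
      using \<delta>0 c \<eta> by (intro exp_n_ln_n_small) auto
    then have "\<forall>\<^sub>F n in sequentially. norm ((SUP (X, Y, Z)\<in>?S n. late_probability c n X Y) - 1) < \<eta>'"
      using slow eventually_ge_at_top[of 2]
    proof eventually_elim
      case (elim n)
      define X where "X = n div 2"
      have XS: "(X, X, n - 2 * X) \<in> ?S n" by (simp add: X_def)
      have lead0: "lead n (initial_config X X) = 0"
        using initial_config_lead[of X X "n - 2 * X" n] XS by simp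
      have l: "0 \<le> real n * ln (real n)" using elim(3) by simp
      have "1 - \<eta> / 3 - exp (- (\<delta>\<^sup>2 / 4 * (c' * (real n * ln (real n))))) \<le> late_probability c n X X"
      proof (rule late_probability_lower[OF elim(3) c(1,2) \<delta>0])
        fix k assume "real k \<le> (1 + \<delta>) * (c' * (real n * ln (real n)))"
        also have "\<dots> = ((1 + \<delta>) * c') * (real n * ln (real n))" by (simp only: mult.assoc)
        also have "\<dots> \<le> (?\<gamma> + c') / 2 * (real n * ln (real n))" using \<delta> l by (rule mult_right_mono)
        finally show "1 - \<eta> / 3 \<le> survival n k (initial_config X X)"
          using elim(2) initial_config_valid lead0 by blast
      qed (use \<eta> in auto)
      moreover have "late_probability c n X X \<le> (SUP (X, Y, Z)\<in>?S n. late_probability c n X Y)"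
        by (rule cSUP_upper2[OF bdd XS]) simp
      moreover have "exp (- (\<delta>\<^sup>2 / 4 * (c' * (real n * ln (real n))))) < \<eta> / 3"
        using elim(1) by (simp add: mult.assoc)
      ultimately have "1 - \<eta> < (SUP (X, Y, Z)\<in>?S n. late_probability c n X Y)" using \<eta> by linarith
      moreover have "(SUP (X, Y, Z)\<in>?S n. late_probability c n X Y) \<le> 1"
        by (rule SUP1[OF late_probability_le_1])
      ultimately show ?case using \<eta> by simp
    qed
    then show "\<exists>no. \<forall>n\<ge>no. norm ((SUP (X, Y, Z)\<in>?S n. late_probability (?\<gamma> - \<alpha>) n X Y) - 1) < \<eta>'"
      by (simp add: eventually_sequentially c_def)
  qed
qed

end
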